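(* Let $\Gamma$ be a finite simple graph, $A_\Gamma$ the associated right-angled Artin group, and $\phi\in\mathrm{Aut}(A_\Gamma)$ a length-preserving automorphism. Then the $\phi$-twisted conjugacy problem $\mathrm{TCP}_\phi(A_\Gamma)$ is solvable. Moreover, when $\phi$ is a composition of inversions, it is decidable in linear time, on a RAM machine, whether two elements of $A_\Gamma$ (given as words over $V(\Gamma)^{\pm}$) are $\phi$-twisted conjugate.
   Context: The right-angled Artin group is $A_\Gamma = \langle V(\Gamma) \mid [s,t]=1 \text{ for all } \{s,t\}\in E(\Gamma)\rangle$, with $X=V(\Gamma)\cup V(\Gamma)^{-1}$. $\phi$ is length-preserving if $|\phi(g)|=|g|$ for all $g\in A_\Gamma$, where $|\cdot|$ is word length over $X$. An inversion is the automorphism sending one vertex $x$ to $x^{-1}$ and fixing all other vertices. Elements $u,v\in A_\Gamma$ are $\phi$-twisted conjugate if $v=\phi(w)^{-1}uw$ for some $w\in A_\Gamma$; $\mathrm{TCP}_\phi(A_\Gamma)$ asks for an algorithm that, given two words over $X$, decides whether they represent $\phi$-twisted conjugate elements. Complexity is measured in the total length of the input words on a random access machine, where basic arithmetic operations on integers take constant time. *)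

theory Defs
  imports Main
begin

text \<open>The graph has vertex set {0..<n}; E is the edge relation.
  Letters of X = V \<union> V^-1 are nonzero integers: vertex v is the letter int v + 1,
  its inverse is -(int v + 1).\<close>

definition simple_graph :: "nat \<Rightarrow> (nat \<Rightarrow> nat \<Rightarrow> bool) \<Rightarrow> bool" where
  "simple_graph n E \<longleftrightarrow> (\<forall>u v. E u v \<longrightarrow> u < n \<and> v < n \<and> u \<noteq> v \<and> E v u)"

definition vtx :: "int \<Rightarrow> nat" where
  "vtx a = nat \<bar>a\<bar> - 1"

definition valid_letter :: "nat \<Rightarrow> int \<Rightarrow> bool" where
  "valid_letter n a \<longleftrightarrow> a \<noteq> 0 \<and> nat \<bar>a\<bar> \<le> n"

definition valid_word :: "nat \<Rightarrow> int list \<Rightarrow> bool" where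
  "valid_word n w \<longleftrightarrow> (\<forall>a\<in>set w. valid_letter n a)"

definition inv_word :: "int list \<Rightarrow> int list" where
  "inv_word w = rev (map uminus w)"

inductive raag_step :: "nat \<Rightarrow> (nat \<Rightarrow> nat \<Rightarrow> bool) \<Rightarrow> int list \<Rightarrow> int list \<Rightarrow> bool"
  for n E where
  cancel: "valid_letter n a \<Longrightarrow> raag_step n E (xs @ [a, -a] @ ys) (xs @ ys)"
| commute: "valid_letter n a \<Longrightarrow> valid_letter n b \<Longrightarrow> E (vtx a) (vtx b) \<Longrightarrow>
            raag_step n E (xs @ [a, b] @ ys) (xs @ [b, a] @ ys)"

definition raag_eq :: "nat \<Rightarrow> (nat \<Rightarrow> nat \<Rightarrow> bool) \<Rightarrow> int list \<Rightarrow> int list \<Rightarrow> bool" where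
  "raag_eq n E = equivclp (raag_step n E)"

definition raag_len :: "nat \<Rightarrow> (nat \<Rightarrow> nat \<Rightarrow> bool) \<Rightarrow> int list \<Rightarrow> nat" where
  "raag_len n E w = (LEAST k. \<exists>w'. valid_word n w' \<and> length w' = k \<and> raag_eq n E w w')"

definition hom :: "(nat \<Rightarrow> int list) \<Rightarrow> int list \<Rightarrow> int list" where
  "hom f w = concat (map (\<lambda>a. if a > 0 then f (vtx a) else inv_word (f (vtx a))) w)"

definition raag_aut :: "nat \<Rightarrow> (nat \<Rightarrow> nat \<Rightarrow> bool) \<Rightarrow> (nat \<Rightarrow> int list) \<Rightarrow> bool" where
  "raag_aut n E f \<longleftrightarrow>
     (\<forall>v<n. valid_word n (f v)) \<and>
     (\<forall>w w'. valid_word n w \<longrightarrow> valid_word n w' \<longrightarrow> raag_eq n E w w' \<longrightarrow> raag_eq n E (hom f w) (hom f w')) \<and>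
     (\<forall>w w'. valid_word n w \<longrightarrow> valid_word n w' \<longrightarrow> raag_eq n E (hom f w) (hom f w') \<longrightarrow> raag_eq n E w w') \<and>
     (\<forall>w. valid_word n w \<longrightarrow> (\<exists>w'. valid_word n w' \<and> raag_eq n E (hom f w') w))"

definition length_preserving :: "nat \<Rightarrow> (nat \<Rightarrow> nat \<Rightarrow> bool) \<Rightarrow> (nat \<Rightarrow> int list) \<Rightarrow> bool" where
  "length_preserving n E f \<longleftrightarrow> (\<forall>w. valid_word n w \<longrightarrow> raag_len n E (hom f w) = raag_len n E w)"

definition inversion :: "nat \<Rightarrow> nat \<Rightarrow> int list" where
  "inversion x = (\<lambda>v. if v = x then [- (int v + 1)] else [int v + 1])"

inductive comp_inversions :: "nat \<Rightarrow> (nat \<Rightarrow> int list) \<Rightarrow> bool" for n where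
  base: "x < n \<Longrightarrow> comp_inversions n (inversion x)"
| comp: "comp_inversions n g \<Longrightarrow> comp_inversions n h \<Longrightarrow> comp_inversions n (\<lambda>v. hom g (h v))"

definition is_comp_of_inversions :: "nat \<Rightarrow> (nat \<Rightarrow> nat \<Rightarrow> bool) \<Rightarrow> (nat \<Rightarrow> int list) \<Rightarrow> bool" where
  "is_comp_of_inversions n E f \<longleftrightarrow>
     (\<exists>g. comp_inversions n g \<and> (\<forall>v<n. raag_eq n E (f v) (g v)))"

definition twisted_conj :: "nat \<Rightarrow> (nat \<Rightarrow> nat \<Rightarrow> bool) \<Rightarrow> (nat \<Rightarrow> int list) \<Rightarrow> int list \<Rightarrow> int list \<Rightarrow> bool" where
  "twisted_conj n E f u v \<longleftrightarrow>
     (\<exists>w. valid_word n w \<and> raag_eq n E v (inv_word (hom f w) @ u @ w))"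

text \<open>Registers indexed by nat hold integers; arithmetic takes unit time;
  indirect addressing via Load/Store. Execution halts when pc leaves the program.\<close>
datatype instr =
    Const nat int
  | Add nat nat nat
  | Sub nat nat nat
  | Mul nat nat nat
  | Div nat nat nat
  | Load nat nat
  | Store nat nat
  | Jz nat nat
  | Jmp nat

type_synonym config = "nat \<times> (nat \<Rightarrow> int)"

fun step :: "instr list \<Rightarrow> config \<Rightarrow> config" where
  "step P (pc, M) =
    (if length P \<le> pc then (pc, M) else
     (case P ! pc of
        Const r k \<Rightarrow> (pc + 1, M(r := k))
      | Add r a b \<Rightarrow> (pc + 1, M(r := M a + M b))
      | Sub r a b \<Rightarrow> (pc + 1, M(r := M a - M b))
      | Mul r a b \<Rightarrow> (pc + 1, M(r := M a * M b))
      | Div r a b \<Rightarrow> (pc + 1, M(r := M a div M b))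
      | Load r a \<Rightarrow> (pc + 1, M(r := M (nat (M a))))
      | Store a r \<Rightarrow> (pc + 1, M(nat (M a) := M r))
      | Jz r l \<Rightarrow> (if M r = 0 then l else pc + 1, M)
      | Jmp l \<Rightarrow> (l, M)))"

definition exec :: "instr list \<Rightarrow> nat \<Rightarrow> config \<Rightarrow> config" where
  "exec P t c = (step P ^^ t) c"

definition init :: "int list \<Rightarrow> config" where
  "init inp = (0, \<lambda>i. if i = 0 then int (length inp)
                      else if i \<le> length inp then inp ! (i - 1) else 0)"

definition outputs_in :: "instr list \<Rightarrow> int list \<Rightarrow> nat \<Rightarrow> bool \<Rightarrow> bool" where
  "outputs_in P inp t b \<longleftrightarrow>
     length P \<le> fst (exec P t (init inp)) \<and>
     snd (exec P t (init inp)) 0 = (if b then 1 else 0)"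

text \<open>Encoding of a pair of words (letters are nonzero, 0 is a separator).\<close>
definition encode_pair :: "int list \<Rightarrow> int list \<Rightarrow> int list" where
  "encode_pair u v = u @ [0] @ v"

definition solves_TCP :: "nat \<Rightarrow> (nat \<Rightarrow> nat \<Rightarrow> bool) \<Rightarrow> (nat \<Rightarrow> int list) \<Rightarrow> instr list \<Rightarrow> bool" where
  "solves_TCP n E f P \<longleftrightarrow>
     (\<forall>u v. valid_word n u \<longrightarrow> valid_word n v \<longrightarrow>
        (\<exists>t. outputs_in P (encode_pair u v) t (twisted_conj n E f u v)))"

definition solves_TCP_linear :: "nat \<Rightarrow> (nat \<Rightarrow> nat \<Rightarrow> bool) \<Rightarrow> (nat \<Rightarrow> int list) \<Rightarrow> instr list \<Rightarrow> nat \<Rightarrow> bool" where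
  "solves_TCP_linear n E f P c \<longleftrightarrow>
     (\<forall>u v. valid_word n u \<longrightarrow> valid_word n v \<longrightarrow>
        (\<exists>t. t \<le> c * (length u + length v + 1) \<and>
             outputs_in P (encode_pair u v) t (twisted_conj n E f u v)))"

end

theory Submission
  imports Defs
begin

text \<open>A length-preserving automorphism acts on generators by a map \<open>F\<close> of letters. A group
element is determined by its piling: one stack per vertex, holding the signs of the occurrences of
that vertex and a zero for each occurrence of a vertex not commuting with it.

If \<open>w\<close> conjugates \<open>u\<close> to \<open>v\<close>, then every left greedy prefix \<open>p\<close> of \<open>w\<close> conjugates \<open>u\<close> to an
element whose length is bounded in terms of \<open>n\<close>, \<open>|u|\<close> and \<open>|v|\<close>. By the pigeonhole principle two
of these elements coincide unless \<open>w\<close> is short, so a shortest conjugator is found by exhaustive search.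

If \<open>F\<close> only inverts letters, peak reduction shows that two elements of minimal length in
their classes are twisted conjugate if and only if they are related by rotations
\<open>a w \<mapsto> w F(a)\<close>. On each connected component of the support one vertex, the apex, is rotated only
when nothing else can be; this greedy rotation meets all elements at which only the apex is
movable within linearly many steps, because any legal sequence of rotations can be reordered
into the greedy one. A stack is kept as a base 3 number together with a power of 3, so that a stack
operation takes a bounded number of instructions.\<close>

subsection \<open>A loop language for the RAM\<close>

text \<open>Conjugating \<open>u\<close> to \<open>v\<close> by \<open>w\<close> means
  \<open>u w = F(w) v\<close>. As \<open>F\<close> respects commutation, it maps the greedy layers
  of \<open>w\<close> to those of its image, and multiplying by one letter on either side displaces
  every layer prefix by a bounded word only. Both products have the same layers, hence the bound on
  the intermediate elements. For inversions, trying all rotations would be too slow: if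
  \<open>a\<close> and \<open>c\<close> commute and \<open>b\<close> commutes with neither, a word
  with \<open>m\<close> letters \<open>a\<close>, \<open>m\<close> letters \<open>c\<close> and one
  \<open>b\<close> has quadratically many rotated forms. The apex cuts this down. Of two
  non-commuting vertices, one can be rotated at most about one full turn more than the other, so in
  a connected support holding the apex still stops everything after at most \<open>n\<close> turns.
  Greedy rotation visits the states in which only the apex can move in a fixed cyclic order; since
  \<open>F\<close> is then an involution, two turns are a period. On the machine the obstacle is
  that the input fills the low registers, so it has to be moved away before any variable
  exists.\<close>

datatype aexp =
    Num int
  | Var nat
  | Plus aexp aexp
  | Minus aexp aexp
  | Times aexp aexp
  | Quot aexp aexp

datatype com =
    Skip
  | Assign nat aexp
  | Read nat nat
  | Seq com com
  | Cond aexp com com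
  | Loop aexp com

primrec aval :: "aexp \<Rightarrow> (nat \<Rightarrow> int) \<Rightarrow> int" where
  "aval (Num k) s = k"
| "aval (Var x) s = s x"
| "aval (Plus a b) s = aval a s + aval b s"
| "aval (Minus a b) s = aval a s - aval b s"
| "aval (Times a b) s = aval a s * aval b s"
| "aval (Quot a b) s = aval a s div aval b s"

text \<open>The input is the read-only function \<open>g\<close>, separate from the registers
  \<open>s\<close>. A loop count is evaluated once on entry, so every program terminates and its
  meaning is a plain function; algorithms can then be verified without program counters.\<close>

primrec sem :: "(int \<Rightarrow> int) \<Rightarrow> com \<Rightarrow> (nat \<Rightarrow> int) \<Rightarrow> (nat \<Rightarrow> int)" where
  "sem g Skip s = s"
| "sem g (Assign x e) s = s(x := aval e s)"
| "sem g (Read x y) s = s(x := g (s y))"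
| "sem g (Seq a b) s = sem g b (sem g a s)"
| "sem g (Cond e a b) s = (if aval e s \<noteq> 0 then sem g a s else sem g b s)"
| "sem g (Loop e c) s = (sem g c ^^ nat (aval e s)) s"

text \<open>Number of emitted instructions. The jump targets in \<open>comp_com\<close> are computed
  from it, and it also bounds the temporaries that an expression occupies.\<close>

primrec esize :: "aexp \<Rightarrow> nat" where
  "esize (Num k) = 1"
| "esize (Var x) = 2"
| "esize (Plus a b) = esize a + esize b + 1"
| "esize (Minus a b) = esize a + esize b + 1"
| "esize (Times a b) = esize a + esize b + 1"
| "esize (Quot a b) = esize a + esize b + 1"

primrec csize :: "com \<Rightarrow> nat" where
  "csize Skip = 0"
| "csize (Assign x e) = esize e + 2"
| "csize (Read x y) = 9"
| "csize (Seq a b) = csize a + csize b"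
| "csize (Cond e a b) = esize e + csize a + csize b + 2"
| "csize (Loop e c) = esize e + csize c + 10"

text \<open>In \<open>Loop\<close>, the 7 counts six instructions that clamp the counter and the
  final test; the 4 counts the test, the decrement in two instructions and the jump back.
  \<open>Read\<close> is charged with its code length.\<close>

primrec cost :: "(int \<Rightarrow> int) \<Rightarrow> com \<Rightarrow> (nat \<Rightarrow> int) \<Rightarrow> nat" where
  "cost g Skip s = 0"
| "cost g (Assign x e) s = esize e + 2"
| "cost g (Read x y) s = 9"
| "cost g (Seq a b) s = cost g a s + cost g b (sem g a s)"
| "cost g (Cond e a b) s = esize e + 2 + (if aval e s \<noteq> 0 then cost g a s else cost g b s)"
| "cost g (Loop e c) s =
     esize e + 7 + (\<Sum>i<nat (aval e s). cost g c ((sem g c ^^ i) s) + 4)"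

primrec evars :: "aexp \<Rightarrow> nat set" where
  "evars (Num k) = {}"
| "evars (Var x) = {x}"
| "evars (Plus a b) = evars a \<union> evars b"
| "evars (Minus a b) = evars a \<union> evars b"
| "evars (Times a b) = evars a \<union> evars b"
| "evars (Quot a b) = evars a \<union> evars b"

primrec cvars :: "com \<Rightarrow> nat set" where
  "cvars Skip = {}"
| "cvars (Assign x e) = insert x (evars e)"
| "cvars (Read x y) = {x, y}"
| "cvars (Seq a b) = cvars a \<union> cvars b"
| "cvars (Cond e a b) = evars e \<union> cvars a \<union> cvars b"
| "cvars (Loop e c) = evars e \<union> cvars c"

text \<open>Registers 0 to 2 are reserved: 0 keeps the value 0 during the run,
  1 holds the address of the relocated input prefix, 2 the input length.\<close>

primrec safe :: "com \<Rightarrow> bool" where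
  "safe Skip = True"
| "safe (Assign x e) = (3 \<le> x)"
| "safe (Read x y) = (3 \<le> x)"
| "safe (Seq a b) = (safe a \<and> safe b)"
| "safe (Cond e a b) = (safe a \<and> safe b)"
| "safe (Loop e c) = safe c"

lemma aval_cong: "\<forall>x\<in>evars e. M x = M' x \<Longrightarrow> aval e M = aval e M'"
  by (induction e) auto

lemma finite_evars: "finite (evars e)"
  by (induction e) auto

lemma finite_cvars: "finite (cvars c)"
  by (induction c) (auto simp: finite_evars)

lemma sem_safe: "safe c \<Longrightarrow> r < 3 \<Longrightarrow> sem g c s r = s r"
proof (induction c arbitrary: s)
  case (Loop e c)
  have "(sem g c ^^ m) s r = s r" for m
    by (induction m) (use Loop in auto)
  then show ?case by simp
qed auto

lemma aval_upd: "k \<notin> evars e \<Longrightarrow> aval e (s(k := v)) = aval e s"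
  by (intro aval_cong) auto

text \<open>Needed for loop counters: a counter occupies a register that the body does not mention,
  so writing it does not disturb the body.\<close>

lemma sem_upd: "k \<notin> cvars c \<Longrightarrow> sem g c (s(k := v)) = (sem g c s)(k := v)"
proof (induction c arbitrary: s)
  case (Assign x e)
  then show ?case by (simp add: aval_upd fun_upd_twist del: fun_upd_apply)
next
  case (Cond e a b)
  then show ?case by (simp add: aval_upd del: fun_upd_apply)
next
  case (Loop e c)
  have "(sem g c ^^ m) (s(k := v)) = ((sem g c ^^ m) s)(k := v)" for m
    by (induction m) (use Loop in auto)
  then show ?case using Loop.prems by (simp add: aval_upd del: fun_upd_apply)
qed (auto simp: fun_upd_twist)

lemma cost_upd: "k \<notin> cvars c \<Longrightarrow> cost g c (s(k := v)) = cost g c s"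
proof (induction c arbitrary: s)
  case (Seq a b)
  then show ?case by (simp add: sem_upd del: fun_upd_apply)
next
  case (Cond e a b)
  then show ?case by (simp add: aval_upd del: fun_upd_apply)
next
  case (Loop e c)
  have "(sem g c ^^ m) (s(k := v)) = ((sem g c ^^ m) s)(k := v)" for m
    by (induction m) (use Loop in \<open>auto simp: sem_upd simp del: fun_upd_apply\<close>)
  then show ?case using Loop by (simp add: aval_upd del: fun_upd_apply)
qed auto

text \<open>Registers from \<open>d\<close> on serve as an evaluation stack, with the value left in
  \<open>d\<close>. A copy is an addition to 0, since there is no move instruction.\<close>

primrec comp_exp :: "nat \<Rightarrow> aexp \<Rightarrow> instr list" where
  "comp_exp d (Num k) = [Const d k]"
| "comp_exp d (Var x) = [Const d 0, Add d d x]"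
| "comp_exp d (Plus a b) = comp_exp d a @ comp_exp (Suc d) b @ [Add d d (Suc d)]"
| "comp_exp d (Minus a b) = comp_exp d a @ comp_exp (Suc d) b @ [Sub d d (Suc d)]"
| "comp_exp d (Times a b) = comp_exp d a @ comp_exp (Suc d) b @ [Mul d d (Suc d)]"
| "comp_exp d (Quot a b) = comp_exp d a @ comp_exp (Suc d) b @ [Div d d (Suc d)]"

text \<open>The instruction set has no sign test; \<open>x div (x * x + 1)\<close> is 0 for \<open>x \<ge> 0\<close> and
  -1 otherwise. Loop counters are clamped at 0 and input addresses are compared
  with \<open>K\<close> by means of such quotients.\<close>

primrec comp_com :: "nat \<Rightarrow> nat \<Rightarrow> nat \<Rightarrow> com \<Rightarrow> instr list" where
  "comp_com K k pc Skip = []"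
| "comp_com K k pc (Assign x e) = comp_exp k e @ [Const (Suc k) 0, Add x k (Suc k)]"
| "comp_com K k pc (Read x y) =
     [Const k 1, Sub (Suc k) y k, Const k (int K), Div k (Suc k) k,
      Jz k (pc + 7), Load x y, Jmp (pc + 9), Add (Suc k) (Suc k) 1, Load x (Suc k)]"
| "comp_com K k pc (Seq a b) = comp_com K k pc a @ comp_com K k (pc + csize a) b"
| "comp_com K k pc (Cond e a b) =
     comp_exp k e @ [Jz k (pc + esize e + csize a + 2)] @
     comp_com K k (pc + esize e + 1) a @
     [Jmp (pc + esize e + csize a + csize b + 2)] @
     comp_com K k (pc + esize e + csize a + 2) b"
| "comp_com K k pc (Loop e c) =
     comp_exp k e @
     [Mul (k + 1) k k, Const (k + 2) 1, Add (k + 1) (k + 1) (k + 2),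
      Div (k + 1) k (k + 1), Add (k + 1) (k + 1) (k + 2), Mul k k (k + 1)] @
     [Jz k (pc + esize e + csize c + 10)] @
     comp_com K (Suc k) (pc + esize e + 7) c @
     [Const (Suc k) 1, Sub k k (Suc k), Jmp (pc + esize e + 6)]"

lemma length_comp_exp [simp]: "length (comp_exp d e) = esize e"
  by (induction e arbitrary: d) auto

lemma length_comp_com [simp]: "length (comp_com K k pc c) = csize c"
  by (induction c arbitrary: k pc) auto

section \<open>Correctness of the compiled code\<close>

primrec eff :: "instr \<Rightarrow> (nat \<Rightarrow> int) \<Rightarrow> (nat \<Rightarrow> int)" where
  "eff (Const r k) M = M(r := k)"
| "eff (Add r a b) M = M(r := M a + M b)"
| "eff (Sub r a b) M = M(r := M a - M b)"
| "eff (Mul r a b) M = M(r := M a * M b)"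
| "eff (Div r a b) M = M(r := M a div M b)"
| "eff (Load r a) M = M(r := M (nat (M a)))"
| "eff (Store a r) M = M(nat (M a) := M r)"
| "eff (Jz r l) M = M"
| "eff (Jmp l) M = M"

fun straight :: "instr \<Rightarrow> bool" where
  "straight (Jz r l) = False"
| "straight (Jmp l) = False"
| "straight _ = True"

definition code_at :: "instr list \<Rightarrow> nat \<Rightarrow> instr list \<Rightarrow> bool" where
  "code_at P pc cs \<longleftrightarrow> (\<exists>pre post. P = pre @ cs @ post \<and> length pre = pc)"

lemma code_at_append:
  "code_at P pc (a @ b) \<Longrightarrow> code_at P pc a \<and> code_at P (pc + length a) b"
  unfolding code_at_def
  by (metis append.assoc length_append)

lemma code_at_appendD: "code_at P pc (a @ b) \<Longrightarrow> pc' = pc + length a \<Longrightarrow> code_at P pc' b"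
  using code_at_append by blast

lemma code_at_Cons:
  assumes "code_at P pc (i # is)"
  shows "pc < length P" "P ! pc = i" "code_at P (Suc pc) is"
proof -
  obtain pre post where P: "P = pre @ (i # is) @ post" "length pre = pc"
    using assms unfolding code_at_def by auto
  then show "pc < length P" "P ! pc = i" by (auto simp: nth_append)
  have "P = (pre @ [i]) @ is @ post" "length (pre @ [i]) = Suc pc" using P by auto
  then show "code_at P (Suc pc) is" unfolding code_at_def by blast
qed

text \<open>Only an upper bound on the number of steps, so that branches of different length can be
  charged the same \<open>cost\<close>.\<close>

definition runs :: "instr list \<Rightarrow> config \<Rightarrow> config \<Rightarrow> nat \<Rightarrow> bool" where
  "runs P c c' t \<longleftrightarrow> (\<exists>t'\<le>t. exec P t' c = c')"

lemma runs_refl [simp]: "runs P c c t"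
  unfolding runs_def exec_def by (intro exI[of _ 0]) auto

lemma runs_trans [trans]:
  assumes "runs P a b t1" "runs P b c t2"
  shows "runs P a c (t1 + t2)"
proof -
  obtain t1' t2' where t: "t1' \<le> t1" "t2' \<le> t2"
    and e: "(step P ^^ t1') a = b" "(step P ^^ t2') b = c"
    using assms unfolding runs_def exec_def by auto
  have "(step P ^^ (t2' + t1')) a = c"
    using e by (simp add: funpow_add)
  then show ?thesis
    unfolding runs_def exec_def using t by (intro exI[of _ "t2' + t1'"]) auto
qed

lemma runs_mono: "runs P a b t \<Longrightarrow> t \<le> t' \<Longrightarrow> runs P a b t'"
  unfolding runs_def using le_trans by blast

lemma runs_step: "step P c = c' \<Longrightarrow> runs P c c' 1"
  unfolding runs_def exec_def by (intro exI[of _ 1]) auto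

lemma runs_straight:
  assumes "code_at P pc cs" "list_all straight cs" "pc' = pc + length cs"
  shows "runs P (pc, M) (pc', fold eff cs M) (length cs)"
  using assms
proof (induction cs arbitrary: pc M)
  case (Cons i cs)
  note c = code_at_Cons[OF Cons.prems(1)]
  have 1: "runs P (pc, M) (Suc pc, eff i M) 1"
    by (rule runs_step) (use c Cons.prems(2) in \<open>cases i; auto\<close>)
  have 2: "runs P (Suc pc, eff i M) (pc', fold eff cs (eff i M)) (length cs)"
    using Cons.IH[OF c(3)] Cons.prems by auto
  show ?case using runs_trans[OF 1 2] by simp
qed simp

lemma straight_comp_exp: "list_all straight (comp_exp d e)"
  by (induction e arbitrary: d) auto

lemma esize_pos: "0 < esize e"
  by (cases e) auto

lemma eff_comp_exp:
  assumes "\<forall>x\<in>evars e. x < d"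
  shows "fold eff (comp_exp d e) M d = aval e M \<and>
    (\<forall>r. r < d \<or> d + esize e \<le> r \<longrightarrow> fold eff (comp_exp d e) M r = M r)"
  using assms
proof (induction e arbitrary: d M)
  case (Plus a b)
  let ?M = "fold eff (comp_exp d a) M"
  have a: "?M d = aval a M" "\<And>r. r < d \<or> d + esize a \<le> r \<Longrightarrow> ?M r = M r"
    using Plus by auto
  have "\<forall>x\<in>evars b. x < Suc d" using Plus.prems by (auto intro!: less_SucI)
  from Plus.IH(2)[OF this, of ?M]
  have b: "fold eff (comp_exp (Suc d) b) ?M (Suc d) = aval b ?M"
    "\<And>r. r \<le> d \<or> Suc d + esize b \<le> r \<Longrightarrow> fold eff (comp_exp (Suc d) b) ?M r = ?M r"
    by (auto simp: less_Suc_eq_le)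
  have "aval b ?M = aval b M" using a Plus.prems by (intro aval_cong) auto
  then show ?case using a b esize_pos[of b] by auto
next
  case (Minus a b)
  let ?M = "fold eff (comp_exp d a) M"
  have a: "?M d = aval a M" "\<And>r. r < d \<or> d + esize a \<le> r \<Longrightarrow> ?M r = M r"
    using Minus by auto
  have "\<forall>x\<in>evars b. x < Suc d" using Minus.prems by (auto intro!: less_SucI)
  from Minus.IH(2)[OF this, of ?M]
  have b: "fold eff (comp_exp (Suc d) b) ?M (Suc d) = aval b ?M"
    "\<And>r. r \<le> d \<or> Suc d + esize b \<le> r \<Longrightarrow> fold eff (comp_exp (Suc d) b) ?M r = ?M r"
    by (auto simp: less_Suc_eq_le)
  have "aval b ?M = aval b M" using a Minus.prems by (intro aval_cong) auto
  then show ?case using a b esize_pos[of b] by auto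
next
  case (Times a b)
  let ?M = "fold eff (comp_exp d a) M"
  have a: "?M d = aval a M" "\<And>r. r < d \<or> d + esize a \<le> r \<Longrightarrow> ?M r = M r"
    using Times by auto
  have "\<forall>x\<in>evars b. x < Suc d" using Times.prems by (auto intro!: less_SucI)
  from Times.IH(2)[OF this, of ?M]
  have b: "fold eff (comp_exp (Suc d) b) ?M (Suc d) = aval b ?M"
    "\<And>r. r \<le> d \<or> Suc d + esize b \<le> r \<Longrightarrow> fold eff (comp_exp (Suc d) b) ?M r = ?M r"
    by (auto simp: less_Suc_eq_le)
  have "aval b ?M = aval b M" using a Times.prems by (intro aval_cong) auto
  then show ?case using a b esize_pos[of b] by auto
next
  case (Quot a b)
  let ?M = "fold eff (comp_exp d a) M"
  have a: "?M d = aval a M" "\<And>r. r < d \<or> d + esize a \<le> r \<Longrightarrow> ?M r = M r"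
    using Quot by auto
  have "\<forall>x\<in>evars b. x < Suc d" using Quot.prems by (auto intro!: less_SucI)
  from Quot.IH(2)[OF this, of ?M]
  have b: "fold eff (comp_exp (Suc d) b) ?M (Suc d) = aval b ?M"
    "\<And>r. r \<le> d \<or> Suc d + esize b \<le> r \<Longrightarrow> fold eff (comp_exp (Suc d) b) ?M r = ?M r"
    by (auto simp: less_Suc_eq_le)
  have "aval b ?M = aval b M" using a Quot.prems by (intro aval_cong) auto
  then show ?case using a b esize_pos[of b] by auto
qed auto

text \<open>The value of input cell \<open>i\<close> once the cells 1 to \<open>K\<close> have been moved to the
  address in register 1.\<close>

definition input_cell :: "nat \<Rightarrow> (nat \<Rightarrow> int) \<Rightarrow> int \<Rightarrow> int" where
  "input_cell K M i = (if (i - 1) div int K = 0 then M (nat (i - 1 + M 1)) else M (nat i))"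

text \<open>Both branches avoid the working registers 2 to \<open>K - 1\<close>: relocated cells lie
  at \<open>K\<close> or above because register 1 does, and an address outside 1 to \<open>K\<close>
  truncates to 0 or exceeds \<open>K\<close>. Reading the input is therefore unaffected by the
  run.\<close>

lemma input_cell_cong:
  assumes "M 1 \<ge> int K" "K > 0" "\<And>r. r < 2 \<or> K \<le> r \<Longrightarrow> M' r = M r"
  shows "input_cell K M' i = input_cell K M i"
proof (cases "(i - 1) div int K = 0")
  case True
  then have "0 \<le> i - 1" "i - 1 < int K"
    using assms(2) by (auto simp: zdiv_eq_0_iff)
  then have "K \<le> nat (i - 1 + M 1)" using assms(1) by linarith
  then show ?thesis using True assms(3) by (simp add: input_cell_def)
next
  case False
  then have "\<not> (0 \<le> i - 1 \<and> i - 1 < int K)" by auto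
  then have "nat i = 0 \<or> K \<le> nat i" by linarith
  then show ?thesis using False assms(3)[of "nat i"] by (auto simp: input_cell_def)
qed

text \<open>\<open>x * x + 1\<close> exceeds the absolute value of \<open>x\<close>, so the quotient
  is 0 or -1 and the factor is 1 or 0.\<close>

lemma clamp_eq: "x * (x div (x * x + 1) + 1) = max (x::int) 0"
proof (cases "x \<ge> 0")
  case True
  have "0 \<le> x * (x - 1)" using True by (cases "x = 0") auto
  then have "x < x * x + 1" by (simp add: algebra_simps)
  then have "x div (x * x + 1) = 0" using True by simp
  then show ?thesis using True by simp
next
  case False
  have "0 \<le> x * (x + 1)" using False by (simp add: mult_nonpos_nonpos)
  then have "x + (x * x + 1) \<ge> 0" by (simp add: algebra_simps)
  then have "x div (x * x + 1) = - 1"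
    using False by (intro int_div_pos_eq[of _ _ _ "x * x + 1 + x"]) auto
  then show ?thesis using False by simp
qed

text \<open>Variables live below \<open>k\<close>, temporaries and loop counters between
  \<open>k\<close> and \<open>K\<close>, the relocated input at \<open>K\<close> and above. A loop
  spends one register on its counter, which the drop in \<open>csize\<close> pays for, so
  \<open>k + csize c \<le> K\<close> survives the induction.\<close>

lemma comp_com_correct:
  assumes "code_at P pc (comp_com K k pc c)" "safe c" "\<forall>x\<in>cvars c. x < k" "3 \<le> k"
    "k + csize c \<le> K" "\<forall>r<k. M r = s r" "int K \<le> M 1" "\<forall>i. input_cell K M i = g i"
  shows "\<exists>M'. runs P (pc, M) (pc + csize c, M') (cost g c s) \<and>
    (\<forall>r<k. M' r = sem g c s r) \<and> (\<forall>r. r < 3 \<or> K \<le> r \<longrightarrow> M' r = M r)"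
  using assms
proof (induction c arbitrary: k pc M s)
  case Skip
  then show ?case by (intro exI[of _ M]) auto
next
  case (Assign x e)
  let ?c = "comp_com K k pc (Assign x e)"
  let ?M = "fold eff ?c M"
  have r: "runs P (pc, M) (pc + csize (Assign x e), ?M) (length ?c)"
    by (rule runs_straight) (use Assign.prems straight_comp_exp in auto)
  have e: "fold eff (comp_exp k e) M k = aval e M"
    "\<And>r. r < k \<or> k + esize e \<le> r \<Longrightarrow> fold eff (comp_exp k e) M r = M r"
    using eff_comp_exp[of e k M] Assign.prems by auto
  have "aval e M = aval e s" using Assign.prems by (intro aval_cong) auto
  then have M: "?M = (fold eff (comp_exp k e) M)(Suc k := 0, x := aval e s)" (is "_ = ?M'")
    using e Assign.prems by simp
  have "\<forall>r<k. ?M' r = sem g (Assign x e) s r" "\<forall>r. r < 3 \<or> K \<le> r \<longrightarrow> ?M' r = M r"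
    using e Assign.prems by auto
  moreover have "runs P (pc, M) (pc + csize (Assign x e), ?M') (cost g (Assign x e) s)"
    using r unfolding M by simp
  ultimately show ?case by blast
next
  case (Read x y)
  note c = Read.prems(1)
  have xy: "3 \<le> x" "x < k" "y < k" "K > 0" using Read.prems by auto
  let ?c1 = "[Const k 1, Sub (Suc k) y k, Const k (int K), Div k (Suc k) k]"
  let ?M1 = "M(Suc k := M y - 1, k := (M y - 1) div int K)"
  have c1: "code_at P pc (?c1 @ [Jz k (pc + 7), Load x y, Jmp (pc + 9), Add (Suc k) (Suc k) 1, Load x (Suc k)])"
    using c by simp
  note c2 = code_at_append[OF c1]
  have "runs P (pc, M) (pc + 4, fold eff ?c1 M) (length ?c1)"
    by (rule runs_straight) (use c2 in auto)
  moreover have "fold eff ?c1 M = ?M1" using xy by (auto simp: fun_eq_iff)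
  ultimately have r1: "runs P (pc, M) (pc + 4, ?M1) 4" by (simp add: eval_nat_numeral)
  have c3: "code_at P (pc + 4) [Jz k (pc + 7), Load x y, Jmp (pc + 9), Add (Suc k) (Suc k) 1, Load x (Suc k)]"
    using c2 by (simp add: eval_nat_numeral)
  note j = code_at_Cons[OF c3] note j2 = code_at_Cons[OF j(3)] note j3 = code_at_Cons[OF j2(3)]
  note j4 = code_at_Cons[OF j3(3)]
  have g: "g (s y) = (if (M y - 1) div int K = 0 then M (nat (M y - 1 + M 1)) else M (nat (M y)))"
  proof -
    have "g (s y) = input_cell K M (M y)" using Read.prems(6,8) xy by simp
    then show ?thesis by (simp add: input_cell_def)
  qed
  show ?case
  proof (cases "(M y - 1) div int K = 0")
    case True
    then have "0 \<le> M y - 1" "M y - 1 < int K"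
      using xy by (auto simp: zdiv_eq_0_iff)
    then have hi: "K \<le> nat (M y - 1 + M 1)" using Read.prems(7) by linarith
    let ?c2 = "[Add (Suc k) (Suc k) 1, Load x (Suc k)]"
    have r2: "runs P (pc + 4, ?M1) (pc + 7, ?M1) 1"
      by (rule runs_step) (use j True in auto)
    have r3: "runs P (pc + 7, ?M1) (pc + 9, fold eff ?c2 ?M1) (length ?c2)"
      by (rule runs_straight) (use j3(3) in \<open>auto simp: eval_nat_numeral\<close>)
    have "runs P (pc, M) (pc + 9, fold eff ?c2 ?M1) (4 + 1 + 2)"
      using runs_trans[OF runs_trans[OF r1 r2] r3] by simp
    then have "runs P (pc, M) (pc + 9, fold eff ?c2 ?M1) 9" by (rule runs_mono) simp
    moreover have "fold eff ?c2 ?M1 r = sem g (Read x y) s r" if "r < k" for r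
      using that xy Read.prems(4,5,6) g True hi by simp
    moreover have "fold eff ?c2 ?M1 r = M r" if "r < 3 \<or> K \<le> r" for r
      using that xy Read.prems(4,5) by auto
    ultimately show ?thesis unfolding csize.simps cost.simps by blast
  next
    case False
    have r2: "runs P (pc + 4, ?M1) (pc + 5, ?M1) 1"
      by (rule runs_step) (use j False in auto)
    let ?M2 = "?M1(x := M (nat (M y)))"
    have nk: "?M1 (nat (M y)) = M (nat (M y))"
    proof -
      have "\<not> (0 \<le> M y - 1 \<and> M y - 1 < int K)" using False by auto
      then have "nat (M y) = 0 \<or> K \<le> nat (M y)" by linarith
      then show ?thesis using Read.prems(4,5) by auto
    qed
    have r3: "runs P (pc + 5, ?M1) (pc + 6, ?M2) 1"
      by (rule runs_step) (use j2 xy nk in \<open>auto simp: eval_nat_numeral\<close>)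
    have r4: "runs P (pc + 6, ?M2) (pc + 9, ?M2) 1"
      by (rule runs_step) (use j3 in \<open>auto simp: eval_nat_numeral\<close>)
    have "runs P (pc, M) (pc + 9, ?M2) (4 + 1 + 1 + 1)"
      using runs_trans[OF runs_trans[OF runs_trans[OF r1 r2] r3] r4] by simp
    then have "runs P (pc, M) (pc + 9, ?M2) 9" by (rule runs_mono) simp
    moreover have "?M2 r = sem g (Read x y) s r" if "r < k" for r
      using that xy Read.prems(4,5,6) g False by simp
    moreover have "?M2 r = M r" if "r < 3 \<or> K \<le> r" for r
      using that xy Read.prems(4,5) by auto
    ultimately show ?thesis unfolding csize.simps cost.simps by blast
  qed
next
  case (Seq a b)
  have ca: "code_at P pc (comp_com K k pc a)" "code_at P (pc + csize a) (comp_com K k (pc + csize a) b)"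
    using code_at_append[of P pc "comp_com K k pc a"] Seq.prems(1) by auto
  have "\<exists>M1. runs P (pc, M) (pc + csize a, M1) (cost g a s) \<and> (\<forall>r<k. M1 r = sem g a s r) \<and> (\<forall>r. r < 3 \<or> K \<le> r \<longrightarrow> M1 r = M r)"
    by (rule Seq.IH(1)) (use ca Seq.prems in auto)
  then obtain M1 where 1: "runs P (pc, M) (pc + csize a, M1) (cost g a s)" "\<forall>r<k. M1 r = sem g a s r" "\<forall>r. r < 3 \<or> K \<le> r \<longrightarrow> M1 r = M r"
    by blast
  have K: "int K \<le> M1 1" using 1(3) Seq.prems by simp
  have "input_cell K M1 i = input_cell K M i" for i
    by (rule input_cell_cong) (use 1(3) Seq.prems in auto)
  then have I: "\<forall>i. input_cell K M1 i = g i" using Seq.prems by simp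
  have "\<exists>M2. runs P (pc + csize a, M1) (pc + csize a + csize b, M2) (cost g b (sem g a s)) \<and> (\<forall>r<k. M2 r = sem g b (sem g a s) r) \<and> (\<forall>r. r < 3 \<or> K \<le> r \<longrightarrow> M2 r = M1 r)"
    by (rule Seq.IH(2)) (use ca 1(2) K I Seq.prems in auto)
  then obtain M2 where 2: "runs P (pc + csize a, M1) (pc + csize a + csize b, M2) (cost g b (sem g a s))" "\<forall>r<k. M2 r = sem g b (sem g a s) r" "\<forall>r. r < 3 \<or> K \<le> r \<longrightarrow> M2 r = M1 r"
    by blast
  show ?case using runs_trans[OF 1(1) 2(1)] 2 1 by (intro exI[of _ M2]) (auto simp: add.assoc)
next
  case (Cond e a b)
  let ?ce = "comp_exp k e" and ?ca = "comp_com K k (pc + esize e + 1) a"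
  let ?cb = "comp_com K k (pc + esize e + csize a + 2) b"
  let ?z = "Jz k (pc + esize e + csize a + 2)" and ?j = "Jmp (pc + esize e + csize a + csize b + 2)"
  have c: "code_at P pc (?ce @ (?z # (?ca @ (?j # ?cb))))" using Cond.prems(1) by simp
  note c1 = code_at_append[OF c]
  note c2 = code_at_Cons[OF c1[THEN conjunct2]]
  note c3 = code_at_append[OF c2(3)]
  note c4 = code_at_Cons[OF c3[THEN conjunct2]]
  let ?M0 = "fold eff ?ce M"
  have r0: "runs P (pc, M) (pc + esize e, ?M0) (esize e)"
    using runs_straight[of P pc ?ce] c1 straight_comp_exp by simp
  have e: "?M0 k = aval e M" "\<And>r. r < k \<or> k + esize e \<le> r \<Longrightarrow> ?M0 r = M r"
    using eff_comp_exp[of e k M] Cond.prems by auto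
  have ae: "aval e M = aval e s" using Cond.prems by (intro aval_cong) auto
  have s0: "\<forall>r<k. ?M0 r = s r" using e Cond.prems by auto
  have K0: "int K \<le> ?M0 1" using e Cond.prems by auto
  have pres: "?M0 r = M r" if "r < 3 \<or> K \<le> r" for r using that e(2)[of r] Cond.prems(4,5) by auto
  have "input_cell K ?M0 i = input_cell K M i" for i
    by (rule input_cell_cong) (use pres Cond.prems in auto)
  then have J: "\<forall>i. input_cell K ?M0 i = g i" using pres Cond.prems by simp
  note I0 = J
  show ?case
  proof (cases "aval e s = 0")
    case True
    have r1: "runs P (pc + esize e, ?M0) (pc + esize e + csize a + 2, ?M0) 1"
      by (rule runs_step) (use c2 True ae e in auto)
    have "\<exists>M2. runs P (pc + esize e + csize a + 2, ?M0) (pc + esize e + csize a + 2 + csize b, M2) (cost g b s) \<and> (\<forall>r<k. M2 r = sem g b s r) \<and> (\<forall>r. r < 3 \<or> K \<le> r \<longrightarrow> M2 r = ?M0 r)"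
      by (rule Cond.IH(2)) (use c3 c4 s0 K0 I0 Cond.prems in auto)
    then obtain M2 where 2: "runs P (pc + esize e + csize a + 2, ?M0) (pc + esize e + csize a + 2 + csize b, M2) (cost g b s)" "\<forall>r<k. M2 r = sem g b s r" "\<forall>r. r < 3 \<or> K \<le> r \<longrightarrow> M2 r = ?M0 r"
      by blast
    have "runs P (pc, M) (pc + esize e + csize a + 2 + csize b, M2) (esize e + 1 + cost g b s)"
      by (rule runs_trans[OF runs_trans[OF r0 r1] 2(1)])
    then have "runs P (pc, M) (pc + csize (Cond e a b), M2) (cost g (Cond e a b) s)"
      using True by (auto elim!: runs_mono simp: algebra_simps)
    then show ?thesis using 2 True pres by (intro exI[of _ M2]) auto
  next
    case False
    have r1: "runs P (pc + esize e, ?M0) (pc + esize e + 1, ?M0) 1"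
      by (rule runs_step) (use c2 False ae e in auto)
    have "\<exists>M2. runs P (pc + esize e + 1, ?M0) (pc + esize e + 1 + csize a, M2) (cost g a s) \<and> (\<forall>r<k. M2 r = sem g a s r) \<and> (\<forall>r. r < 3 \<or> K \<le> r \<longrightarrow> M2 r = ?M0 r)"
      by (rule Cond.IH(1)) (use c3 c4 s0 K0 I0 Cond.prems in auto)
    then obtain M2 where 2: "runs P (pc + esize e + 1, ?M0) (pc + esize e + 1 + csize a, M2) (cost g a s)" "\<forall>r<k. M2 r = sem g a s r" "\<forall>r. r < 3 \<or> K \<le> r \<longrightarrow> M2 r = ?M0 r"
      by blast
    have r3: "runs P (pc + esize e + 1 + csize a, M2) (pc + csize (Cond e a b), M2) 1"
      by (rule runs_step) (use c4 in \<open>auto simp: algebra_simps\<close>)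
    have "runs P (pc, M) (pc + csize (Cond e a b), M2) (esize e + 1 + cost g a s + 1)"
      by (rule runs_trans[OF runs_trans[OF runs_trans[OF r0 r1] 2(1)] r3])
    then have "runs P (pc, M) (pc + csize (Cond e a b), M2) (cost g (Cond e a b) s)"
      using False by (auto elim!: runs_mono simp: algebra_simps)
    then show ?thesis using 2 False pres by (intro exI[of _ M2]) auto
  qed
next
  case (Loop e c)
  let ?ce = "comp_exp k e"
  let ?cl = "[Mul (k + 1) k k, Const (k + 2) 1, Add (k + 1) (k + 1) (k + 2),
      Div (k + 1) k (k + 1), Add (k + 1) (k + 1) (k + 2), Mul k k (k + 1)]"
  let ?h = "pc + esize e + 6"
  let ?cc = "comp_com K (Suc k) (?h + 1) c"
  let ?end = "pc + esize e + csize c + 10"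
  let ?ct = "[Const (Suc k) 1, Sub k k (Suc k)]"
  have c: "code_at P pc ((?ce @ ?cl) @ (Jz k ?end # (?cc @ (?ct @ [Jmp ?h]))))"
    using Loop.prems(1) by (simp add: ac_simps)
  note c1 = code_at_append[OF c]
  have c1': "code_at P ?h (Jz k ?end # (?cc @ (?ct @ [Jmp ?h])))"
    by (rule code_at_appendD[OF c]) simp
  note c2 = code_at_Cons[OF c1']
  have c3: "code_at P (?h + 1) ?cc" "code_at P (?h + 1 + csize c) (?ct @ [Jmp ?h])"
    using code_at_append[OF c2(3)] by auto
  have c4: "code_at P (?h + 1 + csize c) ?ct" using code_at_append[OF c3(2)] by simp
  have c5: "code_at P (?h + csize c + 3) [Jmp ?h]"
    by (rule code_at_appendD[OF c3(2)]) simp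
  note c6 = code_at_Cons[OF c5]
  define M0 where "M0 = fold eff (?ce @ ?cl) M"
  have r0: "runs P (pc, M) (?h, M0) (esize e + 6)"
  proof (rule runs_mono)
    show "runs P (pc, M) (?h, M0) (length (?ce @ ?cl))"
      unfolding M0_def by (rule runs_straight) (use c1 straight_comp_exp in auto)
  qed simp
  have e: "fold eff ?ce M k = aval e M" "\<And>r. r < k \<or> k + esize e \<le> r \<Longrightarrow> fold eff ?ce M r = M r"
    using eff_comp_exp[of e k M] Loop.prems by auto
  have ae: "aval e M = aval e s" using Loop.prems by (intro aval_cong) auto
  let ?m = "nat (aval e s)"
  have M0k: "M0 k = int ?m"
  proof -
    have "M0 k = aval e s * (aval e s div (aval e s * aval e s + 1) + 1)"
      using e(1) ae by (simp add: M0_def)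
    also have "\<dots> = int ?m" unfolding clamp_eq by simp
    finally show ?thesis .
  qed
  have pres: "M0 r = M r" if "r < k \<or> K \<le> r" for r
    using that e(2)[of r] Loop.prems(5) by (auto simp: M0_def)
  have loop: "\<exists>M'. runs P (?h, M1) (?end, M')
        (1 + (\<Sum>i<m. cost g c ((sem g c ^^ i) s1) + 4)) \<and>
      (\<forall>r<k. M' r = (sem g c ^^ m) s1 r) \<and> (\<forall>r. r < 3 \<or> K \<le> r \<longrightarrow> M' r = M1 r)"
    if "\<forall>r<k. M1 r = s1 r" "M1 k = int m" "int K \<le> M1 1" "\<forall>i. input_cell K M1 i = g i"
    for m M1 s1
    using that
  proof (induction m arbitrary: M1 s1)
    case 0
    have "runs P (?h, M1) (?end, M1) 1"
      by (rule runs_step) (use c2 0 in auto)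
    then show ?case using 0 by (intro exI[of _ M1]) auto
  next
    case (Suc m)
    have r1: "runs P (?h, M1) (?h + 1, M1) 1"
      by (rule runs_step) (use c2 Suc.prems in auto)
    \<comment> \<open>The hypothesis for the body, compiled above \<open>Suc k\<close>, wants
      agreement on the counter register too. So the counter is put into the source state, where the
      body ignores it.\<close>
    let ?s = "s1(k := M1 k)"
    have nk: "k \<notin> cvars c" using Loop.prems(3) by auto
    have s1: "\<forall>r<Suc k. M1 r = ?s r" using Suc.prems by (auto simp: less_Suc_eq)
    have "\<exists>M2. runs P (?h + 1, M1) (?h + 1 + csize c, M2) (cost g c ?s) \<and> (\<forall>r<Suc k. M2 r = sem g c ?s r) \<and> (\<forall>r. r < 3 \<or> K \<le> r \<longrightarrow> M2 r = M1 r)"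
      by (rule Loop.IH) (use s1 c3 Loop.prems Suc.prems in \<open>auto intro!: less_SucI\<close>)
    then obtain M2 where 2: "runs P (?h + 1, M1) (?h + 1 + csize c, M2) (cost g c ?s)" "\<forall>r<Suc k. M2 r = sem g c ?s r" "\<forall>r. r < 3 \<or> K \<le> r \<longrightarrow> M2 r = M1 r"
      by blast
    have fr: "cost g c ?s = cost g c s1 \<and> (\<forall>r. sem g c ?s r = (if r = k then M1 k else sem g c s1 r))"
      using cost_upd[OF nk] sem_upd[OF nk] by simp
    let ?M3 = "fold eff ?ct M2"
    have r3: "runs P (?h + 1 + csize c, M2) (?h + csize c + 3, ?M3) 2"
      using runs_straight[OF c4, of "?h + csize c + 3" M2] by (simp add: numeral_2_eq_2)
    have r4: "runs P (?h + csize c + 3, ?M3) (?h, ?M3) 1"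
      by (rule runs_step) (use c6 in auto)
    have M3: "\<forall>r<k. ?M3 r = sem g c s1 r" "?M3 k = int m" "\<forall>r. r < 3 \<or> K \<le> r \<longrightarrow> ?M3 r = M1 r"
      using 2 fr Suc.prems Loop.prems(4,5) by auto
    have K3: "int K \<le> ?M3 1" using M3(3) Suc.prems by simp
    have "input_cell K ?M3 i = input_cell K M1 i" for i
      by (rule input_cell_cong) (use M3(3) Suc.prems Loop.prems(4,5) in auto)
    then have J: "\<forall>i. input_cell K ?M3 i = g i" using M3(3) Suc.prems Loop.prems(4,5) by simp
    note I3 = J
    obtain M' where M': "runs P (?h, ?M3) (?end, M')
        (1 + (\<Sum>i<m. cost g c ((sem g c ^^ i) (sem g c s1)) + 4))"
      "\<forall>r<k. M' r = (sem g c ^^ m) (sem g c s1) r" "\<forall>r. r < 3 \<or> K \<le> r \<longrightarrow> M' r = ?M3 r"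
      using Suc.IH[OF M3(1,2) K3 I3] by blast
    have "runs P (?h, M1) (?end, M') (1 + cost g c ?s + 2 + 1 +
        (1 + (\<Sum>i<m. cost g c ((sem g c ^^ i) (sem g c s1)) + 4)))"
      by (rule runs_trans[OF runs_trans[OF runs_trans[OF runs_trans[OF r1 2(1)] r3] r4] M'(1)])
    moreover have "(\<Sum>i<Suc m. cost g c ((sem g c ^^ i) s1) + 4) =
      cost g c s1 + 4 + (\<Sum>i<m. cost g c ((sem g c ^^ i) (sem g c s1)) + 4)"
      by (subst sum.lessThan_Suc_shift) (simp add: funpow_swap1)
    ultimately have "runs P (?h, M1) (?end, M') (1 + (\<Sum>i<Suc m. cost g c ((sem g c ^^ i) s1) + 4))"
      using fr by (elim runs_mono) linarith
    then show ?case using M' M3 Loop.prems(4) by (intro exI[of _ M']) (auto simp: funpow_swap1)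
  qed
  have "\<forall>r<k. M0 r = s r" using pres Loop.prems by auto
  moreover have "int K \<le> M0 1" using pres[of 1] Loop.prems by simp
  moreover have "input_cell K M0 i = input_cell K M i" for i
    by (rule input_cell_cong) (use pres Loop.prems in auto)
  then have J: "\<forall>i. input_cell K M0 i = g i" using pres Loop.prems by simp
  ultimately obtain M' where M': "runs P (?h, M0) (?end, M')
        (1 + (\<Sum>i<?m. cost g c ((sem g c ^^ i) s) + 4))"
      "\<forall>r<k. M' r = (sem g c ^^ ?m) s r" "\<forall>r. r < 3 \<or> K \<le> r \<longrightarrow> M' r = M0 r"
    using loop[of M0 s ?m, OF _ M0k] by blast
  have "runs P (pc, M) (?end, M') (esize e + 6 + (1 + (\<Sum>i<?m. cost g c ((sem g c ^^ i) s) + 4)))"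
    by (rule runs_trans[OF r0 M'(1)])
  then have "runs P (pc, M) (pc + csize (Loop e c), M') (cost g (Loop e c) s)"
    by (simp add: algebra_simps)
  then show ?case using M' pres Loop.prems(4) by (intro exI[of _ M']) auto
qed

text \<open>At the start every low register may hold input, and only register 0 can be used; it
  contains the input length \<open>L\<close>. Doubling it \<open>K\<close> times in place gives the
  address \<open>A = 2 ^ K * L\<close>, which lies beyond the input and beyond \<open>K\<close>.
  Cell 1 is saved there, which frees register 1 for the constant 1, and the cells 2 to
  \<open>K\<close> follow. From the final address, \<open>A\<close> and then \<open>L\<close> are
  recovered.\<close>

definition prelude :: "nat \<Rightarrow> instr list" where
  "prelude K = replicate K (Add 0 0 0) @ [Store 0 1, Const 1 1] @
     concat (map (\<lambda>r. [Add 0 0 1, Store 0 r]) [2..<Suc K]) @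
     [Const 1 (int K - 1), Sub 1 0 1, Const 2 (2 ^ K), Div 2 1 2, Const 0 0]"

lemma straight_prelude: "list_all straight (prelude K)"
  by (auto simp: prelude_def list_all_iff)

lemma eff_double: "fold eff (replicate m (Add 0 0 0)) M = M(0 := 2 ^ m * M 0)"
  by (induction m arbitrary: M) (auto simp: fun_eq_iff)

lemma eff_save:
  assumes "M 0 = int A" "M 1 = 1" "K < A" "1 \<le> m" "m \<le> K"
  shows "fold eff (concat (map (\<lambda>r. [Add 0 0 1, Store 0 r]) [2..<Suc m])) M r =
    (if r = 0 then int (A + m - 1) else if A + 1 \<le> r \<and> r \<le> A + m - 1 then M (r - A + 1) else M r)"
  using assms(4,5)
proof (induction m arbitrary: r rule: dec_induct)
  case base
  then show ?case using assms by auto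
next
  case (step m)
  let ?M = "fold eff (concat (map (\<lambda>r. [Add 0 0 1, Store 0 r]) [2..<Suc m])) M"
  have IH: "?M r =
    (if r = 0 then int (A + m - 1) else if A + 1 \<le> r \<and> r \<le> A + m - 1 then M (r - A + 1) else M r)" for r
    using step by (simp del: upt_Suc)
  have "[2..<Suc (Suc m)] = [2..<Suc m] @ [Suc m]" using step by (intro upt_Suc_append) simp
  then have "fold eff (concat (map (\<lambda>r. [Add 0 0 1, Store 0 r]) [2..<Suc (Suc m)])) M
r = eff (Store 0 (Suc m)) (eff (Add 0 0 1) ?M) r" by simp
  also have "\<dots> = (if r = 0 then int (A + Suc m - 1)
      else if A + 1 \<le> r \<and> r \<le> A + Suc m - 1 then M (r - A + 1) else M r)"
  proof -
    have "?M 0 = int (A + m - 1)" "?M 1 = 1" "?M (Suc m) = M (Suc m)"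
      using IH assms step by (auto simp del: upt_Suc)
    moreover have "int (A + m - 1) + 1 = int (A + m)" using step by auto
    moreover have "nat (int (A + m)) = A + m" by simp
    ultimately have "eff (Store 0 (Suc m)) (eff (Add 0 0 1) ?M) = ?M(0 := int (A + m), A + m := M (Suc m))"
      using step(1) by (simp add: fun_eq_iff del: upt_Suc)
    then show ?thesis using IH[of r] assms(1-3) step(1,2) by (simp del: upt_Suc) linarith?
  qed
  finally show ?case .
qed

lemma eff_prelude:
  assumes "inp \<noteq> []" "3 \<le> K"
  defines "M \<equiv> fold eff (prelude K) (snd (init inp))"
  shows "M 0 = 0" "int K \<le> M 1" "M 2 = int (length inp)"
    "\<And>i. 1 \<le> i \<Longrightarrow> i \<le> length inp \<Longrightarrow> input_cell K M (int i) = inp ! (i - 1)"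
proof -
  let ?L = "length inp"
  define A where "A = 2 ^ K * ?L"
  have "K < 2 ^ K" by simp
  moreover have L: "1 \<le> ?L" using assms(1) by (cases inp) auto
  ultimately have KA: "K < A" unfolding A_def by (metis less_le_trans mult.right_neutral mult_le_mono2)
  \<comment> \<open>The saved copies land above the input, so the cells beyond \<open>K\<close>,
    which stay in place, are not overwritten.\<close>
  have LA: "2 * ?L \<le> A" unfolding A_def using assms(2)
    by (intro mult_le_mono1) (metis One_nat_def Suc_leD numeral_2_eq_2 numeral_3_eq_3 one_le_numeral power_increasing power_one_right)
  define M0 where "M0 = snd (init inp)"
  have M0: "M0 0 = int ?L" "\<And>i. 1 \<le> i \<Longrightarrow> i \<le> ?L \<Longrightarrow> M0 i = inp ! (i - 1)"
    by (auto simp: M0_def init_def)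
  define M1 where "M1 = M0(0 := int A, A := M0 1, 1 := 1)"
  have A1: "A > 1" using KA assms by auto
  define M2 where "M2 = fold eff (concat (map (\<lambda>r. [Add 0 0 1, Store 0 r]) [2..<Suc K])) M1"
  have M2: "M2 r = (if r = 0 then int (A + K - 1) else if A + 1 \<le> r \<and> r \<le> A + K - 1 then M1 (r - A + 1) else M1 r)" for r
    unfolding M2_def using KA A1 assms by (intro eff_save) (auto simp: M1_def)
  have eM1: "fold eff [Store 0 1, Const 1 1] (fold eff (replicate K (Add 0 0 0)) M0) = M1"
  proof -
    have "2 ^ K * M0 0 = int A" by (simp add: A_def M0)
    then show ?thesis unfolding eff_double using A1 by (auto simp: M1_def fun_eq_iff)
  qed
  have "M = fold eff [Const 1 (int K - 1), Sub 1 0 1, Const 2 (2 ^ K), Div 2 1 2, Const 0 0] M2"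
    unfolding M_def prelude_def M2_def eM1[symmetric] M0_def by simp
  also have "\<dots> = M2(1 := int A, 2 := int ?L, 0 := 0)"
  proof -
    have "int (A + K - 1) - (int K - 1) = int A" using A1 assms by auto
    moreover have "int A div 2 ^ K = int ?L" by (simp add: A_def)
    ultimately show ?thesis using M2[of 0] by (simp add: fun_eq_iff)
  qed
  finally have M: "M = M2(1 := int A, 2 := int ?L, 0 := 0)" .
  show "M 0 = 0" "int K \<le> M 1" "M 2 = int ?L" using M KA by auto
  fix i assume i: "1 \<le> i" "i \<le> ?L"
  show "input_cell K M (int i) = inp ! (i - 1)"
  proof (cases "i \<le> K")
    case True
    then have z: "(int i - 1) div int K = 0" using i by (simp add: zdiv_eq_0_iff)
    have a: "nat (int i - 1 + M 1) = A + i - 1" using M i by auto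
    have "M (A + i - 1) = M2 (A + i - 1)" using M A1 i assms KA by auto
    also have "\<dots> = M0 i"
    proof (cases "i = 1")
      case True
      then show ?thesis using M2[of A] A1 by (simp add: M1_def)
    next
      case False
      then have "i = Suc (Suc (i - 2))" using i by simp
      then obtain m where "i = Suc (Suc m)" by blast
      moreover from this True have "Suc (A + m) \<le> A + K - 1" by simp
      ultimately show ?thesis using M2[of "A + Suc m"] A1 i True KA by (simp add: M1_def)
    qed
    finally show ?thesis using z a M0(2) i by (simp add: input_cell_def)
  next
    case False
    then have z: "(int i - 1) div int K \<noteq> 0" using i assms by (simp add: zdiv_eq_0_iff)
    have "M i = M2 i" using M False assms by auto
    also have "\<dots> = M0 i" using M2[of i] LA i False assms L by (auto simp: M1_def)
    finally show ?thesis using z M0(2) i by (simp add: input_cell_def)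
  qed
qed

text \<open>Correctness of the source program is asked for all register contents \<open>s\<close>
  with the right length, because after the relocation the working registers still contain leftovers
  of the input. In return the time bound speaks of some such \<open>g\<close> and \<open>s\<close>,
  which is enough when the cost is bounded by the length alone.\<close>

theorem ram_program:
  assumes "safe c" "3 \<le> a"
  shows "\<exists>P k. \<forall>inp b. inp \<noteq> [] \<longrightarrow>
    (\<forall>g s. s 2 = int (length inp) \<longrightarrow> (\<forall>i<length inp. g (int i + 1) = inp ! i) \<longrightarrow>
       sem g c s a = (if b then 1 else 0)) \<longrightarrow>
    (\<exists>t g s. s 2 = int (length inp) \<and> t \<le> cost g c s + k \<and> outputs_in P inp t b)"
proof -
  define k where "k = Suc (Max (insert 3 (insert a (cvars c))))"
  have fin: "finite (insert 3 (insert a (cvars c)))" using finite_cvars by auto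
  have k: "3 \<le> k" "a < k" "\<forall>x\<in>cvars c. x < k"
  proof -
    have "x \<le> Max (insert 3 (insert a (cvars c)))" if "x \<in> insert 3 (insert a (cvars c))" for x
      using Max_ge[OF fin that] .
    then have "x < k" if "x \<in> insert 3 (insert a (cvars c))" for x
      using that unfolding k_def by (meson le_imp_less_Suc)
    then show "3 \<le> k" "a < k" "\<forall>x\<in>cvars c. x < k" by (auto intro: less_imp_le)
  qed
  define K where "K = k + csize c"
  define P where "P = prelude K @ comp_com K k (length (prelude K)) c @ [Const 1 0, Add 0 a 1]"
  let ?p = "length (prelude K)"
  have "\<exists>t g s. s 2 = int (length inp) \<and> t \<le> cost g c s + (?p + 2) \<and> outputs_in P inp t b"
    if inp: "inp \<noteq> []" and H: "\<forall>g s. s 2 = int (length inp) \<longrightarrow> (\<forall>i<length inp. g (int i + 1) = inp ! i) \<longrightarrow>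
       sem g c s a = (if b then 1 else 0)" for inp b
  proof -
    define M where "M = fold eff (prelude K) (snd (init inp))"
    have K3: "3 \<le> K" using k K_def by simp
    note ep = eff_prelude[OF inp K3, folded M_def]
    have c0: "code_at P 0 (prelude K)" unfolding code_at_def P_def by (rule exI[of _ "[]"]) simp
    have c1: "code_at P ?p (comp_com K k ?p c)" unfolding code_at_def P_def by blast
    have c2: "code_at P (?p + csize c) [Const 1 0, Add 0 a 1]"
      unfolding code_at_def P_def
      by (intro exI[of _ "prelude K @ comp_com K k ?p c"] exI[of _ "[]"]) simp
    have r1: "runs P (init inp) (?p, M) ?p"
      using runs_straight[OF c0 straight_prelude, of ?p "snd (init inp)"] by (simp add: M_def init_def)
    have "\<exists>M'. runs P (?p, M) (?p + csize c, M') (cost (input_cell K M) c M) \<and>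
      (\<forall>r<k. M' r = sem (input_cell K M) c M r) \<and> (\<forall>r. r < 3 \<or> K \<le> r \<longrightarrow> M' r = M r)"
      by (rule comp_com_correct[OF c1 assms(1) k(3,1)]) (use ep(2) K_def in auto)
    then obtain M' where M': "runs P (?p, M) (?p + csize c, M') (cost (input_cell K M) c M)"
      "\<forall>r<k. M' r = sem (input_cell K M) c M r" by blast
    have r3: "runs P (?p + csize c, M') (length P, fold eff [Const 1 0, Add 0 a 1] M') 2"
      using runs_straight[OF c2, of "length P" M'] by (simp add: P_def numeral_2_eq_2)
    have "\<forall>i<length inp. input_cell K M (int i + 1) = inp ! i"
      using ep(4)[of "Suc i" for i] by (simp add: add.commute)
    then have HH: "sem (input_cell K M) c M a = (if b then 1 else 0)"
      using H ep(3) by blast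
    have "runs P (init inp) (length P, fold eff [Const 1 0, Add 0 a 1] M')
        (cost (input_cell K M) c M + (?p + 2))"
      by (rule runs_mono[OF runs_trans[OF runs_trans[OF r1 M'(1)] r3]]) auto
    then obtain t where "t \<le> cost (input_cell K M) c M + (?p + 2)" "exec P t (init inp) = (length P, fold eff [Const 1 0, Add 0 a 1] M')"
      unfolding runs_def by auto
    moreover have "fold eff [Const 1 0, Add 0 a 1] M' 0 = (if b then 1 else 0)"
      using M'(2) k(2) HH assms(2) by simp
    ultimately show ?thesis using ep(3) unfolding outputs_in_def
      by (intro exI[of _ t] exI[of _ "input_cell K M"] exI[of _ M]) auto
  qed
  then show ?thesis by blast
qed

section \<open>Programs of linear cost\<close>

primrec loop_free :: "com \<Rightarrow> bool" where
  "loop_free Skip = True"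
| "loop_free (Assign x e) = True"
| "loop_free (Read x y) = True"
| "loop_free (Seq a b) = (loop_free a \<and> loop_free b)"
| "loop_free (Cond e a b) = (loop_free a \<and> loop_free b)"
| "loop_free (Loop e c) = False"

primrec linear :: "com \<Rightarrow> bool" where
  "linear Skip = True"
| "linear (Assign x e) = True"
| "linear (Read x y) = True"
| "linear (Seq a b) = (linear a \<and> linear b)"
| "linear (Cond e a b) = (linear a \<and> linear b)"
| "linear (Loop e c) = (e = Var 2 \<and> loop_free c)"

lemma cost_loop_free: "loop_free c \<Longrightarrow> cost g c s \<le> csize c"
proof (induction c arbitrary: s)
  case (Seq a b)
  then show ?case by (simp add: add_mono)
next
  case (Cond e a b)
  then have "cost g a s \<le> csize a" "cost g b s \<le> csize b" by auto
  then show ?case by auto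
qed auto

lemma loop_free_linear [simp]: "loop_free c \<Longrightarrow> linear c"
  by (induction c) auto

text \<open>A \<open>safe\<close> program never writes register 2, so each loop runs exactly as
  often as the input is long. Loops are not nested, and a loop-free body costs at most its
  size.\<close>

lemma cost_linear:
  assumes "linear c" "safe c"
  shows "\<exists>k. \<forall>g s L. s 2 = int L \<longrightarrow> cost g c s \<le> k * (L + 1)"
  using assms
proof (induction c)
  case (Seq a b)
  then obtain k1 k2 where k: "\<forall>g s L. s 2 = int L \<longrightarrow> cost g a s \<le> k1 * (L + 1)"
    "\<forall>g s L. s 2 = int L \<longrightarrow> cost g b s \<le> k2 * (L + 1)"
    by (metis linear.simps(4) safe.simps(4))
  have "cost g (Seq a b) s \<le> (k1 + k2) * (L + 1)" if "s 2 = int L" for g s L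
  proof -
    have "sem g a s 2 = int L" using sem_safe[of a 2] Seq.prems that by simp
    then have "cost g a s \<le> k1 * (L + 1)" "cost g b (sem g a s) \<le> k2 * (L + 1)"
      using k that by blast+
    then show ?thesis by (simp add: distrib_right)
  qed
  then show ?case by blast
next
  case (Cond e a b)
  then obtain k1 k2 where k: "\<forall>g s L. s 2 = int L \<longrightarrow> cost g a s \<le> k1 * (L + 1)"
    "\<forall>g s L. s 2 = int L \<longrightarrow> cost g b s \<le> k2 * (L + 1)"
    by (metis linear.simps(5) safe.simps(5))
  have "cost g (Cond e a b) s \<le> (esize e + 2 + k1 + k2) * (L + 1)" if "s 2 = int L" for g s L
  proof -
    have "cost g a s \<le> k1 * (L + 1)" "cost g b s \<le> k2 * (L + 1)" using k that by blast+
    then show ?thesis by (simp add: algebra_simps)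
  qed
  then show ?case by blast
next
  case (Loop e c)
  have "cost g (Loop e c) s \<le> (csize c + 20) * (L + 1)" if "s 2 = int L" for g s L
  proof -
    have "(\<Sum>i<L. cost g c ((sem g c ^^ i) s) + 4) \<le> (\<Sum>i<L. csize c + 4)"
      using Loop cost_loop_free by (intro sum_mono) auto
    then show ?thesis using Loop that by (simp add: algebra_simps)
  qed
  then show ?case by blast
next
  case Skip then show ?case by auto
next
  case (Assign x e) show ?case by (intro exI[of _ "esize e + 2"]) auto
next
  case (Read x y) show ?case by (intro exI[of _ 9]) auto
qed

subsection \<open>Words, traces and reduced words\<close>

lemma vtx_minus [simp]: "vtx (- a) = vtx a"
  by (simp add: vtx_def)

lemma valid_letter_minus [simp]: "valid_letter n (- a) = valid_letter n a"
  by (simp add: valid_letter_def)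

lemma valid_letter_nonzero: "valid_letter n a \<Longrightarrow> a \<noteq> 0"
  by (simp add: valid_letter_def)

lemma vtx_less: "valid_letter n a \<Longrightarrow> vtx a < n"
  by (auto simp: valid_letter_def vtx_def)

lemma vtx_eq_iff: "a \<noteq> 0 \<Longrightarrow> b \<noteq> 0 \<Longrightarrow> vtx a = vtx b \<longleftrightarrow> b = a \<or> b = - a"
  by (auto simp: vtx_def)

lemma valid_word_simps [simp]:
  "valid_word n []"
  "valid_word n (a # w) \<longleftrightarrow> valid_letter n a \<and> valid_word n w"
  "valid_word n (u @ w) \<longleftrightarrow> valid_word n u \<and> valid_word n w"
  by (auto simp: valid_word_def)

lemma inv_word_simps [simp]:
  "inv_word [] = []"
  "inv_word (a # w) = inv_word w @ [- a]"
  "inv_word (u @ w) = inv_word w @ inv_word u"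
  "inv_word (inv_word w) = w"
  by (auto simp: inv_word_def rev_map)

lemma valid_inv_word [simp]: "valid_word n (inv_word w) = valid_word n w"
  by (induction w) auto

lemma valid_word_rev [simp]: "valid_word n (rev w) = valid_word n w"
  by (auto simp: valid_word_def)

lemma length_inv_word [simp]: "length (inv_word w) = length w"
  by (simp add: inv_word_def)

text \<open>With the signs coded by 1 and 2, the inverse of \<open>d\<close> is
  \<open>3 - d\<close>, and the marker 0 has no inverse because 3 is not a digit. A single condition
  on neighbouring entries, \<open>reduced_stack\<close>, then expresses that nothing
  cancels.\<close>

definition digit :: "int \<Rightarrow> int" where
  "digit a = (if a > 0 then 1 else 2)"

lemma digit_minus [simp]: "a \<noteq> 0 \<Longrightarrow> digit (- a) = 3 - digit a"
  by (auto simp: digit_def)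

lemma digit_eq [simp]: "digit a \<noteq> 0" "digit a \<noteq> 3" "0 \<noteq> digit a" "3 \<noteq> digit a"
  by (auto simp: digit_def)

lemma letter_eqI: "a \<noteq> 0 \<Longrightarrow> b \<noteq> 0 \<Longrightarrow> vtx a = vtx b \<Longrightarrow> digit a = digit b \<Longrightarrow> a = b"
  by (auto simp: vtx_eq_iff digit_def split: if_splits)

definition reduced_stack :: "int list \<Rightarrow> bool" where
  "reduced_stack l \<longleftrightarrow> (\<forall>xs ys d. l \<noteq> xs @ [d, 3 - d] @ ys)"

lemma reduced_stack_appendD:
  assumes "reduced_stack (a @ b)"
  shows "reduced_stack a" "reduced_stack b"
  using assms unfolding reduced_stack_def by (metis append.assoc)+

lemma reduced_stack_snoc:
  assumes "reduced_stack l" "l = [] \<or> last l \<noteq> 3 - d"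
  shows "reduced_stack (l @ [d])"
  unfolding reduced_stack_def
proof (intro allI notI)
  fix xs ys e assume eq: "l @ [d] = xs @ [e, 3 - e] @ ys"
  show False
  proof (cases ys rule: rev_cases)
    case Nil
    then have "l = xs @ [e]" "d = 3 - e" using eq by (simp_all add: append_eq_append_conv2 snoc_eq_iff_butlast)
    then show False using assms(2) by simp
  next
    case (snoc ys' z)
    then have "l = xs @ [e, 3 - e] @ ys'" using eq by (metis append.assoc butlast_snoc)
    then show False using assms(1) unfolding reduced_stack_def by blast
  qed
qed

lemma reduced_stack_rev: "reduced_stack (rev l) \<longleftrightarrow> reduced_stack l"
proof -
  have "reduced_stack (rev l)" if "reduced_stack l" for l
    unfolding reduced_stack_def
  proof (intro allI notI)
    fix xs ys d assume "rev l = xs @ [d, 3 - d] @ ys"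
    then have "l = rev ys @ [3 - d, 3 - (3 - d)] @ rev xs"
      by (metis (no_types, lifting) append.assoc append_Cons append_Nil diff_diff_eq2 add_diff_cancel_left' rev.simps(2) rev_append rev_rev_ident rev_singleton_conv)
    then show False using that unfolding reduced_stack_def by blast
  qed
  from this[of l] this[of "rev l"] show ?thesis by auto
qed

section \<open>Group equality and trace equality\<close>

locale raag =
  fixes n :: nat and E :: "nat \<Rightarrow> nat \<Rightarrow> bool"
  assumes simple: "simple_graph n E"
begin

abbreviation "valid \<equiv> valid_word n"
abbreviation "geq \<equiv> raag_eq n E"

lemma E_sym: "E x y \<Longrightarrow> E y x"
  using simple by (auto simp: simple_graph_def)

lemma E_irrefl [simp]: "\<not> E x x"
  using simple by (auto simp: simple_graph_def)

lemma geq_refl [simp, intro]: "geq u u"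
  by (simp add: raag_eq_def)

lemma geq_sym: "geq u v \<Longrightarrow> geq v u"
  unfolding raag_eq_def by (rule equivclp_sym)

lemma geq_trans [trans]: "geq u v \<Longrightarrow> geq v w \<Longrightarrow> geq u w"
  unfolding raag_eq_def by (rule equivclp_trans)

lemma geq_step: "raag_step n E u v \<Longrightarrow> geq u v"
  unfolding raag_eq_def by (rule r_into_equivclp)

lemma geq_induct [consumes 1, case_names refl step]:
  assumes "geq u v" "P u" "\<And>x y. geq u x \<Longrightarrow> raag_step n E x y \<or> raag_step n E y x \<Longrightarrow> P x \<Longrightarrow> P y"
  shows "P v"
  using assms unfolding raag_eq_def by (induction rule: equivclp_induct) auto

lemma geq_map:
  assumes "\<And>x y. raag_step n E x y \<Longrightarrow> geq (h x) (h y)" "geq u v"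
  shows "geq (h u) (h v)"
  using assms(2)
  by (induction rule: geq_induct) (use assms(1) in \<open>blast intro: geq_trans geq_sym\<close>)+

lemma raag_step_cong: "raag_step n E u v \<Longrightarrow> raag_step n E (xs @ u @ ys) (xs @ v @ ys)"
proof (induction rule: raag_step.induct)
  case (cancel a us vs)
  then show ?case using raag_step.cancel[of n a E "xs @ us" "vs @ ys"] by simp
next
  case (commute a b us vs)
  then show ?case using raag_step.commute[of n a b E "xs @ us" "vs @ ys"] by simp
qed

lemma geq_cong: "geq u v \<Longrightarrow> geq (xs @ u @ ys) (xs @ v @ ys)"
  by (rule geq_map) (auto intro: geq_step raag_step_cong)

lemma geq_append: "geq u u' \<Longrightarrow> geq v v' \<Longrightarrow> geq (u @ v) (u' @ v')"
  using geq_cong[of u u' "[]" v] geq_cong[of v v' u' "[]"] by (auto intro: geq_trans)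

lemma geq_Cons: "geq u v \<Longrightarrow> geq (a # u) (a # v)"
  using geq_cong[of u v "[a]" "[]"] by simp

lemma geq_valid: "geq u v \<Longrightarrow> valid u = valid v"
proof (induction rule: geq_induct)
  case (step x y)
  have "raag_step n E x y \<Longrightarrow> valid x = valid y" for x y
    by (induction rule: raag_step.induct) auto
  then show ?case using step by auto
qed simp

lemma geq_cancel_right: "valid w \<Longrightarrow> geq (w @ inv_word w) []"
proof (induction w)
  case (Cons a w)
  have "geq ([a] @ (w @ inv_word w) @ [- a]) ([a] @ [] @ [- a])"
    using Cons by (intro geq_cong) auto
  moreover have "geq ([] @ [a, - a] @ []) ([] @ [])"
    using Cons by (intro geq_step raag_step.cancel) auto
  ultimately show ?case by (auto intro: geq_trans)
qed simp

lemma geq_cancel_left: "valid w \<Longrightarrow> geq (inv_word w @ w) []"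
  using geq_cancel_right[of "inv_word w"] by simp

lemma geq_inv: "geq u v \<Longrightarrow> geq (inv_word u) (inv_word v)"
proof (rule geq_map[of inv_word])
  fix x y assume "raag_step n E x y"
  then show "geq (inv_word x) (inv_word y)"
  proof (induction rule: raag_step.induct)
    case (cancel a xs ys)
    then show ?case using raag_step.cancel[of n a E "inv_word ys" "inv_word xs"]
      by (auto intro: geq_step)
  next
    case (commute a b xs ys)
    then show ?case using raag_step.commute[of n "- b" "- a" E "inv_word ys" "inv_word xs"]
      by (auto intro: geq_step E_sym)
  qed
qed

lemma geq_rev: "geq u v \<Longrightarrow> geq (rev u) (rev v)"
proof (rule geq_map[of rev])
  fix x y assume "raag_step n E x y"
  then show "geq (rev x) (rev y)"
  proof (induction rule: raag_step.induct)
    case (cancel a xs ys)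
    then show ?case using raag_step.cancel[of n "- a" E "rev ys" "rev xs"]
      by (auto intro: geq_step)
  next
    case (commute a b xs ys)
    then show ?case using raag_step.commute[of n b a E "rev ys" "rev xs"]
      by (auto intro: geq_step E_sym)
  qed
qed

lemma geq_move_left:
  assumes "valid x" "valid u" "valid v"
  shows "geq u (x @ v) \<longleftrightarrow> geq (inv_word x @ u) v"
proof
  assume "geq u (x @ v)"
  then have "geq (inv_word x @ u) (inv_word x @ x @ v)" by (intro geq_append) auto
  also have "geq (inv_word x @ x @ v) ([] @ v)"
    using geq_append[OF geq_cancel_left[OF assms(1)] geq_refl, of v] by simp
  finally show "geq (inv_word x @ u) v" by simp
next
  assume "geq (inv_word x @ u) v"
  then have "geq (x @ inv_word x @ u) (x @ v)" by (intro geq_append) auto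
  moreover have "geq (x @ inv_word x @ u) ([] @ u)"
    using geq_append[OF geq_cancel_right[OF assms(1)] geq_refl, of u] by simp
  ultimately show "geq u (x @ v)" by (auto intro: geq_trans geq_sym)
qed

text \<open>Commutations without cancellation: the classes of \<open>teq\<close> are traces, the
  elements of the partially commutative monoid. The reduced words of one group element form a single
  trace, by \<open>red_geq_iff\<close>.\<close>

inductive tstep :: "int list \<Rightarrow> int list \<Rightarrow> bool" where
  "E (vtx a) (vtx b) \<Longrightarrow> tstep (xs @ [a, b] @ ys) (xs @ [b, a] @ ys)"

definition teq :: "int list \<Rightarrow> int list \<Rightarrow> bool" where
  "teq = tstep\<^sup>*\<^sup>*"

lemma teq_refl [simp, intro]: "teq u u"
  by (simp add: teq_def)

lemma teq_trans [trans]: "teq u v \<Longrightarrow> teq v w \<Longrightarrow> teq u w"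
  unfolding teq_def by (rule rtranclp_trans)

lemma tstep_sym: "tstep u v \<Longrightarrow> tstep v u"
  by (induction rule: tstep.induct) (rule tstep.intros, rule E_sym)

lemma teq_sym: "teq u v \<Longrightarrow> teq v u"
  unfolding teq_def
  by (induction rule: rtranclp_induct) (auto dest: tstep_sym intro: converse_rtranclp_into_rtranclp)

lemma teq_map:
  assumes "\<And>x y. tstep x y \<Longrightarrow> teq (h x) (h y)" "teq u v"
  shows "teq (h u) (h v)"
  using assms(2) unfolding teq_def[of]
  by (induction rule: rtranclp_induct) (auto dest: assms(1) simp: teq_def)

lemma tstep_teq: "tstep u v \<Longrightarrow> teq u v"
  by (simp add: teq_def)

lemma teq_invariant:
  assumes "\<And>x y. tstep x y \<Longrightarrow> h x = h y" "teq u v"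
  shows "h u = h v"
  using assms(2) unfolding teq_def by (induction rule: rtranclp_induct) (auto dest: assms(1))

lemma teq_length: "teq u v \<Longrightarrow> length u = length v"
  by (erule teq_invariant[rotated]) (auto elim: tstep.cases)

lemma teq_set: "teq u v \<Longrightarrow> set u = set v"
  by (erule teq_invariant[rotated]) (auto elim!: tstep.cases)

lemma teq_valid: "teq u v \<Longrightarrow> valid u = valid v"
  by (simp add: valid_word_def teq_set)

lemma teq_cong: "teq u v \<Longrightarrow> teq (xs @ u @ ys) (xs @ v @ ys)"
proof (rule teq_map[of "\<lambda>u. xs @ u @ ys"])
  fix x y assume "tstep x y"
  then show "teq (xs @ x @ ys) (xs @ y @ ys)"
  proof (induction rule: tstep.induct)
    case (1 a b us vs)
    then show ?case using tstep.intros[of a b "xs @ us" "vs @ ys"] by (simp add: tstep_teq)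
  qed
qed

lemma teq_append: "teq u u' \<Longrightarrow> teq v v' \<Longrightarrow> teq (u @ v) (u' @ v')"
  using teq_cong[of u u' "[]" v] teq_cong[of v v' u' "[]"] by (auto intro: teq_trans)

lemma teq_Cons: "teq u v \<Longrightarrow> teq (a # u) (a # v)"
  using teq_cong[of u v "[a]" "[]"] by simp

lemma teq_swap: "E (vtx a) (vtx b) \<Longrightarrow> teq (xs @ a # b # ys) (xs @ b # a # ys)"
  using tstep.intros[of a b xs ys] by (simp add: tstep_teq)

lemma teq_geq:
  assumes "teq u v" "valid u"
  shows "geq u v"
  using assms unfolding teq_def
proof (induction rule: rtranclp_induct)
  case (step x y)
  have "valid x" using teq_valid[of u x] step by (simp add: teq_def)
  with step(2) have "raag_step n E x y"
  proof (induction rule: tstep.induct)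
    case (1 a b xs ys)
    then show ?case using raag_step.commute[of n a b E xs ys] by simp
  qed
  then show ?case using step by (auto intro: geq_step geq_trans)
qed simp

lemma teq_filter: "teq u v \<Longrightarrow> teq (filter Q u) (filter Q v)"
proof (rule teq_map[of "filter Q"])
  fix x y assume "tstep x y"
  then show "teq (filter Q x) (filter Q y)"
    by (induction rule: tstep.induct) (auto intro: teq_swap)
qed

lemma teq_rev: "teq u v \<Longrightarrow> teq (rev u) (rev v)"
proof (rule teq_map[of rev])
  fix x y assume "tstep x y"
  then show "teq (rev x) (rev y)"
    by (induction rule: tstep.induct) (auto intro: teq_swap E_sym)
qed

lemma teq_move: "(\<And>b. b \<in> set y \<Longrightarrow> E (vtx a) (vtx b)) \<Longrightarrow> teq (a # y) (y @ [a])"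
proof (induction y)
  case (Cons b y)
  have "teq (a # b # y) (b # a # y)" using teq_swap[of a b "[]"] Cons by simp
  also have "teq (b # a # y) (b # y @ [a])" using Cons by (intro teq_Cons) auto
  finally show ?case by simp
qed simp

text \<open>The stack of \<open>v\<close> lists the letters of the word which do not commute with \<open>v\<close>;
  those at other vertices are recorded as 0. Together the stacks determine the trace.\<close>

definition pile :: "int list \<Rightarrow> nat \<Rightarrow> int list" where
  "pile w v = map (\<lambda>a. if vtx a = v then digit a else 0) (filter (\<lambda>a. \<not> E (vtx a) v) w)"

lemma pile_Nil [simp]: "pile [] v = []"
  by (simp add: pile_def)

lemma pile_append [simp]: "pile (u @ w) v = pile u v @ pile w v"
  by (simp add: pile_def)

lemma pile_Cons: "pile (a # w) v = (if E (vtx a) v then [] else [if vtx a = v then digit a else 0]) @ pile w v"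
  by (simp add: pile_def)

lemma pile_single: "pile [a] v = (if E (vtx a) v then [] else [if vtx a = v then digit a else 0])"
  by (simp add: pile_def)

lemma pile_rev: "pile (rev w) v = rev (pile w v)"
  by (simp add: pile_def rev_map rev_filter)

lemma teq_pile: "teq u v \<Longrightarrow> pile u = pile v"
proof (erule teq_invariant[rotated])
  fix x y assume "tstep x y"
  then show "pile x = pile y"
  proof (induction rule: tstep.induct)
    case (1 a b xs ys)
    then have "a \<noteq> b" "vtx a \<noteq> vtx b" by auto
    then show ?case using 1 E_sym by (auto simp: fun_eq_iff pile_Cons)
  qed
qed

lemma pile_digits: "set (pile w v) \<subseteq> {0, 1, 2}"
  by (auto simp: pile_def digit_def)

text \<open>A nonzero last entry on stack \<open>v\<close> comes from a letter at \<open>v\<close>,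
  and it is the last letter not commuting with \<open>v\<close>. All later letters commute with it,
  so it can be moved to the end.\<close>

lemma pile_last:
  assumes "pile w v \<noteq> []" "last (pile w v) \<noteq> 0"
  shows "\<exists>w' a. teq w (w' @ [a]) \<and> vtx a = v \<and> digit a = last (pile w v)"
  using assms
proof (induction w rule: rev_induct)
  case (snoc b w)
  show ?case
  proof (cases "E (vtx b) v")
    case True
    then obtain w' a where w: "teq w (w' @ [a])" "vtx a = v" "digit a = last (pile w v)"
      using snoc by (auto simp: pile_single)
    have "teq (w @ [b]) ((w' @ [a]) @ [b])" using w(1) by (intro teq_append) auto
    also have "teq ((w' @ [a]) @ [b]) ((w' @ [b]) @ [a])"
      using teq_swap[of a b w' "[]"] True w(2) E_sym by simp
    finally show ?thesis using w True
      by (intro exI[of _ "w' @ [b]"] exI[of _ a]) (auto simp: pile_single)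
  next
    case False
    then show ?thesis using snoc.prems
      by (intro exI[of _ w] exI[of _ b]) (auto simp: pile_single split: if_splits)
  qed
qed simp

lemma pile_hd:
  assumes "pile w v \<noteq> []" "hd (pile w v) \<noteq> 0"
  shows "\<exists>w' a. teq w (a # w') \<and> vtx a = v \<and> digit a = hd (pile w v)"
proof -
  obtain w' a where "teq (rev w) (w' @ [a])" "vtx a = v" "digit a = hd (pile w v)"
    using pile_last[of "rev w" v] assms by (auto simp: pile_rev last_rev)
  then show ?thesis using teq_rev[of "rev w" "w' @ [a]"] by auto
qed

text \<open>The last letter of \<open>w\<close> shows as a nonzero last entry on a stack of
  \<open>w'\<close> too, so it can be moved to the end of \<open>w'\<close> and removed from both
  words. The restriction to \<open>S\<close> is for later, when only the stacks of one component, or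
  only those below \<open>n\<close>, are compared.\<close>

lemma pile_inj_on:
  assumes "valid w" "valid w'" "vtx ` set w \<subseteq> S" "vtx ` set w' \<subseteq> S" "\<And>v. v \<in> S \<Longrightarrow> pile w v = pile w' v"
  shows "teq w w'"
  using assms
proof (induction w arbitrary: w' rule: rev_induct)
  case Nil
  show ?case
  proof (cases w')
    case (Cons b x)
    then have "pile w' (vtx b) \<noteq> []" by (auto simp: pile_Cons)
    then show ?thesis using Nil Cons by auto
  qed simp
next
  case (snoc a w)
  have eq: "pile w' (vtx a) = pile w (vtx a) @ [digit a]"
    using snoc.prems(3) snoc.prems(5)[of "vtx a"] by (simp add: pile_single)
  then obtain w'' b where b: "teq w' (w'' @ [b])" "vtx b = vtx a" "digit b = digit a"
    using pile_last[of w' "vtx a"] by auto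
  have val: "valid (w'' @ [b])" using teq_valid[OF b(1)] snoc.prems by simp
  then have "a \<noteq> 0" "b \<noteq> 0"
    using snoc.prems(1) valid_letter_nonzero[of n a] valid_letter_nonzero[of n b] by simp_all
  then have "b = a" using b by (simp add: letter_eqI)
  then have "pile w v = pile w'' v" if "v \<in> S" for v
    using teq_pile[OF b(1)] snoc.prems(5)[OF that] by simp
  moreover have "vtx ` set w'' \<subseteq> S" using teq_set[OF b(1)] snoc.prems by auto
  ultimately have "teq w w''" using snoc val by auto
  then have "teq (w @ [a]) (w'' @ [b])" using \<open>b = a\<close> by (intro teq_append) auto
  then show ?case using b teq_sym teq_trans by blast
qed

lemma pile_inj: "valid w \<Longrightarrow> valid w' \<Longrightarrow> pile w = pile w' \<Longrightarrow> teq w w'"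
  by (rule pile_inj_on[of _ _ UNIV]) auto

section \<open>Reduced words and multiplication of pilings\<close>

definition red :: "int list \<Rightarrow> bool" where
  "red w \<longleftrightarrow> (\<forall>v. reduced_stack (pile w v))"

lemma red_Nil [simp]: "red []"
  by (simp add: red_def reduced_stack_def)

lemma red_teq: "teq u v \<Longrightarrow> red u = red v"
  using teq_pile[of u v] by (simp add: red_def)

lemma red_appendD: "red (u @ w) \<Longrightarrow> red u \<and> red w"
  unfolding red_def by (auto dest: reduced_stack_appendD)

lemma red_rev [simp]: "red (rev w) = red w"
  by (simp add: red_def pile_rev reduced_stack_rev)

lemma red_snoc:
  assumes "red w" "pile w (vtx a) = [] \<or> last (pile w (vtx a)) \<noteq> 3 - digit a"
  shows "red (w @ [a])"
  unfolding red_def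
proof
  fix v
  have r: "reduced_stack (pile w v)" using assms by (simp add: red_def)
  have "reduced_stack (pile w v @ [0])"
  proof (rule reduced_stack_snoc[OF r])
    show "pile w v = [] \<or> last (pile w v) \<noteq> 3 - 0"
      using pile_digits[of w v] last_in_set[of "pile w v"] by fastforce
  qed
  moreover have "reduced_stack (pile w v @ [digit a])" if "vtx a = v"
    using reduced_stack_snoc[OF r] assms(2) that by simp
  ultimately show "reduced_stack (pile (w @ [a]) v)" using r by (auto simp: pile_single)
qed

lemma red_snocD:
  assumes "red (w @ [a])"
  shows "pile w (vtx a) = [] \<or> last (pile w (vtx a)) \<noteq> 3 - digit a"
proof (rule ccontr)
  assume *: "\<not> ?thesis"
  then have "pile w (vtx a) = butlast (pile w (vtx a)) @ [3 - digit a]"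
    by (metis append_butlast_last_id)
  then have "pile (w @ [a]) (vtx a) = butlast (pile w (vtx a)) @ [3 - digit a, 3 - (3 - digit a)] @ []"
    by (simp add: pile_single)
  then show False using assms unfolding red_def reduced_stack_def by blast
qed

text \<open>In the cancelling case the inverse letter can be moved to the end of the word, hence it
  is the last entry on every stack that it touches, and one \<open>butlast\<close> on each of them
  removes it. Only the ends of stacks are inspected and changed.\<close>

definition rmul :: "int \<Rightarrow> (nat \<Rightarrow> int list) \<Rightarrow> nat \<Rightarrow> int list" where
  "rmul a p = (if p (vtx a) \<noteq> [] \<and> last (p (vtx a)) = 3 - digit a
     then (\<lambda>v. if E (vtx a) v then p v else butlast (p v))
     else (\<lambda>v. if E (vtx a) v then p v else p v @ [if vtx a = v then digit a else 0]))"

definition lmul :: "int \<Rightarrow> (nat \<Rightarrow> int list) \<Rightarrow> nat \<Rightarrow> int list" where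
  "lmul a p = (if p (vtx a) \<noteq> [] \<and> hd (p (vtx a)) = 3 - digit a
     then (\<lambda>v. if E (vtx a) v then p v else tl (p v))
     else (\<lambda>v. if E (vtx a) v then p v else (if vtx a = v then digit a else 0) # p v))"

lemma lmul_rmul: "lmul a p = (\<lambda>v. rev (rmul a (\<lambda>v. rev (p v)) v))"
  by (auto simp: lmul_def rmul_def fun_eq_iff last_rev butlast_rev)

definition nfp :: "int list \<Rightarrow> nat \<Rightarrow> int list" where
  "nfp w = fold rmul w (\<lambda>_. [])"

lemma rmul_append: "\<not> (pile w (vtx a) \<noteq> [] \<and> last (pile w (vtx a)) = 3 - digit a) \<Longrightarrow> rmul a (pile w) = pile (w @ [a])"
  by (auto simp: rmul_def fun_eq_iff pile_single)

lemma rmul_cases: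
  assumes "valid w" "red w" "valid_letter n a"
  obtains (cancel) w' where "teq w (w' @ [- a])" "valid w'" "red w'" "geq (w @ [a]) w'"
      "rmul a (pile w) = pile w'" "red (w' @ [- a])"
      "pile w (vtx a) \<noteq> []" "last (pile w (vtx a)) = 3 - digit a"
    | (append) "red (w @ [a])" "rmul a (pile w) = pile (w @ [a])"
      "\<not> (pile w (vtx a) \<noteq> [] \<and> last (pile w (vtx a)) = 3 - digit a)"
proof (cases "pile w (vtx a) \<noteq> [] \<and> last (pile w (vtx a)) = 3 - digit a")
  case True
  then obtain w' b where b: "teq w (w' @ [b])" "vtx b = vtx a" "digit b = 3 - digit a"
    using pile_last[of w "vtx a"] by auto
  have v: "valid w'" "valid_letter n b" using teq_valid[OF b(1)] assms(1) by auto
  have "a \<noteq> 0" "b \<noteq> 0"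
    using v(2) assms(3) valid_letter_nonzero[of n a] valid_letter_nonzero[of n b] by simp_all
  then have "b = - a" using b by (simp add: letter_eqI)
  with b have t: "teq w (w' @ [- a])" by simp
  have "geq (w @ [a]) (w' @ [- a, a])"
    using geq_append[OF teq_geq[OF t assms(1)] geq_refl, of "[a]"] by simp
  also have "geq (w' @ [- a, a]) w'"
    using geq_step[OF raag_step.cancel[of n "- a" E w' "[]"]] assms(3) by simp
  finally have "geq (w @ [a]) w'" .
  moreover have r: "red (w' @ [- a])" using red_teq[OF t] assms(2) by simp
  moreover have "rmul a (pile w) = pile w'"
    using True by (auto simp: rmul_def teq_pile[OF t] fun_eq_iff pile_single)
  ultimately show ?thesis using cancel[of w'] t v red_appendD True by blast
next
  case False
  then show ?thesis using append red_snoc[OF assms(2)] rmul_append by blast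
qed

lemma nfp_red:
  assumes "valid w"
  shows "\<exists>r. valid r \<and> red r \<and> geq w r \<and> nfp w = pile r \<and> length r \<le> length w"
  using assms
proof (induction w rule: rev_induct)
  case Nil
  then show ?case by (intro exI[of _ "[]"]) (auto simp: nfp_def)
next
  case (snoc a w)
  then obtain r where r: "valid r" "red r" "geq w r" "nfp w = pile r" "length r \<le> length w" by auto
  have a: "valid_letter n a" using snoc by simp
  have g: "geq (w @ [a]) (r @ [a])" using r by (intro geq_append) auto
  have nf: "nfp (w @ [a]) = rmul a (pile r)" using r by (simp add: nfp_def)
  from r(1,2) a show ?case
  proof (cases rule: rmul_cases)
    case (cancel w')
    then have "length w' \<le> length r" using teq_length[of r "w' @ [- a]"] by simp
    then show ?thesis using cancel g nf r by (intro exI[of _ w']) (auto intro: geq_trans)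
  next
    case append
    then show ?thesis using g nf r a by (intro exI[of _ "r @ [a]"]) auto
  qed
qed

lemma rmul_inverse:
  assumes "valid r" "red r" "valid_letter n a"
  shows "rmul (- a) (rmul a (pile r)) = pile r"
  using assms
proof (cases rule: rmul_cases)
  case (cancel w')
  have "rmul (- a) (pile w') = pile (w' @ [- a])"
    using red_snocD[OF cancel(6)] by (intro rmul_append) auto
  then show ?thesis using cancel teq_pile[OF cancel(1)] by simp
next
  case append
  have "digit (- a) = 3 - digit a" using assms(3) valid_letter_nonzero digit_minus by blast
  then show ?thesis unfolding append(2)
    by (auto simp: rmul_def fun_eq_iff pile_single)
qed

text \<open>With \<open>rmul_inverse\<close> this is van der Waerden's argument: the generators act
  on the pilings of reduced words in accordance with the defining relations, so the result
  \<open>nfp w\<close> of acting on the empty piling depends only on the group element.\<close>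

lemma rmul_commute:
  assumes r: "valid r" "red r" "valid_letter n a" "valid_letter n b" and ab: "E (vtx a) (vtx b)"
  shows "rmul a (rmul b (pile r)) = rmul b (rmul a (pile r))"
proof -
  define c where "c = (\<lambda>a. pile r (vtx a) \<noteq> [] \<and> last (pile r (vtx a)) = 3 - digit a)"
  have ba: "E (vtx b) (vtx a)" "vtx a \<noteq> vtx b" using ab E_sym by auto
  \<comment> \<open>When \<open>a\<close> cancels, every other stack that it touches ends with its
    marker 0. Popping this marker and pushing that of the other letter, in either order, gives the
    stack back.\<close>
  have top: "butlast (pile r v) @ [0] = pile r v" if "c a" "\<not> E (vtx a) v" "v \<noteq> vtx a" "valid_letter n a" for a v
    using r(1,2) that(4)
  proof (cases rule: rmul_cases)
    case (cancel w')
    then show ?thesis using teq_pile[OF cancel(1)] that by (simp add: pile_single)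
  next
    case append
    then show ?thesis using that by (auto simp: c_def)
  qed
  have m: "rmul a p v = (if E (vtx a) v then p v else if c a then butlast (p v) else p v @ [if vtx a = v then digit a else 0])"
    if "p (vtx a) = pile r (vtx a)" for p v a
    using that by (simp add: rmul_def c_def)
  have pb: "rmul b (pile r) (vtx a) = pile r (vtx a)" using ba by (simp add: m)
  have pa: "rmul a (pile r) (vtx b) = pile r (vtx b)" using ab by (simp add: m)
  show ?thesis
  proof
    fix v
    note eqs = m[of "rmul b (pile r)" a v, OF pb] m[of "rmul a (pile r)" b v, OF pa]
      m[of "pile r" a v, OF refl] m[of "pile r" b v, OF refl]
    show "rmul a (rmul b (pile r)) v = rmul b (rmul a (pile r)) v"
    proof (cases "E (vtx a) v \<or> E (vtx b) v")
      case True
      then show ?thesis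
        by (cases "E (vtx a) v"; cases "E (vtx b) v") (simp_all only: eqs if_True if_False simp_thms)
    next
      case False
      then have v: "v \<noteq> vtx a" "v \<noteq> vtx b" using ab ba by auto
      have sa: "butlast (pile r v) @ [0] = pile r v" if "c a"
        using top[OF that _ v(1) r(3)] False by blast
      have sb: "butlast (pile r v) @ [0] = pile r v" if "c b"
        using top[OF that _ v(2) r(4)] False by blast
      show ?thesis unfolding eqs using False v sa sb by (cases "c a"; cases "c b") simp_all
    qed
  qed
qed

lemma nfp_append: "nfp (u @ v) = fold rmul v (nfp u)"
  by (simp add: nfp_def)

lemma geq_nfp:
  assumes "geq u v" "valid u"
  shows "nfp u = nfp v"
  using assms
proof (induction rule: geq_induct)
  case (step x y)
  have "nfp x = nfp y" if "raag_step n E x y" "valid x" for x y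
    using that
  proof (induction rule: raag_step.induct)
    case (cancel a xs ys)
    then obtain r where "valid r" "red r" "nfp xs = pile r" using nfp_red[of xs] by auto
    then show ?case using rmul_inverse[of r a] cancel by (simp add: nfp_append)
  next
    case (commute a b xs ys)
    then obtain r where "valid r" "red r" "nfp xs = pile r" using nfp_red[of xs] by auto
    then show ?case using rmul_commute[of r a b] commute by (simp add: nfp_append)
  qed
  moreover have "valid x" "valid y" using step geq_valid[of u x] geq_valid[OF geq_step] by auto
  ultimately show ?case using step by auto
qed simp

lemma nfp_reduced: "red r \<Longrightarrow> nfp r = pile r"
proof (induction r rule: rev_induct)
  case Nil
  then show ?case by (simp add: nfp_def fun_eq_iff)
next
  case (snoc a r)
  then have "nfp r = pile r" using red_appendD by blast
  then show ?case using red_snocD[OF snoc.prems] rmul_append[of r a] by (auto simp: nfp_def)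
qed

lemma geq_iff_nfp:
  assumes "valid u" "valid v"
  shows "geq u v \<longleftrightarrow> nfp u = nfp v"
proof
  assume *: "nfp u = nfp v"
  obtain r s where r: "valid r" "geq u r" "nfp u = pile r" and s: "valid s" "geq v s" "nfp v = pile s"
    using nfp_red[OF assms(1)] nfp_red[OF assms(2)] by blast
  have "teq r s" using pile_inj r s * by simp
  then have "geq r s" using teq_geq r by blast
  then have "geq u s" by (rule geq_trans[OF r(2)])
  then show "geq u v" using geq_sym[OF s(2)] by (rule geq_trans)
next
  assume "geq u v"
  then show "nfp u = nfp v" using assms(1) by (rule geq_nfp)
qed

lemma red_geq_iff:
  assumes "valid u" "valid v" "red u" "red v"
  shows "geq u v \<longleftrightarrow> teq u v"
  unfolding geq_iff_nfp[OF assms(1,2)] nfp_reduced[OF assms(3)] nfp_reduced[OF assms(4)]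
  using pile_inj[OF assms(1,2)] teq_pile[of u v] by blast

lemma red_exists: "valid w \<Longrightarrow> \<exists>r. valid r \<and> red r \<and> geq w r \<and> length r \<le> length w"
  using nfp_red by blast

lemma raag_len_red:
  assumes "valid r" "red r" "geq w r"
  shows "raag_len n E w = length r"
  unfolding raag_len_def
proof (rule Least_equality)
  show "\<exists>w'. valid w' \<and> length w' = length r \<and> geq w w'" using assms by blast
next
  fix k assume "\<exists>w'. valid w' \<and> length w' = k \<and> geq w w'"
  then obtain w' where w': "valid w'" "length w' = k" "geq w w'" by blast
  obtain s where s: "valid s" "red s" "geq w' s" "length s \<le> length w'" using red_exists w' by blast
  have "geq r s" by (rule geq_trans[OF geq_sym[OF assms(3)] geq_trans[OF w'(3) s(3)]])
  then have "teq r s" unfolding red_geq_iff[OF assms(1) s(1) assms(2) s(2)] .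
  from teq_length[OF this] show "length r \<le> k" using s w' by simp
qed

lemma raag_len_le:
  assumes "valid w"
  shows "raag_len n E w \<le> length w"
proof -
  obtain r where r: "valid r" "red r" "geq w r" "length r \<le> length w" using red_exists[OF assms] by blast
  show ?thesis using raag_len_red[OF r(1-3)] r(4) by simp
qed

lemma raag_len_geq:
  assumes "geq u v"
  shows "raag_len n E u = raag_len n E v"
proof -
  have "geq u w = geq v w" for w
    using geq_trans[OF assms, of w] geq_trans[OF geq_sym[OF assms], of w] by blast
  then show ?thesis by (simp add: raag_len_def)
qed

text \<open>Translates reducedness into word length, the form in which a length-preserving map keeps
  it. If some prefix is reduced but its extension by one letter is not, that letter cancels and a
  shorter equal word results.\<close>

lemma red_iff_len:
  assumes v: "valid w"
  shows "red w \<longleftrightarrow> raag_len n E w = length w"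
proof
  assume l: "raag_len n E w = length w"
  have "red u \<or> (\<exists>r. valid r \<and> geq u r \<and> length r < length u)" if "valid u" for u
    using that
  proof (induction u rule: rev_induct)
    case (snoc a u)
    show ?case
    proof (cases "red u")
      case True
      have "valid u" "valid_letter n a" using snoc by auto
      from this(1) True this(2) show ?thesis
      proof (cases rule: rmul_cases)
        case (cancel w')
        then show ?thesis using teq_length[OF cancel(1)] by (intro disjI2 exI[of _ w']) auto
      qed simp
    next
      case False
      then obtain r where "valid r" "geq u r" "length r < length u" using snoc by auto
      then show ?thesis using snoc.prems geq_append[of u r "[a]" "[a]"]
        by (intro disjI2 exI[of _ "r @ [a]"]) auto
    qed
  qed simp
  from this[OF v] show "red w"
  proof
    assume "\<exists>r. valid r \<and> geq w r \<and> length r < length w"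
    then obtain r where r: "valid r" "geq w r" "length r < length w" by blast
    then show ?thesis using raag_len_le[OF r(1)] raag_len_geq[OF r(2)] l by simp
  qed
next
  assume "red w"
  then show "raag_len n E w = length w" using raag_len_red[of w w] v by simp
qed

lemma lmul_cases:
  assumes "valid w" "red w" "valid_letter n a"
  obtains (cancel) w' where "teq w (- a # w')" "valid w'" "red w'" "geq (a # w) w'"
      "lmul a (pile w) = pile w'"
    | (cons) "red (a # w)" "lmul a (pile w) = pile (a # w)"
proof -
  have e: "(\<lambda>v. rev (pile w v)) = pile (rev w)" by (simp add: fun_eq_iff pile_rev)
  have r: "valid (rev w)" "red (rev w)" using assms by auto
  from r assms(3) show ?thesis
  proof (cases rule: rmul_cases)
    case (cancel w')
    show ?thesis
    proof (rule that(1)[of "rev w'"])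
      show "teq w (- a # rev w')" using teq_rev[OF cancel(1)] by simp
      show "geq (a # w) (rev w')" using geq_rev[OF cancel(4)] by simp
      show "lmul a (pile w) = pile (rev w')" by (simp add: lmul_rmul e cancel pile_rev fun_eq_iff)
    qed (use cancel in auto)
  next
    case append
    show ?thesis
    proof (rule that(2))
      show "red (a # w)" using append(1) red_rev[of "a # w"] by simp
      show "lmul a (pile w) = pile (a # w)"
        by (simp add: lmul_rmul e append pile_rev fun_eq_iff pile_Cons pile_single)
    qed
  qed
qed

lemma nfp_snoc: "nfp (w @ [a]) = rmul a (nfp w)"
  by (simp add: nfp_def)

text \<open>Left multiplication acts directly on the normal form, at the other end of the stacks. A
  conjugation is thus one operation at each end, without recomputing the normal form.\<close>

lemma nfp_Cons:
  assumes "valid w" "valid_letter n a"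
  shows "nfp (a # w) = lmul a (nfp w)"
proof -
  obtain r where r: "valid r" "red r" "geq w r" "nfp w = pile r" using nfp_red assms by blast
  have g: "geq (a # w) (a # r)" using r by (intro geq_Cons)
  from r(1,2) assms(2) show ?thesis
  proof (cases rule: lmul_cases)
    case (cancel w')
    then have "nfp (a # w) = nfp w'" by (intro geq_nfp[OF geq_trans[OF g]]) (use assms in auto)
    then show ?thesis using cancel r nfp_reduced by simp
  next
    case cons
    then have "nfp (a # w) = nfp (a # r)" by (intro geq_nfp[OF g]) (use assms in auto)
    then show ?thesis using cons r nfp_reduced by simp
  qed
qed

end

subsection \<open>Twisted conjugacy for a length-preserving letter map\<close>

lemma hom_simps [simp]:
  "hom f [] = []"
  "hom f (a # w) = (if a > 0 then f (vtx a) else inv_word (f (vtx a))) @ hom f w"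
  by (auto simp: hom_def)

locale twist = raag +
  fixes F :: "int \<Rightarrow> int"
  assumes F_valid [simp]: "valid_letter n (F a) = valid_letter n a"
    and F_minus [simp]: "F (- a) = - F a"
    and F_E: "valid_letter n a \<Longrightarrow> valid_letter n b \<Longrightarrow> E (vtx (F a)) (vtx (F b)) \<longleftrightarrow> E (vtx a) (vtx b)"
    and F_len: "valid_word n w \<Longrightarrow> raag_len n E (map F w) = raag_len n E w"
begin

lemma map_F_valid [simp]: "valid (map F w) = valid w"
  by (induction w) auto

lemma inv_word_map_F [simp]: "inv_word (map F w) = map F (inv_word w)"
  by (induction w) auto

lemma geq_map_F: "geq u v \<Longrightarrow> geq (map F u) (map F v)"
proof (rule geq_map[of "map F"])
  fix x y assume "raag_step n E x y"
  then show "geq (map F x) (map F y)"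
  proof (induction rule: raag_step.induct)
    case (cancel a xs ys)
    then show ?case using raag_step.cancel[of n "F a" E "map F xs" "map F ys"]
      by (auto intro: geq_step)
  next
    case (commute a b xs ys)
    then show ?case using raag_step.commute[of n "F a" "F b" E "map F xs" "map F ys"]
      by (auto intro: geq_step simp: F_E)
  qed
qed

lemma red_map_F: "valid w \<Longrightarrow> red w \<Longrightarrow> red (map F w)"
  by (simp add: red_iff_len F_len)

definition tw :: "int list \<Rightarrow> int list \<Rightarrow> bool" where
  "tw u v \<longleftrightarrow> (\<exists>w. valid w \<and> geq v (inv_word (map F w) @ u @ w))"

lemma tw_geq: "geq u v \<Longrightarrow> tw u v"
  unfolding tw_def by (intro exI[of _ "[]"]) (auto intro: geq_sym)

lemma tw_trans:
  assumes "tw u v" "tw v x"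
  shows "tw u x"
proof -
  obtain w w' where w: "valid w" "geq v (inv_word (map F w) @ u @ w)"
    and w': "valid w'" "geq x (inv_word (map F w') @ v @ w')"
    using assms unfolding tw_def by blast
  have "geq x (inv_word (map F w') @ (inv_word (map F w) @ u @ w) @ w')"
    by (rule geq_trans[OF w'(2)]) (rule geq_cong[OF w(2)])
  then show ?thesis unfolding tw_def using w(1) w'(1)
    by (intro exI[of _ "w @ w'"]) simp
qed

lemma tw_sym:
  assumes "tw u v" "valid u" "valid v"
  shows "tw v u"
proof -
  obtain w where w: "valid w" "geq v (inv_word (map F w) @ u @ w)"
    using assms unfolding tw_def by blast
  have "geq (map F w @ v) (u @ w)"
    using geq_move_left[of "inv_word (map F w)" v "u @ w"] w assms by simp
  then have "geq (map F w @ v @ inv_word w) (u @ w @ inv_word w)"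
    using geq_append[of "map F w @ v" "u @ w" "inv_word w" "inv_word w"] by simp
  also have "geq (u @ w @ inv_word w) (u @ [])"
    using w by (intro geq_append geq_cancel_right) auto
  finally show ?thesis unfolding tw_def using w(1)
    by (intro exI[of _ "inv_word w"]) (auto intro: geq_sym simp flip: inv_word_map_F)
qed

lemma tw_single: "valid_letter n a \<Longrightarrow> geq v (- F a # u @ [a]) \<Longrightarrow> tw u v"
  unfolding tw_def by (intro exI[of _ "[a]"]) auto

end

context raag
begin

lemma geq_pair_comm:
  assumes "geq [a, b] [b, a]" "valid_letter n a" "valid_letter n b" "vtx a \<noteq> vtx b"
  shows "E (vtx a) (vtx b)"
proof (rule ccontr)
  assume E: "\<not> E (vtx a) (vtx b)"
  have "red ([] @ [x])" for x by (rule red_snoc) auto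
  then have "red ([x] @ [y])" if "vtx x \<noteq> vtx y" for x y
    using that by (intro red_snoc) (auto simp: pile_single)
  from this[of a b] this[of b a] have "teq [a, b] [b, a]"
    using red_geq_iff[of "[a, b]" "[b, a]"] assms by simp
  from fun_cong[OF teq_pile[OF this], of "vtx a"] show False
    using E E_sym[of "vtx b" "vtx a"] assms(4) by (auto simp: pile_Cons split: if_splits)
qed

lemma geq_single_eq:
  assumes "geq [a] [b]" "valid_letter n a" "valid_letter n b"
  shows "a = b"
proof -
  have "red ([] @ [x])" for x by (rule red_snoc) auto
  then have "teq [a] [b]" using red_geq_iff[of "[a]" "[b]"] assms by simp
  from teq_set[OF this] show ?thesis by simp
qed

text \<open>A generator has length 1, so its image equals a single letter. For letters at different
  vertices commuting means adjacency, and the automorphism preserves and reflects commuting; this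
  gives the graph condition on \<open>F\<close>.\<close>

lemma length_preserving_letter_map:
  assumes aut: "raag_aut n E f" and lp: "length_preserving n E f"
  obtains F where "twist n E F" "\<And>w. valid w \<Longrightarrow> geq (hom f w) (map F w)"
    "\<And>a. \<not> valid_letter n a \<Longrightarrow> F a = a"
proof -
  have fv: "valid (f v)" if "v < n" for v using aut that by (auto simp: raag_aut_def)
  have "\<exists>b. valid_letter n b \<and> geq (f v) [b]" if v: "v < n" for v
  proof -
    let ?a = "int v + 1"
    have va: "vtx ?a = v" "valid [?a]" using v by (auto simp: vtx_def valid_letter_def)
    have "red ([] @ [?a])" by (rule red_snoc) auto
    then have "raag_len n E (f v) = 1"
      using lp va raag_len_red[of "[?a]" "[?a]"] by (auto simp: length_preserving_def dest!: spec[of _ "[?a]"])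
    moreover obtain r where "valid r" "red r" "geq (f v) r" using red_exists[OF fv[OF v]] by blast
    ultimately have "valid r" "geq (f v) r" "length r = 1" using raag_len_red[of r "f v"] by auto
    then show ?thesis by (auto simp: length_Suc_conv)
  qed
  then obtain h where h: "\<And>v. v < n \<Longrightarrow> valid_letter n (h v) \<and> geq (f v) [h v]" by metis
  \<comment> \<open>Off the alphabet \<open>F\<close> is the identity, so that the sign law and
    validity hold for every integer.\<close>
  define F where "F a = (if \<not> valid_letter n a then a else if a > 0 then h (vtx a) else - h (vtx a))" for a
  have Fm: "F (- a) = - F a" for a using valid_letter_nonzero[of n a] by (auto simp: F_def)
  have Fv: "valid_letter n (F a) = valid_letter n a" for a
    using h vtx_less by (auto simp: F_def)
  have hom: "geq (hom f w) (map F w)" if "valid w" for w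
    using that
  proof (induction w)
    case (Cons a w)
    then have a: "valid_letter n a" "a \<noteq> 0" using valid_letter_nonzero[of n a] by auto
    have g: "geq (f (vtx a)) [h (vtx a)]" using h vtx_less[OF a(1)] by blast
    then have "geq (inv_word (f (vtx a))) [- h (vtx a)]" using geq_inv[OF g] by simp
    then have "geq (if a > 0 then f (vtx a) else inv_word (f (vtx a))) [F a]"
      using g a by (auto simp: F_def)
    then show ?case using geq_append[of _ "[F a]" "hom f w" "map F w"] Cons by simp
  qed simp
  have map_valid: "valid (map F w)" if "valid w" for w using that Fv by (induction w) auto
  have transfer: "geq (map F u) (map F v) \<longleftrightarrow> geq u v" if "valid u" "valid v" for u v
  proof -
    have "geq (map F u) (map F v) \<longleftrightarrow> geq (hom f u) (hom f v)"
      using hom[OF that(1)] hom[OF that(2)] by (meson geq_sym geq_trans)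
    also have "\<dots> \<longleftrightarrow> geq u v" using aut that unfolding raag_aut_def by blast
    finally show ?thesis .
  qed
  have FE: "E (vtx (F a)) (vtx (F b)) \<longleftrightarrow> E (vtx a) (vtx b)" if a: "valid_letter n a" and b: "valid_letter n b" for a b
  proof -
    have a0: "a \<noteq> 0" "b \<noteq> 0" "F a \<noteq> 0" "F b \<noteq> 0"
      using a b Fv valid_letter_nonzero by blast+
    \<comment> \<open>Letters at one vertex commute without being adjacent, so distinctness of
      vertices has to be transported before commuting can be read as adjacency.\<close>
    have eq: "vtx (F a) = vtx (F b) \<longleftrightarrow> vtx a = vtx b"
    proof -
      have "geq [F a] [F c] \<longleftrightarrow> geq [a] [c]" if "valid_letter n c" for c
        using transfer[of "[a]" "[c]"] a that by simp
      then have inj: "F a = F c \<longleftrightarrow> a = c" if "valid_letter n c" for c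
        using geq_single_eq[of a c] a that by (metis geq_refl)
      have "vtx (F a) = vtx (F b) \<longleftrightarrow> F a = F b \<or> F a = F (- b)"
        using a0 Fm by (auto simp: vtx_eq_iff)
      also have "\<dots> \<longleftrightarrow> a = b \<or> a = - b" using inj[of b] inj[of "- b"] b by simp
      also have "\<dots> \<longleftrightarrow> vtx a = vtx b" using a0 by (auto simp: vtx_eq_iff)
      finally show ?thesis .
    qed
    have comm: "geq [c, d] [d, c]" if "E (vtx c) (vtx d)" "valid_letter n c" "valid_letter n d" for c d
      using geq_step[OF raag_step.commute[of n c d E "[]" "[]"]] that by simp
    have tr: "geq [F a, F b] [F b, F a] \<longleftrightarrow> geq [a, b] [b, a]"
      using transfer[of "[a, b]" "[b, a]"] a b by simp
    show ?thesis
    proof (cases "vtx a = vtx b")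
      case True
      then have "vtx (F a) = vtx (F b)" using eq by simp
      then show ?thesis using True by simp
    next
      case False
      then have ne: "vtx (F a) \<noteq> vtx (F b)" using eq by simp
      have "E (vtx a) (vtx b) \<longleftrightarrow> geq [a, b] [b, a]"
        using comm[of a b] geq_pair_comm[of a b] False a b by blast
      moreover have "E (vtx (F a)) (vtx (F b)) \<longleftrightarrow> geq [F a, F b] [F b, F a]"
        using comm[of "F a" "F b"] geq_pair_comm[of "F a" "F b"] ne a b Fv by blast
      ultimately show ?thesis using tr by blast
    qed
  qed
  have Flen: "raag_len n E (map F w) = raag_len n E w" if "valid w" for w
    using raag_len_geq[OF hom[OF that]] lp that by (simp add: length_preserving_def)
  have "twist n E F"
    by unfold_locales (use Fm Fv FE Flen in auto)
  then show ?thesis using that hom by (auto simp: F_def)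
qed

end

context twist
begin

lemma twisted_conj_iff_tw:
  assumes "\<And>w. valid w \<Longrightarrow> geq (hom f w) (map F w)"
  shows "twisted_conj n E f u v \<longleftrightarrow> tw u v"
proof -
  have "geq v (inv_word (hom f w) @ u @ w) \<longleftrightarrow> geq v (inv_word (map F w) @ u @ w)" if "valid w" for w
  proof -
    have "geq (inv_word (hom f w) @ u @ w) (inv_word (map F w) @ u @ w)"
      using geq_append[OF geq_inv[OF assms[OF that]] geq_refl, of "u @ w"] .
    then show ?thesis by (meson geq_sym geq_trans)
  qed
  then show ?thesis unfolding tw_def twisted_conj_def by blast
qed

end

subsection \<open>Prefixes of the left greedy normal form\<close>

context raag
begin

text \<open>A heap of pieces: \<open>h x\<close> is the level on which the next letter at
  \<open>x\<close> comes to rest. The letter \<open>a\<close> rests on level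
  \<open>h (vtx a)\<close> and blocks it for all vertices not adjacent to its own, itself included.
  From height 0 the levels are the layers of the greedy (Cartier-Foata) normal form.\<close>

definition raise :: "(nat \<Rightarrow> nat) \<Rightarrow> int \<Rightarrow> nat \<Rightarrow> nat" where
  "raise h a x = (if E (vtx a) x then h x else max (h x) (Suc (h (vtx a))))"

text \<open>The subword of the letters in the first \<open>i\<close> layers of the heap of a word, on top of
  a heap whose column heights are given by \<open>h\<close>.\<close>

primrec layers :: "(nat \<Rightarrow> nat) \<Rightarrow> nat \<Rightarrow> int list \<Rightarrow> int list" where
  "layers h i [] = []"
| "layers h i (a # w) = (if h (vtx a) < i then [a] else []) @ layers (raise h a) i w"

lemma layers_append: "layers h i (u @ w) = layers h i u @ layers (foldl raise h u) i w"
  by (induction u arbitrary: h) auto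

lemma set_layers: "set (layers h i w) \<subseteq> set w"
  by (induction w arbitrary: h) auto

lemma valid_layers: "valid w \<Longrightarrow> valid (layers h i w)"
  using set_layers[of h i w] by (auto simp: valid_word_def)

lemma layers_teq: "teq u v \<Longrightarrow> teq (layers h i u) (layers h i v)"
proof (rule teq_map[of "layers h i"])
  fix x y assume "tstep x y"
  then show "teq (layers h i x) (layers h i y)"
  proof (induction rule: tstep.induct)
    case (1 a b xs ys)
    let ?h = "foldl raise h xs"
    have "raise (raise ?h a) b = raise (raise ?h b) a" "raise ?h a (vtx b) = ?h (vtx b)"
      "raise ?h b (vtx a) = ?h (vtx a)"
      using 1 E_sym by (auto simp: raise_def fun_eq_iff)
    then show ?case using 1 teq_swap[of a b "layers h i xs"] by (auto simp: layers_append)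
  qed
qed

lemma layers_0 [simp]: "layers h 0 w = []"
  by (induction w arbitrary: h) auto

lemma layers_all: "\<forall>x. h x + length w \<le> i \<Longrightarrow> layers h i w = w"
proof (induction w arbitrary: h)
  case (Cons a w)
  have "\<forall>x. raise h a x + length w \<le> i"
  proof
    fix x show "raise h a x + length w \<le> i"
      using Cons.prems[rule_format, of x] Cons.prems[rule_format, of "vtx a"] by (auto simp: raise_def)
  qed
  then show ?case using Cons.IH[of "raise h a"] Cons.prems[rule_format, of "vtx a"] by auto
qed simp

lemma layers_shift: "layers (\<lambda>x. Suc (h x)) (Suc i) w = layers h i w"
proof (induction w arbitrary: h)
  case (Cons a w)
  have "raise (\<lambda>x. Suc (h x)) a = (\<lambda>x. Suc (raise h a x))" by (auto simp: raise_def fun_eq_iff)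
  then show ?case using Cons[of "raise h a"] by simp
qed simp

lemma raise_ge: "h x \<le> raise h a x"
  by (simp add: raise_def)

lemma layers_above:
  assumes "b \<in> set (layers h i w)" "\<And>x. \<not> E v x \<Longrightarrow> i \<le> h x"
  shows "E v (vtx b)"
  using assms
proof (induction w arbitrary: h)
  case (Cons a w)
  have r: "i \<le> raise h a x" if "\<not> E v x" for x
    using Cons.prems(2)[OF that] raise_ge[of h x a] by (rule le_trans)
  consider "b = a" "h (vtx a) < i" | "b \<in> set (layers (raise h a) i w)"
    using Cons.prems(1) by (auto split: if_splits)
  then show ?case
  proof cases
    case 1
    then show ?thesis using Cons.prems(2)[of "vtx a"] by (meson leD)
  next
    case 2
    then show ?thesis using r by (rule Cons.IH)
  qed
qed simp

text \<open>A letter is kept under \<open>h\<close> and dropped under \<open>h'\<close> only if its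
  column has height \<open>i - 1\<close> under \<open>h\<close> and \<open>i\<close> under
  \<open>h'\<close>. All letters kept later under \<open>h'\<close> then commute with it, so it can
  be moved to the end; and its column is full under \<open>h\<close> from then on, so each vertex
  yields at most one extra letter.\<close>

lemma layers_lag:
  assumes "valid w" "\<And>x. h x \<le> h' x \<and> h' x \<le> Suc (h x)"
  shows "\<exists>y. valid y \<and> teq (layers h i w) (layers h' i w @ y) \<and> length y \<le> card {x. x < n \<and> h x < i}"
  using assms
proof (induction w arbitrary: h h')
  case (Cons a w)
  let ?g = "raise h a" and ?g' = "raise h' a"
  have lag: "?g x \<le> ?g' x \<and> ?g' x \<le> Suc (?g x)" for x
    using Cons.prems(2)[of x] Cons.prems(2)[of "vtx a"] by (auto simp: raise_def)
  have "\<exists>y. valid y \<and> teq (layers ?g i w) (layers ?g' i w @ y) \<and> length y \<le> card {x. x < n \<and> ?g x < i}"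
    by (rule Cons.IH) (use Cons.prems(1) lag in auto)
  then obtain y where y: "valid y" "teq (layers ?g i w) (layers ?g' i w @ y)"
    "length y \<le> card {x. x < n \<and> ?g x < i}"
    by blast
  have a: "vtx a < n" "valid_letter n a" using Cons.prems vtx_less by auto
  have sub: "{x. x < n \<and> ?g x < i} \<subseteq> {x. x < n \<and> h x < i}" using raise_ge le_less_trans by blast
  have fin: "finite {x. x < n \<and> h x < i}" by simp
  have le: "card {x. x < n \<and> ?g x < i} \<le> card {x. x < n \<and> h x < i}" by (rule card_mono[OF fin sub])
  consider "h (vtx a) < i" "h' (vtx a) < i" | "h (vtx a) < i" "i \<le> h' (vtx a)" | "i \<le> h (vtx a)"
    by linarith
  then show ?case
  proof cases
    case 1
    then show ?thesis using y le by (intro exI[of _ y]) (auto intro: teq_Cons)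
  next
    case 2
    then have hi: "Suc (h (vtx a)) = i" "h' (vtx a) = i" using Cons.prems(2)[of "vtx a"] by auto
    have "vtx a \<in> {x. x < n \<and> h x < i}" "vtx a \<notin> {x. x < n \<and> ?g x < i}"
      using 2 a hi by (auto simp: raise_def)
    then have "card {x. x < n \<and> ?g x < i} < card {x. x < n \<and> h x < i}"
      using sub by (intro psubset_card_mono[OF fin]) auto
    then have len: "length (a # y) \<le> card {x. x < n \<and> h x < i}" using y(3) by simp
    have "E (vtx a) (vtx b)" if "b \<in> set (layers ?g' i w)" for b
      by (rule layers_above[OF that]) (use hi in \<open>auto simp: raise_def\<close>)
    then have "teq ((a # layers ?g' i w) @ y) ((layers ?g' i w @ [a]) @ y)"
      by (intro teq_append teq_move) auto
    moreover have "teq (a # layers ?g i w) (a # layers ?g' i w @ y)" using y(2) by (rule teq_Cons)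
    ultimately have "teq (a # layers ?g i w) (layers ?g' i w @ (a # y))"
      using teq_trans by auto
    then show ?thesis using 2 len y(1) a by (intro exI[of _ "a # y"]) auto
  next
    case 3
    then have "i \<le> h' (vtx a)" using Cons.prems(2)[of "vtx a"] by linarith
    then show ?thesis using 3 y le by (intro exI[of _ y]) auto
  qed
qed (auto intro!: exI[of _ "[]"])

abbreviation "layer \<equiv> layers (\<lambda>_. 0)"

lemma card_less_n: "card {x. x < n \<and> Q x} \<le> n"
  using card_mono[of "{..<n}" "{x. x < n \<and> Q x}"] by auto

text \<open>Starting one level higher hides exactly one layer, so consecutive greedy prefixes are
  compared by \<open>layers_lag\<close> for the constant heights 0 and 1.\<close>

lemma layer_Suc:
  assumes "valid w"
  shows "\<exists>y. valid y \<and> teq (layer (Suc i) w) (layer i w @ y) \<and> length y \<le> n"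
  using layers_lag[OF assms, of "\<lambda>_. 0" "\<lambda>_. Suc 0" "Suc i"] layers_shift[of "\<lambda>_. 0" i w]
    card_less_n[of "\<lambda>x. 0 < Suc i"] by auto

text \<open>A new first letter raises no column by more than one, which is the situation of
  \<open>layers_lag\<close>.\<close>

lemma layer_Cons:
  assumes "valid (a # w)"
  shows "\<exists>y. valid y \<and> teq (a # layer i w) (layer i (a # w) @ y) \<and> length y \<le> n"
proof (cases "i = 0")
  case True
  have "vtx a < n" using assms vtx_less by auto
  then show ?thesis using True assms by (intro exI[of _ "[a]"]) auto
next
  case False
  have "\<exists>y. valid y \<and> teq (layer i w) (layers (raise (\<lambda>_. 0) a) i w @ y) \<and>
    length y \<le> card {x. x < n \<and> 0 < i}"
    by (rule layers_lag) (use assms in \<open>auto simp: raise_def\<close>)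
  then obtain y where y: "valid y" "teq (layer i w) (layers (raise (\<lambda>_. 0) a) i w @ y)"
    "length y \<le> card {x. x < n \<and> 0 < i}" by blast
  then show ?thesis using False card_less_n[of "\<lambda>x. 0 < i"] teq_Cons[OF y(2), of a]
    by (intro exI[of _ y]) auto
qed

lemma layer_snoc: "layer i (w @ [a]) = layer i w \<or> layer i (w @ [a]) = layer i w @ [a]"
  by (simp add: layers_append)

end

section \<open>Fellow travelling of prefixes and the length of conjugators\<close>

context twist
begin

lemma layers_map_F:
  assumes "valid w" "\<And>a. valid_letter n a \<Longrightarrow> h' (vtx (F a)) = h (vtx a)"
  shows "layers h' i (map F w) = map F (layers h i w)"
  using assms
proof (induction w arbitrary: h h')
  case (Cons a w)
  have "raise h' (F a) (vtx (F b)) = raise h a (vtx b)" if "valid_letter n b" for b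
    using Cons.prems that by (auto simp: raise_def F_E)
  then show ?case using Cons.IH[of "raise h' (F a)" "raise h a"] Cons.prems by simp
qed simp

text \<open>Each letter of \<open>u\<close> displaces the prefixes by at most \<open>n\<close>
  letters. A cancelling letter is \<open>layer_Cons\<close> read backwards, since the old trace then
  is \<open>- a # z'\<close>.\<close>

lemma left_fellow:
  assumes "valid u" "valid w" "red w"
  shows "\<exists>z. valid z \<and> red z \<and> geq (u @ w) z \<and>
    (\<forall>i. \<exists>y. valid y \<and> length y \<le> n * length u \<and> geq (u @ layer i w) (layer i z @ y))"
  using assms
proof (induction u)
  case Nil
  then show ?case by (intro exI[of _ w]) (auto intro!: exI[of _ "[]"])
next
  case (Cons a u)
  then obtain z where z: "valid z" "red z" "geq (u @ w) z"
    and zi: "\<And>i. \<exists>y. valid y \<and> length y \<le> n * length u \<and> geq (u @ layer i w) (layer i z @ y)" by auto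
  have a: "valid_letter n a" using Cons by simp
  have g: "geq ((a # u) @ w) (a # z)" using geq_Cons[OF z(3), of a] by simp
  have step: "\<exists>y. valid y \<and> length y \<le> n * length (a # u) \<and> geq ((a # u) @ layer i w) (layer i z' @ y)"
    if z': "\<exists>y'. valid y' \<and> length y' \<le> n \<and> geq (a # layer i z) (layer i z' @ y')" for i z'
  proof -
    obtain y where y: "valid y" "length y \<le> n * length u" "geq (u @ layer i w) (layer i z @ y)"
      using zi by blast
    obtain y' where y': "valid y'" "length y' \<le> n" "geq (a # layer i z) (layer i z' @ y')"
      using z' by blast
    have "geq (a # u @ layer i w) (a # layer i z @ y)" using y(3) by (rule geq_Cons)
    also have "geq (a # layer i z @ y) ((layer i z' @ y') @ y)"
      using geq_append[OF y'(3) geq_refl, of y] by simp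
    finally show ?thesis using y y' by (intro exI[of _ "y' @ y"]) auto
  qed
  from z(1,2) a show ?case
  proof (cases rule: lmul_cases)
    case (cancel z')
    have val: "valid (- a # z')" using cancel a by simp
    have "\<exists>y'. valid y' \<and> length y' \<le> n \<and> geq (a # layer i z) (layer i z' @ y')" for i
    proof -
      obtain y where y: "valid y" "teq (- a # layer i z') (layer i (- a # z') @ y)" "length y \<le> n"
        using layer_Cons[OF val] by blast
      have vl: "valid (layer i z)" "valid (layer i z')" "valid (layer i (- a # z'))"
        using valid_layers[OF z(1)] valid_layers[OF cancel(2)] valid_layers[OF val] by blast+
      have t: "teq (layer i z) (layer i (- a # z'))" by (rule layers_teq[OF cancel(1)])
      have g1: "geq (- a # layer i z') (layer i z @ y)"
      proof -
        have "teq (- a # layer i z') (layer i z @ y)"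
          by (rule teq_trans[OF y(2)]) (intro teq_append teq_sym[OF t] teq_refl)
        then show ?thesis using teq_geq[of "- a # layer i z'"] vl a by simp
      qed
      have "geq (layer i z') ([a] @ (layer i z @ y))"
        using geq_move_left[of "[a]" "layer i z'" "layer i z @ y"] g1 vl a y by simp
      then have "geq (layer i z' @ inv_word y) ((a # layer i z @ y) @ inv_word y)"
        by (intro geq_append) auto
      also have "geq ((a # layer i z @ y) @ inv_word y) (a # layer i z)"
        using geq_append[OF geq_refl geq_cancel_right[OF y(1)], of "a # layer i z"] by simp
      finally show ?thesis using y by (intro exI[of _ "inv_word y"]) (auto intro: geq_sym)
    qed
    then show ?thesis using cancel g step[of _ z'] geq_trans[OF g cancel(4)] by blast
  next
    case cons
    have val: "valid (a # z)" using a z by simp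
    have "\<exists>y'. valid y' \<and> length y' \<le> n \<and> geq (a # layer i z) (layer i (a # z) @ y')" for i
    proof -
      obtain y where y: "valid y" "teq (a # layer i z) (layer i (a # z) @ y)" "length y \<le> n"
        using layer_Cons[OF val] by blast
      then show ?thesis using teq_geq[OF y(2)] a valid_layers[OF z(1)] by auto
    qed
    then show ?thesis using cons g val step[of _ "a # z"] by blast
  qed
qed

text \<open>A last letter either enters a given prefix or does not, so it costs one letter per
  prefix and not \<open>n\<close>.\<close>

lemma right_fellow:
  assumes "valid v" "valid w" "red w"
  shows "\<exists>z. valid z \<and> red z \<and> geq (w @ v) z \<and>
    (\<forall>i. \<exists>y. valid y \<and> length y \<le> length v \<and> geq (layer i w) (layer i z @ y))"
  using assms
proof (induction v rule: rev_induct)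
  case Nil
  then show ?case by (intro exI[of _ w]) (auto intro!: exI[of _ "[]"])
next
  case (snoc a v)
  then obtain z where z: "valid z" "red z" "geq (w @ v) z"
    and zi: "\<And>i. \<exists>y. valid y \<and> length y \<le> length v \<and> geq (layer i w) (layer i z @ y)" by auto
  have a: "valid_letter n a" using snoc by simp
  have g: "geq (w @ v @ [a]) (z @ [a])" using geq_append[OF z(3) geq_refl, of "[a]"] by simp
  have step: "\<exists>y. valid y \<and> length y \<le> length (v @ [a]) \<and> geq (layer i w) (layer i z' @ y)"
    if z': "\<exists>y'. valid y' \<and> length y' \<le> 1 \<and> geq (layer i z) (layer i z' @ y')" for i z'
  proof -
    obtain y where y: "valid y" "length y \<le> length v" "geq (layer i w) (layer i z @ y)"
      using zi by blast
    obtain y' where y': "valid y'" "length y' \<le> 1" "geq (layer i z) (layer i z' @ y')"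
      using z' by blast
    have "geq (layer i z @ y) ((layer i z' @ y') @ y)"
      using geq_append[OF y'(3) geq_refl, of y] by simp
    from geq_trans[OF y(3) this] show ?thesis using y y' by (intro exI[of _ "y' @ y"]) auto
  qed
  from z(1,2) a show ?case
  proof (cases rule: rmul_cases)
    case (cancel z')
    have "\<exists>y'. valid y' \<and> length y' \<le> 1 \<and> geq (layer i z) (layer i z' @ y')" for i
    proof -
      have "teq (layer i z) (layer i (z' @ [- a]))" by (rule layers_teq[OF cancel(1)])
      then have g1: "geq (layer i z) (layer i (z' @ [- a]))" using valid_layers[OF z(1)] by (rule teq_geq)
      from layer_snoc[of i z' "- a"] show ?thesis
      proof
        assume "layer i (z' @ [- a]) = layer i z'"
        then show ?thesis using g1 by (intro exI[of _ "[]"]) auto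
      next
        assume "layer i (z' @ [- a]) = layer i z' @ [- a]"
        then show ?thesis using g1 a by (intro exI[of _ "[- a]"]) auto
      qed
    qed
    then show ?thesis using cancel step[of _ z'] geq_trans[OF g cancel(4)] by blast
  next
    case append
    have val: "valid (z @ [a])" using a z by simp
    have "\<exists>y'. valid y' \<and> length y' \<le> 1 \<and> geq (layer i z) (layer i (z @ [a]) @ y')" for i
      using layer_snoc[of i z a]
    proof
      assume "layer i (z @ [a]) = layer i z"
      then show ?thesis by (intro exI[of _ "[]"]) auto
    next
      assume l: "layer i (z @ [a]) = layer i z @ [a]"
      have "geq ((layer i z @ [a]) @ [- a]) (layer i z)"
        using geq_append[OF geq_refl geq_cancel_right[of "[a]"], of "layer i z"] a by simp
      then show ?thesis using l a by (intro exI[of _ "[- a]"]) (auto intro: geq_sym)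
    qed
    then show ?thesis using append g val step[of _ "z @ [a]"] by blast
  qed
qed

text \<open>The products \<open>u w\<close> and \<open>F(w) v\<close> reduce to the same trace
  \<open>z\<close>. Its \<open>i\<close>-th prefix is close to \<open>u\<close> times the
  \<open>i\<close>-th prefix of \<open>w\<close>, and also close to the image of that prefix under
  \<open>F\<close>; the two correction words make up \<open>x\<close>.\<close>

lemma tw_prefixes_short:
  assumes uvw: "valid u" "valid v" "valid w" "red w" and eq: "geq v (inv_word (map F w) @ u @ w)"
  shows "\<exists>x. valid x \<and> length x \<le> n * length u + length v \<and>
    geq x (inv_word (map F (layer i w)) @ u @ layer i w)"
proof -
  obtain z where z: "valid z" "red z" "geq (u @ w) z"
    and zi: "\<exists>y. valid y \<and> length y \<le> n * length u \<and> geq (u @ layer i w) (layer i z @ y)"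
    using left_fellow[OF uvw(1,3,4)] by blast
  obtain z' where z': "valid z'" "red z'" "geq (map F w @ v) z'"
    and zi': "\<exists>y. valid y \<and> length y \<le> length v \<and> geq (layer i (map F w)) (layer i z' @ y)"
    using right_fellow[OF uvw(2), of "map F w"] red_map_F[OF uvw(3,4)] uvw(3) by auto
  have "geq (map F w @ v) (u @ w)"
    using geq_move_left[of "inv_word (map F w)" v "u @ w"] uvw eq by simp
  then have "geq z z'" using z(3) z'(3) by (meson geq_sym geq_trans)
  then have "teq z z'" using red_geq_iff[OF z(1) z'(1) z(2) z'(2)] by simp
  then have t: "geq (layer i z') (layer i z)"
    using teq_geq[OF layers_teq[OF teq_sym] valid_layers[OF z'(1)]] by blast
  obtain y where y: "valid y" "length y \<le> n * length u" "geq (u @ layer i w) (layer i z @ y)"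
    using zi by blast
  obtain y' where y': "valid y'" "length y' \<le> length v" "geq (layer i (map F w)) (layer i z' @ y')"
    using zi' by blast
  have "layer i (map F w) = map F (layer i w)" by (rule layers_map_F[OF uvw(3)]) simp
  then have g1: "geq (map F (layer i w)) (layer i z @ y')"
    using geq_trans[OF y'(3) geq_append[OF t geq_refl, of y']] by simp
  have vz: "valid (layer i z)" using valid_layers z by blast
  have "geq (inv_word (map F (layer i w)) @ u @ layer i w) (inv_word (layer i z @ y') @ layer i z @ y)"
    by (rule geq_append[OF geq_inv[OF g1] y(3)])
  also have "geq (inv_word (layer i z @ y') @ layer i z @ y) (inv_word y' @ y)"
    using geq_cong[OF geq_cancel_left[OF vz], of "inv_word y'" y] by simp
  finally show ?thesis using y y' by (intro exI[of _ "inv_word y' @ y"]) (auto intro: geq_sym)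
qed

text \<open>Counts words over all integers from \<open>- n\<close> to \<open>n\<close>, the
  non-letter 0 included; the sum over the lengths is absorbed by the base
  \<open>2 * n + 2\<close>.\<close>

lemma card_words_le: "finite {w. valid w \<and> length w \<le> R} \<and> card {w. valid w \<and> length w \<le> R} \<le> (2 * n + 2) ^ R"
proof -
  let ?A = "{- int n..int n}"
  have sub: "{w. valid w \<and> length w \<le> R} \<subseteq> {w. set w \<subseteq> ?A \<and> length w \<le> R}"
  proof -
    have "a \<in> ?A" if "valid_letter n a" for a
      using that unfolding valid_letter_def atLeastAtMost_iff by linarith
    then show ?thesis by (auto simp: valid_word_def)
  qed
  have fin: "finite {w. set w \<subseteq> ?A \<and> length w \<le> R}" by (rule finite_lists_length_le) simp
  have "(\<Sum>i\<le>R. (2 * n + 1) ^ i) \<le> (2 * n + 2) ^ R"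
  proof (induction R)
    case (Suc R)
    have "(2 * n + 1) ^ R \<le> (2 * n + 2) ^ R" by (intro power_mono) auto
    then have "(2 * n + 1) * (2 * n + 1) ^ R \<le> (2 * n + 1) * (2 * n + 2) ^ R" by (rule mult_le_mono2)
    then show ?case using Suc by simp
  qed simp
  moreover have "card {w. set w \<subseteq> ?A \<and> length w \<le> R} = (\<Sum>i\<le>R. (2 * n + 1) ^ i)"
    by (subst card_lists_length_le) (auto simp: nat_add_distrib nat_mult_distrib)
  ultimately show ?thesis using card_mono[OF fin sub] finite_subset[OF sub fin] by simp
qed

text \<open>The power bounds the number of short words. A shortest path between two of them has at
  most as many edges as there are pairs of them, whence the product, and an edge is a conjugation by
  at most \<open>n\<close> letters.\<close>

definition word_bound :: "nat \<Rightarrow> nat" where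
  "word_bound L = n * ((2 * n + 2) ^ (n * L) * (2 * n + 2) ^ (n * L))"

theorem tw_bounded:
  assumes uv: "valid u" "valid v" and tw: "tw u v" and L: "length u + length v \<le> L"
  shows "\<exists>w. valid w \<and> length w \<le> word_bound L \<and> geq v (inv_word (map F w) @ u @ w)"
proof -
  obtain w0 where w0: "valid w0" "geq v (inv_word (map F w0) @ u @ w0)" using tw unfolding tw_def by blast
  obtain w where w: "valid w" "red w" "geq w0 w" using red_exists[OF w0(1)] by blast
  have eq: "geq v (inv_word (map F w) @ u @ w)"
    by (rule geq_trans[OF w0(2)]) (intro geq_append geq_inv geq_map_F w geq_refl)
  define R where "R = n * length u + length v"
  define S where "S = {w. valid w \<and> length w \<le> R}"
  define T where "T = {(x, y). x \<in> S \<and> y \<in> S \<and>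
    (\<exists>z. valid z \<and> length z \<le> n \<and> geq y (inv_word (map F z) @ x @ z))}"
  have S: "finite S" "card S \<le> (2 * n + 2) ^ R" using card_words_le[of R] by (auto simp: S_def)
  have TS: "T \<subseteq> S \<times> S" by (auto simp: T_def)
  then have finT: "finite T" using S finite_subset by blast
  have "card T \<le> card (S \<times> S)" using S TS by (intro card_mono) auto
  also have "\<dots> \<le> (2 * n + 2) ^ R * (2 * n + 2) ^ R" using S by (simp add: card_cartesian_product mult_le_mono)
  finally have cT: "card T \<le> (2 * n + 2) ^ R * (2 * n + 2) ^ R" .
  obtain X where X: "\<And>i. valid (X i)" "\<And>i. length (X i) \<le> R"
    "\<And>i. geq (X i) (inv_word (map F (layer i w)) @ u @ layer i w)"
    using tw_prefixes_short[OF uv w(1,2) eq] unfolding R_def by metis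
  have X0: "geq (X 0) u" using X(3)[of 0] by simp
  have "layer (length w) w = w" by (rule layers_all) simp
  then have Xw: "geq (X (length w)) v" using X(3)[of "length w"] eq geq_sym geq_trans by metis
  have step: "(X i, X (Suc i)) \<in> T" for i
  proof -
    obtain y where y: "valid y" "teq (layer (Suc i) w) (layer i w @ y)" "length y \<le> n"
      using layer_Suc[OF w(1)] by blast
    have g: "geq (layer (Suc i) w) (layer i w @ y)" using teq_geq y(2) valid_layers w(1) by blast
    have "geq (X (Suc i)) (inv_word (map F (layer i w @ y)) @ u @ layer i w @ y)"
      by (rule geq_trans[OF X(3)]) (intro geq_append geq_inv geq_map_F g geq_refl)
    also have "inv_word (map F (layer i w @ y)) @ u @ layer i w @ y =
      inv_word (map F y) @ (inv_word (map F (layer i w)) @ u @ layer i w) @ y" by simp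
    also have "geq \<dots> (inv_word (map F y) @ X i @ y)" by (rule geq_cong) (rule geq_sym[OF X(3)])
    finally show ?thesis using y X by (auto simp: T_def S_def)
  qed
  have "(X 0, X k) \<in> T\<^sup>*" for k by (induction k) (use step in \<open>auto intro: rtrancl_into_rtrancl\<close>)
  \<comment> \<open>The pigeonhole step: the walk along the greedy prefixes is replaced by one with
    at most \<open>card T\<close> edges, whose labels spell the short conjugator.\<close>
  then obtain m where m: "m \<le> card T" "(X 0, X (length w)) \<in> T ^^ m"
    using rtrancl_finite_eq_relpow[OF finT] by auto
  have path: "\<exists>z. valid z \<and> length z \<le> n * m \<and> geq y (inv_word (map F z) @ x @ z)"
    if "(x, y) \<in> T ^^ m" for x y m
    using that
  proof (induction m arbitrary: y)
    case 0
    then show ?case by (intro exI[of _ "[]"]) auto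
  next
    case (Suc m)
    then obtain y' where y': "(x, y') \<in> T ^^ m" "(y', y) \<in> T" by auto
    obtain z where z: "valid z" "length z \<le> n * m" "geq y' (inv_word (map F z) @ x @ z)"
      using Suc.IH[OF y'(1)] by blast
    obtain z' where z': "valid z'" "length z' \<le> n" "geq y (inv_word (map F z') @ y' @ z')"
      using y'(2) by (auto simp: T_def)
    have "geq y (inv_word (map F z') @ (inv_word (map F z) @ x @ z) @ z')"
      by (rule geq_trans[OF z'(3)]) (rule geq_cong[OF z(3)])
    then show ?case using z z' by (intro exI[of _ "z @ z'"]) auto
  qed
  obtain z where z: "valid z" "length z \<le> n * m" "geq (X (length w)) (inv_word (map F z) @ X 0 @ z)"
    using path[OF m(2)] by blast
  have "geq v (inv_word (map F z) @ u @ z)"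
    by (rule geq_trans[OF geq_sym[OF Xw] geq_trans[OF z(3)]]) (rule geq_cong[OF X0])
  moreover have "length z \<le> word_bound L"
  proof (cases "n = 0")
    case False
    have "R \<le> n * (length u + length v)" using False by (auto simp: R_def distrib_left)
    also have "\<dots> \<le> n * L" using L by simp
    finally have RL: "(2 * n + 2) ^ R \<le> (2 * n + 2) ^ (n * L)" by (intro power_increasing) auto
    have "length z \<le> n * card T" using z(2) m(1) mult_le_mono2 le_trans by blast
    also have "\<dots> \<le> n * ((2 * n + 2) ^ R * (2 * n + 2) ^ R)" using cT by (rule mult_le_mono2)
    also have "\<dots> \<le> word_bound L" unfolding word_bound_def
      by (intro mult_le_mono2 mult_le_mono RL)
    finally show ?thesis .
  qed (use z in \<open>simp add: word_bound_def\<close>)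
  ultimately show ?thesis using z by blast
qed

end

subsection \<open>Peak reduction for compositions of inversions\<close>

text \<open>Let \<open>k\<close> bound the sizes on a path. If an end has size \<open>k\<close>, its
  minimality spreads along the path, which therefore stays on level \<open>k\<close>. Otherwise both
  ends are below \<open>k\<close>, every visit to level \<open>k\<close> can be bypassed through
  smaller elements, and induction on \<open>k\<close> applies.\<close>

lemma peak_reduction:
  fixes e :: "'a \<Rightarrow> 'a \<Rightarrow> bool" and sz :: "'a \<Rightarrow> nat"
  assumes sym: "\<And>x y. e x y \<Longrightarrow> e y x"
    and peak: "\<And>x y z. e x y \<Longrightarrow> e x z \<Longrightarrow> sz y < sz x \<Longrightarrow> sz z \<le> sz x \<Longrightarrow>
      \<exists>r. e y r \<and> e z r \<and> sz r < sz x"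
    and path: "e\<^sup>*\<^sup>* p q"
    and min: "\<And>r. e p r \<Longrightarrow> sz p \<le> sz r" "\<And>r. e q r \<Longrightarrow> sz q \<le> sz r"
  shows "(\<lambda>x y. e x y \<and> sz x = sz y)\<^sup>*\<^sup>* p q"
proof -
  define c where "c k = (\<lambda>x y. e x y \<and> sz x \<le> k \<and> sz y \<le> k)" for k
  let ?pl = "\<lambda>x y. e x y \<and> sz x = sz y"
  have c_mono: "(c k)\<^sup>*\<^sup>* x y \<Longrightarrow> k \<le> l \<Longrightarrow> (c l)\<^sup>*\<^sup>* x y" for k l x y
    by (erule rtranclp_mono[THEN predicate2D, rotated]) (auto simp: c_def)
  have c_sym: "(c k)\<^sup>*\<^sup>* x y \<Longrightarrow> (c k)\<^sup>*\<^sup>* y x" for k x y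
    by (induction rule: rtranclp_induct)
      (auto simp: c_def intro: sym converse_rtranclp_into_rtranclp)
  have top: "?pl\<^sup>*\<^sup>* p q" if "(c k)\<^sup>*\<^sup>* p q" "sz p = k" "\<And>r. e p r \<Longrightarrow> sz p \<le> sz r" for p q k
  proof -
    have "?pl\<^sup>*\<^sup>* p q \<and> sz q = k \<and> (\<forall>r. e q r \<longrightarrow> k \<le> sz r)"
      using that(1)
    proof (induction rule: rtranclp_induct)
      case base
      then show ?case using that by auto
    next
      case (step x y)
      then have xy: "e x y" "sz x = k" "sz y = k" by (auto simp: c_def intro: le_antisym)
      \<comment> \<open>A descent from \<open>y\<close> would be passed on by the peak condition at
        \<open>y\<close> to its predecessor \<open>x\<close>, which has none.\<close>
      have "k \<le> sz r" if r: "e y r" for r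
      proof (rule ccontr)
        assume "\<not> k \<le> sz r"
        then obtain s where "e x s" "sz s < k" using peak[OF r sym[OF xy(1)]] xy by auto
        then show False using step by (meson leD)
      qed
      then show ?case using step xy by (auto intro: rtranclp.rtrancl_into_rtrancl)
    qed
    then show ?thesis by blast
  qed
  have main: "(c k)\<^sup>*\<^sup>* p q \<Longrightarrow> sz p \<le> k \<Longrightarrow> sz q \<le> k \<Longrightarrow> ?pl\<^sup>*\<^sup>* p q"
    if "\<And>r. e p r \<Longrightarrow> sz p \<le> sz r" "\<And>r. e q r \<Longrightarrow> sz q \<le> sz r" for k
  proof (induction k rule: less_induct)
    case (less k)
    consider "sz p = k" | "sz q = k" | "sz p < k" "sz q < k" using less.prems by linarith
    then show ?case
    proof cases
      case 1
      then show ?thesis using top[OF less.prems(1)] that by blast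
    next
      case 2
      have "?pl\<^sup>*\<^sup>* q p" using top[OF c_sym[OF less.prems(1)] 2] that by blast
      then show ?thesis
        by (induction rule: rtranclp_induct) (auto intro: sym converse_rtranclp_into_rtranclp)
    next
      case 3
      define j where "j = k - 1"
      have j: "j < k" "\<And>x. sz x < k \<Longrightarrow> sz x \<le> j" using 3 by (auto simp: j_def)
      \<comment> \<open>An element of level \<open>k\<close> is not itself reachable below
        \<open>k\<close>, so at that level the invariant speaks of its descents: there is one, and
        all of them are reachable.\<close>
      have "(sz q < k \<longrightarrow> (c j)\<^sup>*\<^sup>* p q) \<and>
        (sz q = k \<longrightarrow> (\<exists>y. e q y \<and> sz y < k) \<and> (\<forall>y. e q y \<longrightarrow> sz y < k \<longrightarrow> (c j)\<^sup>*\<^sup>* p y))"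
        using less.prems(1)
      proof (induction rule: rtranclp_induct)
        case base
        then show ?case using 3 by auto
      next
        case (step x y)
        then have xy: "e x y" "sz x \<le> k" "sz y \<le> k" by (auto simp: c_def)
        have link: "(c j)\<^sup>*\<^sup>* p s" if y: "(c j)\<^sup>*\<^sup>* p r" "e r t" "e s t" "sz r < k" "sz s < k" "sz t < k" for r s t
        proof -
          have "c j r t" "c j t s" using y j(2) sym by (auto simp: c_def)
          then show ?thesis using y(1) by (meson rtranclp.rtrancl_into_rtrancl)
        qed
        consider "sz x < k" "sz y < k" | "sz x < k" "sz y = k" | "sz x = k" "sz y < k" | "sz x = k" "sz y = k"
          using xy by linarith
        then show ?case
        proof cases
          case 1
          then have "c j x y" using xy j by (auto simp: c_def)
          then show ?thesis using step 1 by (auto intro: rtranclp.rtrancl_into_rtrancl)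
        next
          case 2
          have px: "(c j)\<^sup>*\<^sup>* p x" using step 2 by auto
          have "(c j)\<^sup>*\<^sup>* p z" if z: "e y z" "sz z < k" for z
          proof -
            obtain r where "e x r" "e z r" "sz r < k"
              using peak[OF sym[OF xy(1)] z(1)] 2 z by auto
            then show ?thesis using link[OF px] 2 z by blast
          qed
          then show ?thesis using 2 xy sym by auto
        next
          case 3
          then show ?thesis using step xy by auto
        next
          case 4
          then obtain z where z: "e x z" "sz z < k" "(c j)\<^sup>*\<^sup>* p z" using step by auto
          obtain r where r: "e z r" "e y r" "sz r < k" using peak[OF z(1) xy(1)] 4 z by auto
          have pr: "(c j)\<^sup>*\<^sup>* p r"
            using z r j by (auto simp: c_def intro!: rtranclp.rtrancl_into_rtrancl[of _ p z r])
          have "(c j)\<^sup>*\<^sup>* p s" if s: "e y s" "sz s < k" for s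
          proof -
            obtain t where t: "e r t" "e s t" "sz t < k" using peak[OF r(2) s(1)] 4 r s by auto
            show ?thesis using link[OF pr t(1,2) r(3) s(2) t(3)] .
          qed
          then show ?thesis using 4 r by auto
        qed
      qed
      then have "(c j)\<^sup>*\<^sup>* p q" using 3 by auto
      then show ?thesis using less.IH[OF j(1)] 3 j(2) by auto
    qed
  qed
  have "\<exists>k. (c k)\<^sup>*\<^sup>* p q \<and> sz p \<le> k \<and> sz q \<le> k" using path
  proof (induction rule: rtranclp_induct)
    case (step x y)
    then obtain k where k: "(c k)\<^sup>*\<^sup>* p x" "sz p \<le> k" "sz x \<le> k" by blast
    let ?l = "max k (sz y)"
    have "(c ?l)\<^sup>*\<^sup>* p x" "c ?l x y" using c_mono[OF k(1), of ?l] step k by (auto simp: c_def)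
    then show ?case using k by (intro exI[of _ ?l]) (auto intro: rtranclp.rtrancl_into_rtrancl)
  qed auto
  then show ?thesis using main[OF min] by blast
qed

section \<open>Twisted conjugation of reduced words by single letters\<close>

locale inversion_twist = twist +
  assumes F_pm: "F a = a \<or> F a = - a"
begin

lemma vtx_F [simp]: "vtx (F a) = vtx a"
  using F_pm[of a] by auto

lemma F_F [simp]: "F (F a) = a"
  using F_pm[of a] by auto

lemma F_comp_F [simp]: "F \<circ> F = id"
  by auto

lemma teq_Cons_cancel:
  assumes "teq (a # u) (a # v)" "valid u" "valid v"
  shows "teq u v"
proof (rule pile_inj)
  have "pile (a # u) x = pile (a # v) x" for x using teq_pile[OF assms(1)] by simp
  then show "pile u = pile v" by (simp add: fun_eq_iff pile_Cons)
qed (use assms in auto)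

text \<open>The new letters \<open>- F a\<close> and \<open>a\<close> may each cancel at their end
  of \<open>p\<close>. Two cancellations shorten \<open>p\<close> by two letters, one amounts to a
  rotation, none lengthens \<open>p\<close> by two. In the case \<open>fixed\<close> the new letters
  cancel each other across a word commuting with \<open>a\<close>.\<close>

lemma conj_cases:
  assumes p: "valid p" "red p" and a: "valid_letter n a"
    and q: "valid q" "red q" "geq q (- F a # p @ [a])"
  obtains (dec) x where "teq p (F a # x @ [- a])" "teq q x"
  | (right) y where "teq p (y @ [- a])" "teq q (- F a # y)"
  | (left) y where "teq p (F a # y)" "teq q (y @ [a])"
  | (fixed) "teq q p"
  | (inc) "teq q (- F a # p @ [a])"
proof -
  have Fa: "valid_letter n (- F a)" using a by simp
  have qeq: "teq q s" if "geq (- F a # p @ [a]) s" "valid s" "red s" for s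
    using red_geq_iff[OF q(1) that(2) q(2) that(3)] geq_trans[OF q(3) that(1)] by blast
  from p a show ?thesis
  proof (cases rule: rmul_cases)
    case (cancel y)
    have g: "geq (- F a # p @ [a]) (- F a # y)" using cancel(4) by (rule geq_Cons)
    from cancel(2,3) Fa show ?thesis
    proof (cases rule: lmul_cases)
      case (cancel x)
      have "teq p (F a # x @ [- a])"
        using teq_trans[OF \<open>teq p (y @ [- a])\<close> teq_append[OF cancel(1) teq_refl, of "[- a]"]] by simp
      then show ?thesis using dec[of x] qeq[of x] geq_trans[OF g cancel(4)] cancel by blast
    next
      case cons
      then show ?thesis using right[OF cancel(1)] qeq[OF g] cancel Fa by simp
    qed
  next
    case append
    have v: "valid (p @ [a])" using p a by simp
    from v append(1) Fa show ?thesis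
    proof (cases rule: lmul_cases)
      case (cancel x)
      have qx: "teq q x" using qeq[of x] cancel by simp
      have t: "teq (p @ [a]) (F a # x)" using cancel by simp
      have hdp: "hd (pile (p @ [a]) (vtx a)) = digit (F a)"
        using fun_cong[OF teq_pile[OF t], of "vtx a"] by (simp add: pile_Cons)
      show ?thesis
      proof (cases "pile p (vtx a) = []")
        \<comment> \<open>Here \<open>- F a\<close> finds no letter of its vertex in
          \<open>p\<close>, so it cancels against the appended \<open>a\<close>; this forces
          \<open>F a = a\<close> and makes all of \<open>p\<close> commute with
          \<open>a\<close>.\<close>
        case True
        then have "digit a = digit (F a)" using hdp by (simp add: pile_single)
        then have Fa: "F a = a" using a valid_letter_nonzero[of n a] valid_letter_nonzero[of n "F a"]
          by (intro letter_eqI[of "F a" a]) auto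
        have "E (vtx b) (vtx a)" if "b \<in> set p" for b
          using True that by (auto simp: pile_def filter_empty_conv)
        then have "teq (a # p) (p @ [a])" using E_sym by (intro teq_move) auto
        then have "teq (a # p) (a # x)" using t Fa teq_trans by simp
        then have "teq p x" by (rule teq_Cons_cancel) (use p cancel in auto)
        from fixed[OF teq_trans[OF qx teq_sym[OF this]]] show ?thesis .
      next
        case False
        then have h: "hd (pile p (vtx a)) = digit (F a)" using hdp by simp
        then obtain y b where y: "teq p (b # y)" "vtx b = vtx a" "digit b = digit (F a)"
          using pile_hd[of p "vtx a"] False by auto
        have vy: "valid (b # y)" using teq_valid[OF y(1)] p by simp
        then have "b = F a" using y(2,3) a valid_letter_nonzero[of n b] valid_letter_nonzero[of n "F a"]
          by (intro letter_eqI[of b "F a"]) auto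
        with y have py: "teq p (F a # y)" by simp
        have "teq (F a # x) (F a # y @ [a])"
          using teq_trans[OF teq_sym[OF t] teq_append[OF py teq_refl, of "[a]"]] by simp
        then have "teq x (y @ [a])" by (rule teq_Cons_cancel) (use cancel vy a in auto)
        from left[OF py teq_trans[OF qx this]] show ?thesis .
      qed
    next
      case cons
      then show ?thesis using inc qeq[of "- F a # p @ [a]"] p a by simp
    qed
  qed
qed

definition edge :: "int list \<Rightarrow> int list \<Rightarrow> bool" where
  "edge p q \<longleftrightarrow> valid p \<and> red p \<and> valid q \<and> red q \<and>
    (geq q p \<or> (\<exists>a. valid_letter n a \<and> geq q (- F a # p @ [a])))"

lemma conj_flip:
  assumes "valid p" "valid q" "valid_letter n a" "geq q (- F a # p @ [a])"
  shows "geq p (- F (- a) # q @ [- a])"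
proof -
  have "geq (F a # q @ [- a]) ([F a] @ (- F a # p @ [a]) @ [- a])"
    using geq_cong[OF assms(4), of "[F a]" "[- a]"] by simp
  also have "[F a] @ (- F a # p @ [a]) @ [- a] = [F a, - F a] @ p @ [a, - a]" by simp
  also have "geq \<dots> ([] @ p @ [])"
    using geq_cancel_right[of "[F a]"] geq_cancel_right[of "[a]"] assms
    by (intro geq_append) auto
  finally show ?thesis by (auto intro: geq_sym)
qed

lemma edge_sym: "edge p q \<Longrightarrow> edge q p"
  unfolding edge_def using conj_flip geq_sym by (metis valid_letter_minus)

lemma edge_refl: "valid p \<Longrightarrow> red p \<Longrightarrow> edge p p"
  by (simp add: edge_def)

lemma conj_geq: "geq p q \<Longrightarrow> geq (- F a # p @ [a]) (- F a # q @ [a])"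
  using geq_cong[of p q "[- F a]" "[a]"] by simp

lemma conj_commute:
  assumes "valid_letter n a" "valid_letter n b" "E (vtx a) (vtx b)"
  shows "geq (- F a # (- F b # p @ [b]) @ [a]) (- F b # (- F a # p @ [a]) @ [b])"
proof -
  have "geq [- F a, - F b] [- F b, - F a]" "geq [b, a] [a, b]"
    using geq_step[OF raag_step.commute[of n "- F a" "- F b" E "[]" "[]"]]
      geq_step[OF raag_step.commute[of n b a E "[]" "[]"]] assms E_sym by auto
  then have "geq ([- F a, - F b] @ p @ [b, a]) ([- F b, - F a] @ p @ [a, b])"
    by (intro geq_append) auto
  then show ?thesis by simp
qed

text \<open>Two letters which can both be conjugated away commute, because the two ends of the heap
  they occupy are distinct; so the conjugations commute as well.\<close>

lemma edge_peak:
  assumes e1: "edge p q1" and e2: "edge p q2" and l1: "length q1 < length p" and l2: "length q2 \<le> length p"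
  shows "\<exists>r. edge q1 r \<and> edge q2 r \<and> length r < length p"
proof -
  have v: "valid p" "red p" "valid q1" "red q1" "valid q2" "red q2" using e1 e2 by (auto simp: edge_def)
  have "\<not> geq q1 p" using red_geq_iff v teq_length l1 by fastforce
  then obtain a where a: "valid_letter n a" and g1: "geq q1 (- F a # p @ [a])" using e1 by (auto simp: edge_def)
  have a0: "a \<noteq> 0" using a valid_letter_nonzero by blast
  have "\<exists>x. teq p (F a # x @ [- a]) \<and> teq q1 x"
    using v(1,2) a v(3,4) g1
  proof (cases rule: conj_cases)
    case (right y)
    then show ?thesis using l1 teq_length[of p] teq_length[of q1] by fastforce
  next
    case (left y)
    then show ?thesis using l1 teq_length[of p] teq_length[of q1] by fastforce
  next
    case fixed
    then show ?thesis using l1 teq_length by fastforce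
  next
    case inc
    then show ?thesis using l1 teq_length by fastforce
  qed blast
  then obtain x where x: "teq p (F a # x @ [- a])" "teq q1 x" by blast
  have lx: "length p = length x + 2" "length q1 = length x" using teq_length[OF x(1)] teq_length[OF x(2)] by auto
  have vx: "valid x" using teq_valid[OF x(2)] v by simp
  have q1x: "geq q1 x" using teq_geq[OF x(2) v(3)] .
  show ?thesis
  proof (cases "geq q2 p")
    case True
    have "edge q2 q1"
      unfolding edge_def using v a geq_trans[OF g1 conj_geq[OF geq_sym[OF True], of a]] by blast
    then show ?thesis using edge_refl[OF v(3,4)] l1 by blast
  next
    case False
    then obtain b where b: "valid_letter n b" and g2: "geq q2 (- F b # p @ [b])" using e2 by (auto simp: edge_def)
    have b0: "b \<noteq> 0" using b valid_letter_nonzero by blast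
    have same: ?thesis if "a = b"
    proof -
      have "geq q1 q2" using that geq_trans[OF g1 geq_sym[OF g2[folded that]]] by simp
      then have "edge q2 q1" using v by (simp add: edge_def)
      then show ?thesis using edge_refl[OF v(3,4)] l1 by blast
    qed
    \<comment> \<open>The common lower neighbour: conjugating \<open>q1\<close> by \<open>b\<close>
      and conjugating \<open>q2\<close> by \<open>a\<close> give the same element.\<close>
    have diamond: ?thesis if ab: "E (vtx a) (vtx b)" and s: "geq (- F b # q1 @ [b]) s" "valid s" "length s < length p" for s
    proof -
      obtain r where r: "valid r" "red r" "geq s r" "length r \<le> length s" using red_exists[OF s(2)] by blast
      have g: "geq r (- F b # q1 @ [b])" using geq_sym[OF geq_trans[OF s(1) r(3)]] .
      have "geq (- F b # q1 @ [b]) (- F b # (- F a # p @ [a]) @ [b])" by (rule conj_geq[OF g1])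
      also have "geq \<dots> (- F a # (- F b # p @ [b]) @ [a])" by (rule geq_sym[OF conj_commute[OF a b ab]])
      also have "geq \<dots> (- F a # q2 @ [a])" by (rule conj_geq[OF geq_sym[OF g2]])
      finally have "geq r (- F a # q2 @ [a])" by (rule geq_trans[OF g])
      then have "edge q1 r" "edge q2 r" using g r v a b by (auto simp: edge_def)
      then show ?thesis using r s by auto
    qed
    have pp: "pile p z = pile (F a # x @ [- a]) z" for z using teq_pile[OF x(1)] by simp
    have right: ?thesis if y: "teq p (y @ [- b])" for y
    proof -
      have lst: "last (pile p (vtx b)) = digit (- b)" "pile p (vtx b) \<noteq> []"
        using teq_pile[OF y] by (auto simp: pile_single)
      show ?thesis
      proof (cases "vtx a = vtx b")
        case True
        then have "digit (- a) = digit (- b)" using lst pp[of "vtx a"] by (simp add: pile_Cons pile_single)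
        then have "- a = - b" using True a0 b0 by (intro letter_eqI[of "- a" "- b"]) auto
        then show ?thesis using same by simp
      next
        case False
        have ab: "E (vtx a) (vtx b)"
        proof (rule ccontr)
          assume "\<not> ?thesis"
          then have "last (pile p (vtx b)) = 0" using pp[of "vtx b"] False by (simp add: pile_Cons pile_single)
          then show False using lst by simp
        qed
        then have "pile x (vtx b) \<noteq> []" "last (pile x (vtx b)) = digit (- b)"
          using lst pp[of "vtx b"] by (auto simp: pile_Cons)
        then obtain x' c where c: "teq x (x' @ [c])" "vtx c = vtx b" "digit c = digit (- b)"
          using pile_last[of x "vtx b"] by auto
        have vc: "valid x'" "valid_letter n c" using teq_valid[OF c(1)] vx by auto
        then have "c = - b" using c b0 valid_letter_nonzero[of n c] by (intro letter_eqI[of c "- b"]) auto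
        with c have xx: "teq x (x' @ [- b])" by simp
        have "geq (- F b # q1 @ [b]) (- F b # (x' @ [- b]) @ [b])"
          by (rule conj_geq) (rule geq_trans[OF q1x teq_geq[OF xx vx]])
        also have "- F b # (x' @ [- b]) @ [b] = (- F b # x') @ [- b, b]" by simp
        also have "geq \<dots> ((- F b # x') @ [])"
          using geq_cancel_left[of "[b]"] b by (intro geq_append) auto
        finally have "geq (- F b # q1 @ [b]) (- F b # x')" by simp
        then show ?thesis using diamond[OF ab] vc b teq_length[OF xx] lx by auto
      qed
    qed
    have left: ?thesis if y: "teq p (F b # y)" for y
    proof -
      have hdp: "hd (pile p (vtx b)) = digit (F b)" "pile p (vtx b) \<noteq> []"
        using teq_pile[OF y] by (auto simp: pile_Cons)
      show ?thesis
      proof (cases "vtx a = vtx b")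
        case True
        then have "digit (F a) = digit (F b)" using hdp pp[of "vtx a"] by (simp add: pile_Cons)
        then have "F a = F b" using True a b valid_letter_nonzero[of n "F a"] valid_letter_nonzero[of n "F b"]
          by (intro letter_eqI[of "F a" "F b"]) auto
        then have "a = b" using F_F by metis
        then show ?thesis using same by simp
      next
        case False
        have ab: "E (vtx a) (vtx b)"
        proof (rule ccontr)
          assume "\<not> ?thesis"
          then have "hd (pile p (vtx b)) = 0" using pp[of "vtx b"] False by (simp add: pile_Cons)
          then show False using hdp by simp
        qed
        then have "pile x (vtx b) \<noteq> []" "hd (pile x (vtx b)) = digit (F b)"
          using hdp pp[of "vtx b"] by (auto simp: pile_Cons)
        then obtain x' c where c: "teq x (c # x')" "vtx c = vtx b" "digit c = digit (F b)"
          using pile_hd[of x "vtx b"] by auto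
        have vc: "valid x'" "valid_letter n c" using teq_valid[OF c(1)] vx by auto
        then have "c = F b" using c b valid_letter_nonzero[of n c] valid_letter_nonzero[of n "F b"]
          by (intro letter_eqI[of c "F b"]) auto
        with c have xx: "teq x (F b # x')" by simp
        have "geq (- F b # q1 @ [b]) (- F b # (F b # x') @ [b])"
          by (rule conj_geq) (rule geq_trans[OF q1x teq_geq[OF xx vx]])
        also have "- F b # (F b # x') @ [b] = [- F b, F b] @ (x' @ [b])" by simp
        also have "geq \<dots> ([] @ (x' @ [b]))"
          using geq_cancel_left[of "[F b]"] b by (intro geq_append) auto
        finally have "geq (- F b # q1 @ [b]) (x' @ [b])" by simp
        then show ?thesis using diamond[OF ab] vc b teq_length[OF xx] lx by auto
      qed
    qed
    show ?thesis
      using v(1,2) b v(5,6) g2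
    proof (cases rule: conj_cases)
      case (dec y)
      then show ?thesis using right[of "F b # y"] by simp
    next
      case fixed
      then show ?thesis using False teq_geq v by blast
    next
      case inc
      then show ?thesis using l2 teq_length by fastforce
    qed (use left right in blast)+
  qed
qed

lemma edge_path:
  assumes "valid w" "valid p" "red p" "valid q" "red q" "geq q (inv_word (map F w) @ p @ w)"
  shows "edge\<^sup>*\<^sup>* p q"
  using assms
proof (induction w arbitrary: p)
  case Nil
  then show ?case by (auto simp: edge_def)
next
  case (Cons a w)
  have v: "valid (- F a # p @ [a])" using Cons by simp
  obtain r where r: "valid r" "red r" "geq (- F a # p @ [a]) r" using red_exists[OF v] by blast
  have "edge p r" using Cons r geq_sym unfolding edge_def by auto
  moreover have "edge\<^sup>*\<^sup>* r q"
  proof (rule Cons.IH)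
    show "geq q (inv_word (map F w) @ r @ w)"
      by (rule geq_trans[OF Cons.prems(6)])
        (use geq_cong[OF r(3), of "inv_word (map F w)" w] in simp)
  qed (use Cons r in auto)
  ultimately show ?case by (rule converse_rtranclp_into_rtranclp)
qed

text \<open>Twisted cyclically reduced traces. By \<open>irred_edge\<close> they are local minima of
  the length in the graph \<open>edge\<close>, as peak reduction requires of its end points.\<close>

definition irred :: "int list \<Rightarrow> bool" where
  "irred p \<longleftrightarrow> \<not> (\<exists>c x. teq p (c # x @ [- F c]))"

lemma irred_edge:
  assumes "irred p" "edge p q"
  shows "length p \<le> length q"
proof -
  have v: "valid p" "red p" "valid q" "red q" using assms(2) by (auto simp: edge_def)
  show ?thesis
  proof (cases "geq q p")
    case True
    then show ?thesis using red_geq_iff[of q p] v teq_length by fastforce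
  next
    case False
    then obtain a where a: "valid_letter n a" "geq q (- F a # p @ [a])" using assms(2) by (auto simp: edge_def)
    show ?thesis using v(1,2) a(1) v(3,4) a(2)
    proof (cases rule: conj_cases)
      case (dec x)
      then have "teq p (F a # x @ [- F (F a)])" by simp
      then show ?thesis using assms(1) unfolding irred_def by blast
    qed (use teq_length in fastforce)+
  qed
qed

section \<open>Rotations\<close>

inductive rots :: "int list \<Rightarrow> int list \<Rightarrow> bool" where
  rots_teq: "teq u v \<Longrightarrow> rots u v"
| rots_rot: "rots u (a # w) \<Longrightarrow> rots u (w @ [F a])"
| rots_trans_teq: "rots u v \<Longrightarrow> teq v w \<Longrightarrow> rots u w"

lemma rots_refl [simp, intro]: "rots u u"
  by (simp add: rots_teq)

lemma rots_trans [trans]: "rots v w \<Longrightarrow> rots u v \<Longrightarrow> rots u w"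
  by (induction rule: rots.induct) (auto intro: rots.intros)

lemma rots_single: "rots (a # w) (w @ [F a])"
  by (rule rots_rot) simp

lemma rots_block: "rots (u @ v) (v @ map F u)"
proof (induction u arbitrary: v)
  case (Cons a u)
  from rots_trans[OF Cons[of "v @ [F a]"], of "a # u @ v"] rots_single[of a "u @ v"]
  show ?case by simp
qed simp

lemma rots_full: "rots u (map F u)"
  using rots_block[of u "[]"] by simp

text \<open>Rotating every letter once applies \<open>F\<close>, which is an involution, so
  completing two full turns undoes a single rotation. Rotations in one direction are therefore
  enough.\<close>

lemma rots_back: "rots (w @ [F a]) (a # w)"
proof -
  have "rots (w @ [F a]) (F a # map F w)" using rots_block[of w "[F a]"] by simp
  moreover have "rots (F a # map F w) (a # w)" using rots_full[of "F a # map F w"] by simp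
  ultimately show ?thesis using rots_trans by blast
qed

lemma rots_sym: "rots u v \<Longrightarrow> rots v u"
proof (induction rule: rots.induct)
  case (rots_teq u v)
  show ?case by (rule rots.rots_teq[OF teq_sym[OF rots_teq(1)]])
next
  case (rots_rot u a w)
  show ?case by (rule rots_trans[OF rots_rot(2) rots_back])
next
  case (rots_trans_teq u v w)
  show ?case by (rule rots_trans[OF rots_trans_teq(3) rots.rots_teq[OF teq_sym[OF rots_trans_teq(2)]]])
qed

lemma rots_valid: "rots u v \<Longrightarrow> valid v = valid u"
  by (induction rule: rots.induct) (auto dest: teq_valid)

lemma rots_tw: "rots u v \<Longrightarrow> valid u \<Longrightarrow> tw u v"
proof (induction rule: rots.induct)
  case (rots_teq u v)
  then show ?case by (intro tw_geq teq_geq)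
next
  case (rots_rot u a w)
  have v: "valid (a # w)" using rots_valid[OF rots_rot(1)] rots_rot by simp
  have "geq ([- a, a] @ w @ [F a]) ([] @ w @ [F a])"
    using geq_cancel_left[of "[a]"] v by (intro geq_append) auto
  then have "tw (a # w) (w @ [F a])"
    using v by (intro tw_single[of "F a"]) (auto intro: geq_sym)
  from tw_trans[OF rots_rot(2)[OF rots_rot(3)] this] show ?case .
next
  case (rots_trans_teq u v w)
  have "valid v" using rots_valid[OF rots_trans_teq(1)] rots_trans_teq by simp
  from tw_trans[OF rots_trans_teq(3)[OF rots_trans_teq(4)] tw_geq[OF teq_geq[OF rots_trans_teq(2) this]]]
  show ?case .
qed

lemma plateau_rots:
  assumes "edge p q" "length p = length q"
  shows "rots p q"
proof -
  have v: "valid p" "red p" "valid q" "red q" using assms by (auto simp: edge_def)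
  show ?thesis
  proof (cases "geq q p")
    case True
    then have "teq q p" using red_geq_iff[of q p] v by simp
    from rots_teq[OF teq_sym[OF this]] show ?thesis .
  next
    case False
    then obtain a where a: "valid_letter n a" "geq q (- F a # p @ [a])" using assms(1) by (auto simp: edge_def)
    show ?thesis using v(1,2) a(1) v(3,4) a(2)
    proof (cases rule: conj_cases)
      case (dec x)
      then show ?thesis using assms(2) teq_length[of p] teq_length[of q] by fastforce
    next
      case (right y)
      have "rots (- F a # y) (y @ [- a])" using rots_single[of "- F a" y] by simp
      from rots_trans_teq[OF rots_trans[OF rots_sym[OF this] rots_teq[OF right(1)]] teq_sym[OF right(2)]]
      show ?thesis .
    next
      case (left y)
      have "rots (F a # y) (y @ [a])" using rots_single[of "F a" y] by simp
      from rots_trans_teq[OF rots_trans[OF this rots_teq[OF left(1)]] teq_sym[OF left(2)]]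
      show ?thesis .
    next
      case fixed
      from rots_teq[OF teq_sym[OF this]] show ?thesis .
    next
      case inc
      then show ?thesis using assms(2) teq_length[of q] by fastforce
    qed
  qed
qed

text \<open>Peak reduction turns a conjugation between irreducible elements into a chain of edges of
  constant length, and by \<open>plateau_rots\<close> each of them is trivial or a rotation in one
  of the two directions.\<close>

theorem tw_iff_rots:
  assumes v: "valid u" "valid v" "valid p" "red p" "irred p" "valid q" "red q" "irred q"
    and "tw u p" "tw v q"
  shows "tw u v \<longleftrightarrow> rots p q"
proof
  assume "tw u v"
  from tw_trans[OF tw_trans[OF tw_sym[OF assms(9) v(1,3)] this] assms(10)] have "tw p q" .
  then obtain w where "valid w" "geq q (inv_word (map F w) @ p @ w)" unfolding tw_def by blast
  then have "edge\<^sup>*\<^sup>* p q" using edge_path v by blast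
  then have "(\<lambda>x y. edge x y \<and> length x = length y)\<^sup>*\<^sup>* p q"
    using edge_sym edge_peak irred_edge v by (intro peak_reduction) auto
  then show "rots p q"
    by (induction rule: rtranclp_induct) (auto intro: rots_trans plateau_rots)
next
  assume "rots p q"
  then have "tw p q" using rots_tw v by blast
  from tw_trans[OF tw_trans[OF assms(9) this] tw_sym[OF assms(10) v(2,6)]] show "tw u v" .
qed

end

subsection \<open>Cyclic matching of traces\<close>

context inversion_twist
begin

text \<open>Connectedness in the complement graph, in which distinct non-commuting vertices are
  joined.\<close>

definition stack_conn :: "nat set \<Rightarrow> bool" where
  "stack_conn C \<longleftrightarrow> C \<noteq> {} \<and>
    (\<forall>D. D \<subseteq> C \<longrightarrow> D \<noteq> {} \<longrightarrow> (\<forall>x\<in>D. \<forall>y\<in>C - D. E x y) \<longrightarrow> D = C)"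

text \<open>Unions of components of the complement graph on \<open>S\<close>; together with
  \<open>stack_conn\<close>, the single components.\<close>

definition closed_in :: "nat set \<Rightarrow> nat set \<Rightarrow> bool" where
  "closed_in C S \<longleftrightarrow> C \<subseteq> S \<and> (\<forall>x\<in>C. \<forall>y\<in>S - C. E x y)"

abbreviation supp :: "int list \<Rightarrow> nat set" where
  "supp w \<equiv> vtx ` set w"

abbreviation res :: "nat set \<Rightarrow> int list \<Rightarrow> int list" where
  "res C \<equiv> filter (\<lambda>a. vtx a \<in> C)"

lemma rots_supp: "rots u v \<Longrightarrow> supp v = supp u"
proof (induction rule: rots.induct)
  case (rots_trans_teq u v w)
  then show ?case using teq_set[of v w] by simp
qed (auto dest: teq_set)

lemma rots_length: "rots u v \<Longrightarrow> length v = length u"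
  by (induction rule: rots.induct) (auto dest: teq_length)

lemma supp_res: "supp (res D w) = supp w \<inter> D"
  by auto

lemma rots_res: "rots u v \<Longrightarrow> rots (res C u) (res C v)"
proof (induction rule: rots.induct)
  case (rots_teq u v)
  then show ?case by (intro rots.rots_teq teq_filter)
next
  case (rots_rot u a w)
  then show ?case using rots.rots_rot[of "res C u" a "res C w"] by auto
next
  case (rots_trans_teq u v w)
  then show ?case using rots.rots_trans_teq teq_filter by blast
qed

lemma teq_commute:
  assumes "\<And>a b. a \<in> set u \<Longrightarrow> b \<in> set x \<Longrightarrow> E (vtx a) (vtx b)"
  shows "teq (u @ x) (x @ u)"
  using assms
proof (induction u)
  case (Cons a u)
  have "teq (a # u @ x) (a # x @ u)" using Cons by (intro teq_Cons) auto
  moreover have "teq (a # x) (x @ [a])" using Cons by (intro teq_move) auto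
  from teq_append[OF this teq_refl, of u] have "teq (a # x @ u) (x @ a # u)" by simp
  ultimately show ?case using teq_trans by simp
qed simp

lemma teq_split:
  assumes "closed_in C (supp w)"
  shows "teq w (res C w @ res (- C) w)"
proof -
  have "\<forall>x\<in>C \<inter> supp w. \<forall>y\<in>supp w - C. E x y" using assms by (auto simp: closed_in_def)
  then show ?thesis
  proof (induction w)
    case (Cons a w)
    then have t: "teq w (res C w @ res (- C) w)" by auto
    show ?case
    proof (cases "vtx a \<in> C")
      case True
      then show ?thesis using teq_Cons[OF t] by simp
    next
      case False
      have "teq (a # res C w) (res C w @ [a])" using Cons.prems False E_sym by (intro teq_move) auto
      from teq_append[OF this teq_refl, of "res (- C) w"] teq_trans[OF teq_Cons[OF t]]
      show ?thesis using False by simp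
    qed
  qed simp
qed

lemma rots_append:
  assumes "rots u v" "\<And>a b. a \<in> supp u \<Longrightarrow> b \<in> supp x \<Longrightarrow> E a b"
  shows "rots (u @ x) (v @ x)"
  using assms
proof (induction rule: rots.induct)
  case (rots_teq u v)
  then show ?case by (intro rots.rots_teq teq_append) auto
next
  case (rots_rot u a w)
  have "rots (u @ x) (a # w @ x)" using rots_rot by simp
  then have r: "rots (u @ x) ((w @ x) @ [F a])" by (rule rots.rots_rot)
  have "vtx a \<in> supp u" using rots_supp[OF rots_rot(1)] by auto
  then have "teq ([F a] @ x) (x @ [F a])" using rots_rot by (intro teq_commute) auto
  from teq_append[OF teq_refl teq_sym[OF this], of w] have "teq (w @ x @ [F a]) (w @ [F a] @ x)" .
  then show ?case using rots_trans_teq[OF r] by simp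
next
  case (rots_trans_teq u v w)
  then show ?case using rots.rots_trans_teq[of "u @ x" "v @ x" "w @ x"] teq_append by auto
qed

text \<open>A smallest nonempty closed part \<open>C\<close> of the support is connected. The
  letters in \<open>C\<close> commute with all others, so the word is a product of two commuting
  factors, and rotating one factor rotates the word. The second factor is treated by induction on
  the support.\<close>

lemma rots_components:
  assumes "supp u = S" "supp v = S"
    "\<And>C. stack_conn C \<Longrightarrow> closed_in C S \<Longrightarrow> rots (res C u) (res C v)"
  shows "rots u v"
  using assms
proof (induction "card S" arbitrary: S u v rule: less_induct)
  case less
  have fin: "finite S" using less.prems by auto
  show ?case
  proof (cases "S = {}")
    case True
    then show ?thesis using less.prems by simp
  next
    case False
    define Q where "Q C \<longleftrightarrow> C \<noteq> {} \<and> closed_in C S" for C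
    have "Q S" using False by (auto simp: Q_def closed_in_def)
    then obtain C where C: "Q C" "\<And>D. Q D \<Longrightarrow> card C \<le> card D"
      using ex_has_least_nat[of Q S card] by blast
    have CS: "C \<subseteq> S" "C \<noteq> {}" "closed_in C S" using C by (auto simp: Q_def closed_in_def)
    have conn: "stack_conn C"
      unfolding stack_conn_def
    proof (intro conjI allI impI)
      fix D assume D: "D \<subseteq> C" "D \<noteq> {}" "\<forall>x\<in>D. \<forall>y\<in>C - D. E x y"
      then have "E x y" if "x \<in> D" "y \<in> S - D" for x y
        using that CS(3) by (cases "y \<in> C") (auto simp: closed_in_def)
      then have "Q D" using D CS by (auto simp: Q_def closed_in_def)
      then show "D = C" using C(2) D(1) finite_subset[OF CS(1) fin] card_seteq by blast
    qed (rule CS)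
    let ?u = "res (- C) u" and ?v = "res (- C) v"
    have su: "supp ?u = S - C" "supp ?v = S - C"
      using supp_res[of "- C" u] supp_res[of "- C" v] less.prems(1,2) by (simp_all add: Diff_eq)
    have rest: "rots ?u ?v"
    proof (rule less.hyps[OF _ su])
      show "card (S - C) < card S" using CS fin by (intro psubset_card_mono) auto
      fix D assume D: "stack_conn D" "closed_in D (S - C)"
      have "closed_in D S"
        unfolding closed_in_def
      proof (intro conjI ballI)
        show "D \<subseteq> S" using D by (auto simp: closed_in_def)
        fix x y assume xy: "x \<in> D" "y \<in> S - D"
        show "E x y"
        proof (cases "y \<in> C")
          case True
          then have "E y x" using D xy CS by (auto simp: closed_in_def)
          then show ?thesis by (rule E_sym)
        next
          case False
          then show ?thesis using D xy by (auto simp: closed_in_def)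
        qed
      qed
      then have "rots (res D u) (res D v)" using less.prems D by blast
      moreover have "D \<inter> C = {}" using D by (auto simp: closed_in_def)
      then have "res D ?u = res D u" "res D ?v = res D v" by (auto intro: filter_cong)
      ultimately show "rots (res D ?u) (res D ?v)" by simp
    qed
    have comm: "E a b" "E b a" if "a \<in> C" "b \<in> S - C" for a b
      using CS(3) that E_sym by (auto simp: closed_in_def)
    have r1: "rots (res C u @ ?u) (res C v @ ?u)"
      by (rule rots_append) (use less.prems conn CS comm su in auto)
    have r2: "rots (?u @ res C v) (?v @ res C v)"
      by (rule rots_append[OF rest]) (use less.prems comm su in auto)
    have mem: "vtx a \<in> S - C" if "a \<in> set ?u \<union> set ?v" for a using su that by blast
    have c1: "teq (res C v @ ?u) (?u @ res C v)"
      by (rule teq_commute) (use comm(1) mem in auto)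
    have c2: "teq (?v @ res C v) (res C v @ ?v)"
      by (rule teq_commute) (use comm(2) mem in auto)
    have "closed_in C (supp u)" "closed_in C (supp v)" using CS(3) less.prems(1,2) by simp_all
    note split = this[THEN teq_split]
    from rots_trans_teq[OF rots_trans[OF r1 rots_teq[OF split(1)]] c1] have "rots u (?u @ res C v)" .
    from rots_trans_teq[OF rots_trans[OF r2 this] c2] have "rots u (res C v @ ?v)" .
    moreover have "teq (res C v @ ?v) v" by (rule teq_sym[OF split(2)])
    ultimately show ?thesis by (rule rots_trans_teq)
  qed
qed

text \<open>The action of \<open>F\<close> on the signs at \<open>y\<close>, read off from its value
  at the positive letter.\<close>

definition flip :: "nat \<Rightarrow> int \<Rightarrow> int" where
  "flip y d = (if F (int y + 1) = int y + 1 then d else 3 - d)"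

lemma flip_digit: "c \<noteq> 0 \<Longrightarrow> flip (vtx c) (digit c) = digit (F c)"
proof -
  assume c: "c \<noteq> 0"
  let ?a = "int (vtx c) + 1"
  have a: "?a = \<bar>c\<bar>" using c by (auto simp: vtx_def)
  show ?thesis
  proof (cases "c > 0")
    case True
    then show ?thesis using F_pm[of c] a c by (auto simp: flip_def)
  next
    case False
    then have "?a = - c" using a by simp
    moreover have "F (- c) = - c \<longleftrightarrow> F c = c" by simp
    ultimately show ?thesis using F_pm[of c] c by (auto simp: flip_def simp del: F_minus)
  qed
qed

text \<open>The front of a word is at the head of its stacks: a nonzero head means that a letter at
  \<open>y\<close> can be moved to the front, hence rotated.\<close>

definition top_letter :: "(nat \<Rightarrow> int list) \<Rightarrow> nat \<Rightarrow> bool" where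
  "top_letter P y \<longleftrightarrow> P y \<noteq> [] \<and> hd (P y) \<noteq> 0"

subsection \<open>Twisted cyclic reduction\<close>

text \<open>The bound on the length keeps one occurrence from serving as first and last letter at
  once: when \<open>F\<close> inverts \<open>y\<close>, a single letter would match itself.\<close>

definition redu :: "nat \<Rightarrow> (nat \<Rightarrow> int list) \<Rightarrow> bool" where
  "redu y P \<longleftrightarrow> 2 \<le> length (P y) \<and> hd (P y) \<noteq> 0 \<and> last (P y) = 3 - flip y (hd (P y))"

definition strip :: "nat \<Rightarrow> (nat \<Rightarrow> int list) \<Rightarrow> nat \<Rightarrow> int list" where
  "strip y P = (\<lambda>z. if E y z then P z else butlast (tl (P z)))"

definition strip_if :: "nat \<Rightarrow> (nat \<Rightarrow> int list) \<Rightarrow> nat \<Rightarrow> int list" where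
  "strip_if y P = (if redu y P then strip y P else P)"

lemma redu_word:
  assumes p: "valid p" "red p" and r: "redu y (pile p)"
  obtains x where "valid x" "red x" "tw p x" "length x < length p" "strip y (pile p) = pile x"
proof -
  have "pile p y \<noteq> []" "hd (pile p y) \<noteq> 0" using r by (auto simp: redu_def)
  then obtain w c where w: "teq p (c # w)" "vtx c = y" "digit c = hd (pile p y)"
    using pile_hd by blast
  have v: "valid w" "valid_letter n c" using teq_valid[OF w(1)] p by auto
  have c0: "c \<noteq> 0" "F c \<noteq> 0" using v valid_letter_nonzero[of n c] valid_letter_nonzero[of n "F c"] by auto
  have pe: "pile p y = digit c # pile w y" using teq_pile[OF w(1)] w(2) by (simp add: pile_Cons)
  then have ne: "pile w y \<noteq> []" using r by (auto simp: redu_def)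
  have l: "last (pile w y) = digit (- F c)"
    using r pe ne flip_digit[OF c0(1)] w(2) c0 by (auto simp: redu_def)
  then obtain x d where x: "teq w (x @ [d])" "vtx d = y" "digit d = digit (- F c)"
    using pile_last[of w y] ne by auto
  have vx: "valid x" "valid_letter n d" using teq_valid[OF x(1)] v by auto
  have "d = - F c" using x(2,3) w(2) c0 vx valid_letter_nonzero[of n d]
    by (intro letter_eqI[of d "- F c"]) auto
  with x have xx: "teq w (x @ [- F c])" by simp
  have t: "teq p (c # x @ [- F c])" by (rule teq_trans[OF w(1) teq_Cons[OF xx]])
  have rx: "red x"
    using red_teq[OF t] p red_appendD[of "[c]" "x @ [- F c]"] red_appendD[of x "[- F c]"] by simp
  have g: "geq (- c # p @ [F c]) x"
  proof -
    have "geq ([- c] @ p @ [F c]) ([- c] @ (c # x @ [- F c]) @ [F c])"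
      by (rule geq_cong[OF teq_geq[OF t p(1)]])
    also have "[- c] @ (c # x @ [- F c]) @ [F c] = [- c, c] @ x @ [- F c, F c]" by simp
    also have "geq \<dots> ([] @ x @ [])"
      using geq_cancel_left[of "[c]"] geq_cancel_left[of "[F c]"] v
      by (intro geq_append) auto
    finally show ?thesis by simp
  qed
  have "tw p x" by (rule tw_single[of "F c"]) (use v g in \<open>auto intro: geq_sym\<close>)
  moreover have "strip y (pile p) = pile x"
    unfolding teq_pile[OF t] by (auto simp: strip_def fun_eq_iff pile_Cons pile_single w(2) butlast_append)
  ultimately show ?thesis using that vx rx teq_length[OF t] by auto
qed

lemma irred_if_not_redu:
  assumes "valid p" "\<And>y. y < n \<Longrightarrow> \<not> redu y (pile p)"
  shows "irred p"
  unfolding irred_def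
proof
  assume "\<exists>c x. teq p (c # x @ [- F c])"
  then obtain c x where t: "teq p (c # x @ [- F c])" by blast
  have v: "valid_letter n c" using teq_valid[OF t] assms by simp
  then have c0: "c \<noteq> 0" "F c \<noteq> 0" using valid_letter_nonzero[of n c] valid_letter_nonzero[of n "F c"] by auto
  have "redu (vtx c) (pile p)"
    using flip_digit[OF c0(1)] c0 unfolding teq_pile[OF t]
    by (auto simp: redu_def pile_Cons pile_single)
  then show False using assms v vtx_less by blast
qed

lemma strip_pass:
  assumes "valid p" "red p"
  shows "\<exists>p'. valid p' \<and> red p' \<and> tw p p' \<and> fold strip_if ys (pile p) = pile p' \<and>
    (length p' < length p \<or> p' = p \<and> (\<forall>y\<in>set ys. \<not> redu y (pile p)))"
  using assms
proof (induction ys arbitrary: p)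
  case Nil
  then show ?case using tw_geq geq_refl by (intro exI[of _ p]) auto
next
  case (Cons y ys)
  show ?case
  proof (cases "redu y (pile p)")
    case True
    from Cons.prems True obtain x where x: "valid x" "red x" "tw p x" "length x < length p"
      "strip y (pile p) = pile x" by (rule redu_word)
    obtain p' where p': "valid p'" "red p'" "tw x p'" "fold strip_if ys (pile x) = pile p'"
      "length p' \<le> length x"
      using Cons.IH[OF x(1,2)] by (auto intro: less_imp_le)
    moreover have "strip_if y (pile p) = pile x" using x True by (simp add: strip_if_def)
    ultimately show ?thesis using x tw_trans[OF x(3) p'(3)] by (intro exI[of _ p']) auto
  next
    case False
    then have "strip_if y (pile p) = pile p" by (simp add: strip_if_def)
    then show ?thesis using Cons False by auto
  qed
qed

text \<open>A pass over all vertices shortens the word or shows it irreducible, after which further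
  passes change nothing. As many passes as letters suffice, and the program need not detect the
  end.\<close>

lemma cyclic_reduction:
  assumes "valid p" "red p" "length p \<le> m"
  shows "\<exists>p'. valid p' \<and> red p' \<and> irred p' \<and> tw p p' \<and> length p' \<le> length p \<and>
    (fold strip_if [0..<n] ^^ m) (pile p) = pile p'"
  using assms
proof (induction m arbitrary: p)
  case 0
  then show ?case using tw_geq geq_refl irred_if_not_redu[of "[]"] by (intro exI[of _ "[]"]) (auto simp: redu_def)
next
  case (Suc m)
  obtain q where q: "valid q" "red q" "tw p q" "fold strip_if [0..<n] (pile p) = pile q"
    "length q < length p \<or> q = p \<and> (\<forall>y\<in>set [0..<n]. \<not> redu y (pile p))"
    using strip_pass[OF Suc.prems(1,2)] by blast
  show ?case
  proof (cases "length q < length p")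
    case True
    then obtain p' where "valid p'" "red p'" "irred p'" "tw q p'" "length p' \<le> length q"
      "(fold strip_if [0..<n] ^^ m) (pile q) = pile p'"
      using Suc.IH[OF q(1,2)] Suc.prems(3) by auto
    then show ?thesis using q True tw_trans[OF q(3)]
      by (intro exI[of _ p']) (auto simp: funpow_swap1)
  next
    case False
    then have qp: "q = p" "\<And>y. y < n \<Longrightarrow> \<not> redu y (pile p)" using q by auto
    have "(fold strip_if [0..<n] ^^ k) (pile p) = pile p" for k
      by (induction k) (use q qp in auto)
    from this[of "Suc m"] irred_if_not_redu[OF Suc.prems(1) qp(2)] Suc.prems tw_geq[OF geq_refl]
    show ?thesis by blast
  qed
qed

end

subsection \<open>The rotation orbit of a connected trace\<close>

text \<open>\<open>x\<close> is the apex; the order of \<open>ys\<close> breaks ties between the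
  other movable vertices.\<close>

locale component = inversion_twist +
  fixes C :: "nat set" and x :: nat and ys :: "nat list"
  assumes conn: "stack_conn C" and C_less: "C \<subseteq> {..<n}" and x: "x \<in> C" and ys: "set ys = C - {x}"
begin

text \<open>A rotation seen on the stacks, as in chip firing: it depends only on the vertex, because
  the stack itself shows which letter is moved.\<close>

definition fire :: "nat \<Rightarrow> (nat \<Rightarrow> int list) \<Rightarrow> nat \<Rightarrow> int list" where
  "fire y P = (\<lambda>z. if z \<in> C \<and> \<not> E y z
     then tl (P z) @ [if z = y then flip y (hd (P y)) else 0] else P z)"

definition cpile :: "int list \<Rightarrow> nat \<Rightarrow> int list" where
  "cpile u = (\<lambda>z. if z \<in> C then pile u z else [])"

definition cword :: "int list \<Rightarrow> bool" where
  "cword u \<longleftrightarrow> valid u \<and> supp u = C"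

lemma cpile_teq: "teq u v \<Longrightarrow> cpile u = cpile v"
  using teq_pile by (auto simp: cpile_def)

lemma cpile_inj: "cword u \<Longrightarrow> cword v \<Longrightarrow> cpile u = cpile v \<Longrightarrow> teq u v"
  by (rule pile_inj_on[of _ _ C]) (auto simp: cpile_def cword_def fun_eq_iff split: if_splits)

lemma cword_rots: "rots u v \<Longrightarrow> cword u \<Longrightarrow> cword v"
  using rots_valid rots_supp by (simp add: cword_def)

lemma fire_cpile:
  assumes "teq u (c # w)" "cword u"
  shows "fire (vtx c) (cpile u) = cpile (w @ [F c])"
proof -
  have "valid_letter n c" "vtx c \<in> C"
    using teq_valid[OF assms(1)] teq_set[OF assms(1)] assms(2) by (auto simp: cword_def)
  then have "flip (vtx c) (digit c) = digit (F c)" "vtx c \<in> C"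
    using flip_digit valid_letter_nonzero by blast+
  then show ?thesis
    unfolding cpile_teq[OF assms(1)] by (auto simp: fire_def cpile_def fun_eq_iff pile_Cons pile_single)
qed

lemma top_letter_word:
  assumes "top_letter (cpile u) y" "cword u"
  obtains c w where "teq u (c # w)" "vtx c = y" "fire y (cpile u) = cpile (w @ [F c])"
    "rots u (w @ [F c])" "cword (w @ [F c])" "y \<in> C"
proof -
  have y: "y \<in> C" "pile u y \<noteq> []" "hd (pile u y) \<noteq> 0"
    using assms by (auto simp: top_letter_def cpile_def split: if_splits)
  then obtain w c where c: "teq u (c # w)" "vtx c = y" using pile_hd by blast
  have r: "rots u (w @ [F c])" by (rule rots_rot) (rule rots_teq[OF c(1)])
  show ?thesis
    using that[OF c _ r cword_rots[OF r assms(2)] y(1)] fire_cpile[OF c(1) assms(2)] c(2) by blast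
qed

lemma top_letter_teq: "teq u (c # w) \<Longrightarrow> cword u \<Longrightarrow> top_letter (cpile u) (vtx c)"
  using cpile_teq[of u "c # w"] teq_set[of u "c # w"]
  by (auto simp: top_letter_def cpile_def pile_Cons cword_def)

lemma top_letters_commute:
  assumes "top_letter (cpile u) y" "top_letter (cpile u) z" "cword u" "y \<noteq> z"
  shows "E y z"
proof (rule ccontr)
  assume "\<not> E y z"
  from assms(1,3) obtain c w where c: "teq u (c # w)" "vtx c = y" by (rule top_letter_word)
  then have "cpile u z = [] \<or> hd (cpile u z) = 0"
    using cpile_teq[OF c(1)] \<open>\<not> E y z\<close> assms(4) by (auto simp: cpile_def pile_Cons)
  then show False using assms(2) by (auto simp: top_letter_def)
qed

lemma fire_other: "E y z \<Longrightarrow> fire y P z = P z"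
  by (simp add: fire_def)

lemma fire_commute:
  assumes "E y z" "top_letter P y" "top_letter P z"
  shows "fire y (fire z P) = fire z (fire y P)"
proof -
  have "E z y" "y \<noteq> z" using assms E_sym by auto
  then show ?thesis using assms(1) by (auto simp: fire_def fun_eq_iff)
qed

section \<open>Legal firing sequences and the least action principle\<close>

primrec legal :: "(nat \<Rightarrow> int list) \<Rightarrow> nat list \<Rightarrow> (nat \<Rightarrow> int list) \<Rightarrow> bool" where
  "legal P [] Q \<longleftrightarrow> P = Q"
| "legal P (y # s) Q \<longleftrightarrow> top_letter P y \<and> legal (fire y P) s Q"

lemma legal_append: "legal P s Q \<Longrightarrow> legal Q t R \<Longrightarrow> legal P (s @ t) R"
  by (induction s arbitrary: P) auto

text \<open>The moved letters \<open>t\<close> satisfy the equation \<open>u F(t) = t v\<close> of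
  traces. Projected to two vertices, it limits how far one of them can run ahead of the
  other.\<close>

lemma legal_word:
  assumes "legal (cpile u) s Q" "cword u"
  shows "\<exists>t v. cword v \<and> Q = cpile v \<and> s = map vtx t \<and> teq (u @ map F t) (t @ v) \<and> rots u v"
  using assms
proof (induction s arbitrary: u)
  case Nil
  then show ?case by (intro exI[of _ "[]"] exI[of _ u]) auto
next
  case (Cons y s)
  then have "top_letter (cpile u) y" by simp
  from this Cons.prems(2) obtain c w where c: "teq u (c # w)" "vtx c = y" "fire y (cpile u) = cpile (w @ [F c])"
    "rots u (w @ [F c])" "cword (w @ [F c])" by (rule top_letter_word)
  then obtain t v where tv: "cword v" "Q = cpile v" "s = map vtx t"
    "teq ((w @ [F c]) @ map F t) (t @ v)" "rots (w @ [F c]) v"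
    using Cons.IH[of "w @ [F c]"] Cons.prems by auto
  have "teq (u @ map F (c # t)) (c # (w @ [F c]) @ map F t)"
    using teq_append[OF c(1) teq_refl, of "map F (c # t)"] by simp
  also have "teq (c # (w @ [F c]) @ map F t) (c # t @ v)" using tv(4) by (rule teq_Cons)
  finally show ?case using tv c rots_trans[OF tv(5) c(4)]
    by (intro exI[of _ "c # t"] exI[of _ v]) auto
qed

lemma rots_legal:
  assumes "rots u v" "cword u"
  shows "\<exists>s. legal (cpile u) s (cpile v)"
  using assms
proof (induction rule: rots.induct)
  case (rots_teq u v)
  then show ?case using cpile_teq by (intro exI[of _ "[]"]) auto
next
  case (rots_rot u a w)
  then obtain s where s: "legal (cpile u) s (cpile (a # w))" by blast
  have w: "cword (a # w)" using cword_rots rots_rot by blast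
  have "legal (cpile (a # w)) [vtx a] (cpile (w @ [F a]))"
    using top_letter_teq[OF teq_refl w] fire_cpile[OF teq_refl w] by simp
  then show ?case using legal_append[OF s] by blast
next
  case (rots_trans_teq u v w)
  then show ?case using cpile_teq by metis
qed

text \<open>Vertices movable at the same time commute, so the first firing of \<open>y\<close> can
  be pulled to the front of the sequence.\<close>

lemma legal_exchange:
  assumes "legal (cpile u) s Q" "cword u" "y \<in> set s" "top_letter (cpile u) y"
  shows "legal (fire y (cpile u)) (remove1 y s) Q"
  using assms
proof (induction s arbitrary: u)
  case (Cons z s)
  show ?case
  proof (cases "z = y")
    case True
    then show ?thesis using Cons.prems by simp
  next
    case False
    have z: "top_letter (cpile u) z" using Cons.prems by simp
    from z Cons.prems(2) obtain c w where c: "fire z (cpile u) = cpile (w @ [F c])" "cword (w @ [F c])"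
      by (rule top_letter_word)
    have yz: "E y z" "E z y" using top_letters_commute Cons.prems z False E_sym by blast+
    have "top_letter (fire z (cpile u)) y" using Cons.prems(4) fire_other[OF yz(2)] by (simp add: top_letter_def)
    then have "legal (fire y (fire z (cpile u))) (remove1 y s) Q"
      using Cons.IH[of "w @ [F c]"] c Cons.prems False by auto
    moreover have "top_letter (fire y (cpile u)) z" using z fire_other[OF yz(1)] by (simp add: top_letter_def)
    ultimately show ?thesis
      using False fire_commute[OF yz(1) Cons.prems(4) z] by simp
  qed
qed simp

text \<open>Firing another movable vertex leaves the stack of \<open>y\<close> alone, so
  \<open>y\<close> stays movable until it is fired itself.\<close>

lemma legal_persist:
  assumes "legal (cpile u) s Q" "cword u" "y \<notin> set s" "top_letter (cpile u) y"
  shows "top_letter Q y"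
  using assms
proof (induction s arbitrary: u)
  case (Cons z s)
  have z: "top_letter (cpile u) z" using Cons.prems by simp
  from z Cons.prems(2) obtain c w where c: "fire z (cpile u) = cpile (w @ [F c])" "cword (w @ [F c])"
    by (rule top_letter_word)
  have "E z y" using top_letters_commute[OF z] Cons.prems by auto
  then have "top_letter (fire z (cpile u)) y" using Cons.prems(4) fire_other by (simp add: top_letter_def)
  then show ?case using Cons.IH[of "w @ [F c]"] c Cons.prems by auto
qed simp

definition next_fire :: "(nat \<Rightarrow> int list) \<Rightarrow> nat \<Rightarrow> int list" where
  "next_fire P = (case find (top_letter P) ys of Some y \<Rightarrow> fire y P | None \<Rightarrow> fire x P)"

definition next_stab :: "(nat \<Rightarrow> int list) \<Rightarrow> nat \<Rightarrow> int list" where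
  "next_stab P = (case find (top_letter P) ys of Some y \<Rightarrow> fire y P | None \<Rightarrow> P)"

definition stable :: "(nat \<Rightarrow> int list) \<Rightarrow> bool" where
  "stable P \<longleftrightarrow> find (top_letter P) ys = None"

lemma find_ysD: "find (top_letter P) ys = Some y \<Longrightarrow> top_letter P y \<and> y \<noteq> x \<and> y \<in> C"
  using ys by (auto simp: find_Some_iff dest!: nth_mem)

lemma stable_iff: "stable P \<longleftrightarrow> (\<forall>y\<in>C - {x}. \<not> top_letter P y)"
  using ys by (auto simp: stable_def find_None_iff)

text \<open>Any legal sequence leading to a stable state can be reordered into the greedy one.\<close>

lemma least_action:
  assumes "legal (cpile u) s Q" "cword u" "stable Q"
  shows "Q = (next_fire ^^ length s) (cpile u)"
  using assms
proof (induction "length s" arbitrary: s u)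
  case 0
  then show ?case by simp
next
  case (Suc m)
  have step: "Q = (next_fire ^^ length s) (cpile u)"
    if y: "top_letter (cpile u) y" "y \<in> set s" "next_fire (cpile u) = fire y (cpile u)" for y
  proof -
    from y(1) Suc.prems(2) obtain c w where c: "fire y (cpile u) = cpile (w @ [F c])" "cword (w @ [F c])"
      by (rule top_letter_word)
    have "legal (cpile (w @ [F c])) (remove1 y s) Q"
      using legal_exchange[OF Suc.prems(1,2) y(2,1)] c by simp
    moreover have len: "m = length (remove1 y s)" using Suc.hyps(2) y(2) by (simp add: length_remove1)
    ultimately have "Q = (next_fire ^^ m) (cpile (w @ [F c]))"
      using Suc.hyps(1)[of "remove1 y s" "w @ [F c]"] c Suc.prems(3) by simp
    then show ?thesis using Suc.hyps(2) y c by (simp add: funpow_swap1 flip: Suc.hyps(2))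
  qed
  show ?case
  proof (cases "find (top_letter (cpile u)) ys")
    case None
    then have st: "stable (cpile u)" by (simp add: stable_def)
    obtain z t where s: "s = z # t" using Suc.hyps(2) by (cases s) auto
    then have z: "top_letter (cpile u) z" using Suc.prems by simp
    from z Suc.prems(2) have "z \<in> C" by (rule top_letter_word)
    \<comment> \<open>In a stable state nothing but the apex is movable, so any legal sequence
      begins like the greedy one.\<close>
    then have "z = x" using st z by (auto simp: stable_iff)
    then show ?thesis using step[OF z] s None by (simp add: next_fire_def)
  next
    case (Some y)
    note y = find_ysD[OF Some]
    \<comment> \<open>Otherwise \<open>y\<close> would still be movable in \<open>Q\<close>, against
      stability.\<close>
    have "y \<in> set s"
      using legal_persist[OF Suc.prems(1,2)] y Suc.prems(3) by (auto simp: stable_iff)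
    moreover have "next_fire (cpile u) = fire y (cpile u)" using Some by (simp add: next_fire_def)
    ultimately show ?thesis using step y by blast
  qed
qed

lemma legal_prefix: "legal (cpile (u @ v)) (map vtx u) (cpile (v @ map F u))" if "cword (u @ v)" for u v
  using that
proof (induction u arbitrary: v)
  case (Cons a u)
  then have w: "cword (a # u @ v)" by simp
  have "cword ((u @ v) @ [F a])"
    by (rule cword_rots[OF _ w]) (rule rots_single)
  then show ?case
    using Cons.IH[of "v @ [F a]"] top_letter_teq[OF teq_refl w] fire_cpile[OF teq_refl w] by simp
qed simp

text \<open>One turn applies \<open>F\<close> to the word and a second one undoes this; the greedy
  orbit of a stable state thus has period twice the length.\<close>

lemma legal_period:
  assumes "cword u"
  shows "legal (cpile u) (map vtx u @ map vtx u) (cpile u)"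
proof -
  have w: "cword (map F u)" using assms by (auto simp: cword_def image_image)
  have "legal (cpile u) (map vtx u) (cpile (map F u))"
    using legal_prefix[of u "[]"] assms by simp
  moreover have "legal (cpile (map F u)) (map vtx (map F u)) (cpile (map F (map F u)))"
    using legal_prefix[of "map F u" "[]"] w by simp
  then have "legal (cpile (map F u)) (map vtx u) (cpile u)" by (simp add: o_def)
  ultimately show ?thesis by (rule legal_append)
qed

text \<open>By iterating the equation, \<open>S\<close> and \<open>Suc k\<close> copies of
  \<open>A\<close> are comparable as prefixes. If \<open>S\<close> is the shorter one, its letters
  are counted by those copies; it cannot be the longer one, since it would then contain
  \<open>z\<close> too often.\<close>

lemma count_bound:
  assumes eq: "A @ S = S @ V" and z: "count_list S z \<le> k * count_list A z" "0 < count_list A z"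
  shows "count_list S y \<le> Suc k * count_list A y"
proof -
  have pow: "\<exists>V. concat (replicate m A) @ S = S @ V" for m
  proof (induction m)
    case (Suc m)
    then obtain V' where V': "concat (replicate m A) @ S = S @ V'" by blast
    have "concat (replicate (Suc m) A) @ S = A @ S @ V'" using V' by simp
    also have "\<dots> = S @ (V @ V')" using eq by (metis append.assoc)
    finally show ?case by blast
  qed simp
  have cnt: "count_list (concat (replicate m A)) v = m * count_list A v" for m v
    by (induction m) auto
  obtain V' where "concat (replicate (Suc k) A) @ S = S @ V'" using pow by blast
  then obtain t where "concat (replicate (Suc k) A) = S @ t \<or> S = concat (replicate (Suc k) A) @ t"
    by (auto simp: append_eq_append_conv2)
  then show ?thesis
  proof
    assume "concat (replicate (Suc k) A) = S @ t"
    then show ?thesis using cnt[of "Suc k" y] by (metis count_list_append le_add1)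
  next
    assume "S = concat (replicate (Suc k) A) @ t"
    then have "Suc k * count_list A z \<le> count_list S z"
      using cnt[of "Suc k" z] by (metis count_list_append le_add1)
    then show ?thesis using z by simp
  qed
qed

text \<open>\<open>D k\<close> collects the vertices fired for at most \<open>k\<close> turns. The
  apex lies in \<open>D 0\<close>, and a vertex not commuting with a member of \<open>D k\<close>
  lies in \<open>D (Suc k)\<close>. By connectedness \<open>D k\<close> grows until it is all of
  \<open>C\<close>, at the latest for \<open>k = n\<close>; summing over the vertices gives the
  bound.\<close>

lemma legal_without_apex:
  assumes leg: "legal (cpile u) s Q" and u: "cword u" and xs: "x \<notin> set s"
  shows "length s \<le> n * length u"
proof -
  obtain t v where tv: "cword v" "s = map vtx t" "teq (u @ map F t) (t @ v)"
    using legal_word[OF leg u] by blast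
  let ?A = "count_list (map vtx u)" and ?N = "count_list s"
  define D where "D k = {y \<in> C. ?N y \<le> k * ?A y}" for k
  have Apos: "0 < ?A z" if "z \<in> C" for z
    using that u count_list_0_iff[of "map vtx u" z] by (auto simp: cword_def)
  have setC: "set s \<subseteq> C"
  proof -
    have "set (t @ v) = set (u @ map F t)" using teq_set[OF tv(3)] by simp
    have "supp t \<subseteq> C"
    proof
      fix y assume y: "y \<in> supp t"
      have "set s \<subseteq> C" using leg u
      proof (induction s arbitrary: u)
        case (Cons z s)
        then have "top_letter (cpile u) z" by simp
        from this Cons.prems(2) obtain c w where "fire z (cpile u) = cpile (w @ [F c])" "cword (w @ [F c])" "z \<in> C"
          by (rule top_letter_word)
        then show ?case using Cons.IH[of "w @ [F c]"] Cons.prems by auto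
      qed simp
      then show "y \<in> C" using y tv by auto
    qed
    then show ?thesis using tv by auto
  qed
  have step: "y \<in> D (Suc k)" if y: "y \<in> C" and z: "z \<in> D k" and nE: "\<not> E y z" and yz: "y \<noteq> z" for y z k
  proof -
    \<comment> \<open>The order in which two non-commuting vertices occur is a trace invariant, and
      \<open>F\<close> keeps vertices. The equation of \<open>legal_word\<close> thus becomes one of
      words in two symbols, the form needed for \<open>count_bound\<close>.\<close>
    define pr where "pr w = filter (\<lambda>v. v = y \<or> v = z) (map vtx w)" for w :: "int list"
    have "pr (u @ map F t) = pr (t @ v)"
    proof (rule teq_invariant[OF _ tv(3)])
      fix w w' assume "tstep w w'"
      then show "pr w = pr w'"
      proof (induction rule: tstep.induct)
        case (1 a b us vs)
        then show ?case using nE E_sym by (auto simp: pr_def)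
      qed
    qed
    moreover have "pr (map F t) = pr t" by (simp add: pr_def o_def)
    ultimately have eq: "pr u @ pr t = pr t @ pr v" by (simp add: pr_def)
    have cnt: "count_list (pr w) r = count_list (map vtx w) r" if "r = y \<or> r = z" for w r
      unfolding pr_def using that by (induction w) auto
    show ?thesis
      using count_bound[OF eq, of z k y] z y Apos[of z] cnt tv(2) by (auto simp: D_def)
  qed
  have mono: "D k \<subseteq> D (Suc k)" for k by (auto simp: D_def)
  have finC: "finite C" using C_less finite_subset by blast
  have grow: "Suc k \<le> card (D k) \<or> D k = C" for k
  proof (induction k)
    case 0
    have "x \<in> D 0" using x xs by (simp add: D_def)
    moreover have "finite (D 0)" using finC by (simp add: D_def)
    ultimately show ?case using card_gt_0_iff[of "D 0"] by auto
  next
    case (Suc k)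
    show ?case
    proof (cases "D k = C")
      case True
      then show ?thesis using mono[of k] by (auto simp: D_def)
    next
      case False
      have "x \<in> D k" using x xs by (simp add: D_def)
      moreover have "D k \<subseteq> C" by (auto simp: D_def)
      ultimately obtain z y where zy: "z \<in> D k" "y \<in> C - D k" "\<not> E z y"
        using conn False unfolding stack_conn_def by blast
      then have "y \<in> D (Suc k)" using step[of y z k] E_sym by auto
      then have "D k \<subset> D (Suc k)" using mono[of k] zy by auto
      moreover have "finite (D (Suc k))" using finC by (simp add: D_def)
      ultimately have "card (D k) < card (D (Suc k))" by (rule psubset_card_mono[rotated])
      then show ?thesis using Suc False by auto
    qed
  qed
  have "card (D n) \<le> card {..<n}" using C_less by (intro card_mono) (auto simp: D_def)
  then have "D n = C" using grow[of n] by auto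
  then have le: "?N y \<le> n * ?A y" if "y \<in> C" for y using that by (auto simp: D_def)
  have sum_count: "(\<Sum>y\<in>C. count_list l y) = length l" if "set l \<subseteq> C" for l
    using that sum_count_set[OF _ finC] by blast
  have "length s = (\<Sum>y\<in>C. ?N y)" using sum_count[OF setC] by simp
  also have "\<dots> \<le> (\<Sum>y\<in>C. n * ?A y)" using le by (rule sum_mono)
  also have "\<dots> = n * (\<Sum>y\<in>C. ?A y)" by (simp add: sum_distrib_left)
  also have "(\<Sum>y\<in>C. ?A y) = length u" using sum_count[of "map vtx u"] u by (auto simp: cword_def)
  finally show ?thesis .
qed

text \<open>\<open>next_stab\<close> never fires the apex, so its proper steps form a legal sequence
  of bounded length; iterated more often than that, it has come to rest.\<close>

lemma stabilize:
  assumes "cword u" "n * length u < m"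
  shows "\<exists>s v. legal (cpile u) s (cpile v) \<and> cword v \<and> rots u v \<and> length s \<le> n * length u \<and>
    stable (cpile v) \<and> (next_stab ^^ m) (cpile u) = cpile v"
proof -
  have "\<exists>s. legal (cpile u) s ((next_stab ^^ m) (cpile u)) \<and> x \<notin> set s \<and>
    (length s = m \<or> stable ((next_stab ^^ m) (cpile u)))" for m
  proof (induction m)
    case 0
    then show ?case by (intro exI[of _ "[]"]) auto
  next
    case (Suc m)
    let ?P = "(next_stab ^^ m) (cpile u)"
    obtain s where s: "legal (cpile u) s ?P" "x \<notin> set s" "length s = m \<or> stable ?P" using Suc by blast
    show ?case
    proof (cases "find (top_letter ?P) ys")
      case None
      then have "next_stab ?P = ?P" "stable ?P" by (auto simp: next_stab_def stable_def)
      then show ?thesis using s by (intro exI[of _ s]) auto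
    next
      case (Some y)
      note y = find_ysD[OF Some]
      have "\<not> stable ?P" using Some by (simp add: stable_def)
      moreover have "legal ?P [y] (next_stab ?P)" using y Some by (simp add: next_stab_def)
      ultimately show ?thesis using s y legal_append[OF s(1)]
        by (intro exI[of _ "s @ [y]"]) auto
    qed
  qed
  then obtain s where s: "legal (cpile u) s ((next_stab ^^ m) (cpile u))" "x \<notin> set s"
    "length s = m \<or> stable ((next_stab ^^ m) (cpile u))" by blast
  have l: "length s \<le> n * length u" using legal_without_apex[OF s(1) assms(1) s(2)] .
  obtain v where v: "cword v" "(next_stab ^^ m) (cpile u) = cpile v" "rots u v"
    using legal_word[OF s(1) assms(1)] by blast
  show ?thesis using s l v assms(2) by (intro exI[of _ s] exI[of _ v]) auto
qed

lemma stable_apex: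
  assumes "cword v" "stable (cpile v)"
  shows "top_letter (cpile v) x"
proof -
  have "v \<noteq> []" using assms(1) x by (auto simp: cword_def)
  then obtain c w where c: "v = c # w" by (cases v) auto
  have "top_letter (cpile v) (vtx c)" using top_letter_teq[of v c w] assms(1) c by auto
  moreover have "vtx c \<in> C" using assms(1) c by (auto simp: cword_def)
  ultimately show ?thesis using assms(2) by (auto simp: stable_iff)
qed

lemma next_fire_rots:
  assumes "cword u"
  shows "\<exists>v. cword v \<and> rots u v \<and> (next_fire ^^ k) (cpile u) = cpile v"
proof (induction k)
  case 0
  then show ?case using assms by (intro exI[of _ u]) auto
next
  case (Suc k)
  then obtain v where v: "cword v" "rots u v" "(next_fire ^^ k) (cpile u) = cpile v" by blast
  have "\<exists>y. top_letter (cpile v) y \<and> next_fire (cpile v) = fire y (cpile v)"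
  proof (cases "find (top_letter (cpile v)) ys")
    case None
    then have "top_letter (cpile v) x" using stable_apex[OF v(1)] by (simp add: stable_def)
    then show ?thesis using None by (auto simp: next_fire_def)
  next
    case (Some y)
    then show ?thesis using find_ysD[OF Some] by (auto simp: next_fire_def)
  qed
  then obtain y where y: "top_letter (cpile v) y" "next_fire (cpile v) = fire y (cpile v)" by blast
  from y(1) v(1) obtain c w where "fire y (cpile v) = cpile (w @ [F c])" "rots v (w @ [F c])" "cword (w @ [F c])"
    by (rule top_letter_word)
  then show ?case using y v rots_trans[OF _ v(2)] by (intro exI[of _ "w @ [F c]"]) auto
qed

text \<open>Both words are led to stable states, between which least action leaves only the greedy
  path to follow. From \<open>u\<close> a stable state is reached within \<open>n * length u\<close>
  steps, and from there the target within one period of \<open>2 * length u\<close> steps; hence the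
  factor \<open>n + 2\<close>.\<close>

theorem rots_iff_orbit:
  assumes u: "cword u" and v: "cword v" and m: "n * length v < m" and K: "(n + 2) * length u \<le> K"
  shows "rots u v \<longleftrightarrow> (\<exists>k<K. (next_fire ^^ k) (cpile u) = (next_stab ^^ m) (cpile v))"
proof
  obtain v' where v': "cword v'" "rots v v'" "stable (cpile v')" "(next_stab ^^ m) (cpile v) = cpile v'"
    using stabilize[OF v m] by blast
  assume uv: "rots u v"
  obtain s1 u1 where u1: "legal (cpile u) s1 (cpile u1)" "cword u1" "rots u u1"
    "length s1 \<le> n * length u" "stable (cpile u1)"
    using stabilize[OF u, of "Suc (n * length u)"] by auto
  have l1: "length u1 = length u" using rots_length[OF u1(3)] .
  have "rots u1 v'" using rots_trans[OF v'(2) rots_trans[OF uv rots_sym[OF u1(3)]]] .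
  then obtain s2 where s2: "legal (cpile u1) s2 (cpile v')" using rots_legal u1(2) by blast
  have e1: "cpile u1 = (next_fire ^^ length s1) (cpile u)" by (rule least_action[OF u1(1) u u1(5)])
  have e2: "cpile v' = (next_fire ^^ length s2) (cpile u1)" by (rule least_action[OF s2 u1(2) v'(3)])
  have "cpile u1 = (next_fire ^^ length (map vtx u1 @ map vtx u1)) (cpile u1)"
    by (rule least_action[OF legal_period[OF u1(2)] u1(2,5)])
  then have per: "(next_fire ^^ (2 * length u)) (cpile u1) = cpile u1" using l1 by (simp add: mult_2)
  define r where "r = length s2 mod (2 * length u)"
  have "cpile v' = (next_fire ^^ r) (cpile u1)"
    unfolding r_def using e2 funpow_mod_eq[OF per] by simp
  then have "cpile v' = (next_fire ^^ (r + length s1)) (cpile u)" using e1 by (simp add: funpow_add)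
  moreover have "0 < length u" using u x by (auto simp: cword_def)
  then have "r < 2 * length u" by (simp add: r_def)
  then have "r + length s1 < K" using u1(4) K by (simp add: algebra_simps)
  ultimately show "\<exists>k<K. (next_fire ^^ k) (cpile u) = (next_stab ^^ m) (cpile v)"
    using v'(4) by metis
next
  obtain v' where v': "cword v'" "rots v v'" "(next_stab ^^ m) (cpile v) = cpile v'"
    using stabilize[OF v m] by blast
  assume "\<exists>k<K. (next_fire ^^ k) (cpile u) = (next_stab ^^ m) (cpile v)"
  then obtain k where k: "(next_fire ^^ k) (cpile u) = cpile v'" using v' by auto
  obtain u' where u': "cword u'" "rots u u'" "(next_fire ^^ k) (cpile u) = cpile u'"
    using next_fire_rots[OF u] by blast
  then have "teq u' v'" using cpile_inj v' k by simp
  from rots_trans[OF rots_sym[OF v'(2)] rots_trans_teq[OF u'(2) this]] show "rots u v" .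
qed

end

subsection \<open>Stacks in registers\<close>

primrec tgts :: "com \<Rightarrow> nat set" where
  "tgts Skip = {}"
| "tgts (Assign x e) = {x}"
| "tgts (Read x y) = {x}"
| "tgts (Seq a b) = tgts a \<union> tgts b"
| "tgts (Cond e a b) = tgts a \<union> tgts b"
| "tgts (Loop e c) = tgts c"

lemma sem_frame: "r \<notin> tgts c \<Longrightarrow> sem g c s r = s r"
proof (induction c arbitrary: s)
  case (Loop e c)
  have "(sem g c ^^ m) s r = s r" for m
    by (induction m) (use Loop in auto)
  then show ?case by simp
qed auto

lemma safe_iff_tgts: "safe c \<longleftrightarrow> (\<forall>r\<in>tgts c. 3 \<le> r)"
  by (induction c) auto

definition seqs :: "com list \<Rightarrow> com" where
  "seqs cs = foldr Seq cs Skip"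

lemma seqs_simps [simp]: "seqs [] = Skip" "seqs (c # cs) = Seq c (seqs cs)"
  by (simp_all add: seqs_def)

lemma tgts_seqs [simp]: "tgts (seqs cs) = \<Union> (tgts ` set cs)"
  by (induction cs) auto

lemma loop_free_seqs [simp]: "loop_free (seqs cs) \<longleftrightarrow> (\<forall>c\<in>set cs. loop_free c)"
  by (induction cs) auto

lemma linear_seqs [simp]: "linear (seqs cs) \<longleftrightarrow> (\<forall>c\<in>set cs. linear c)"
  by (induction cs) auto

text \<open>The first entry is the most significant digit. Leading zeros are genuine entries, so the
  number does not determine the length; hence the power of 3 beside it in \<open>stack_at\<close>,
  which is also the place value for pushing at the front.\<close>

definition stack_num :: "int list \<Rightarrow> int" where
  "stack_num l = foldl (\<lambda>x d. 3 * x + d) 0 l"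

abbreviation digits :: "int list \<Rightarrow> bool" where
  "digits l \<equiv> set l \<subseteq> {0, 1, 2}"

lemma stack_num_Nil [simp]: "stack_num [] = 0"
  by (simp add: stack_num_def)

lemma stack_num_snoc [simp]: "stack_num (l @ [d]) = 3 * stack_num l + d"
  by (simp add: stack_num_def)

lemma stack_num_Cons: "stack_num (d # l) = d * 3 ^ length l + stack_num l"
  by (induction l rule: rev_induct) (simp_all add: algebra_simps stack_num_def)

lemma stack_num_bounds: "digits l \<Longrightarrow> 0 \<le> stack_num l \<and> stack_num l < 3 ^ length l"
  by (induction l rule: rev_induct) auto

text \<open>Markers are 0, so a nonzero number means that the vertex itself occurs: the support test
  of the program.\<close>

lemma stack_num_eq_0_iff: "digits l \<Longrightarrow> stack_num l = 0 \<longleftrightarrow> set l \<subseteq> {0}"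
proof (induction l rule: rev_induct)
  case (snoc d l)
  then have "0 \<le> stack_num l" "stack_num l = 0 \<longleftrightarrow> set l \<subseteq> {0}" using stack_num_bounds[of l] by auto
  moreover have "3 * x + d = 0 \<longleftrightarrow> x = 0 \<and> d = 0" if "0 \<le> x" "d \<in> {0, 1, 2}" for x :: int
    using that by (auto, presburger+)
  moreover have "d \<in> {0, 1, 2}" using snoc by auto
  ultimately show ?case by auto
qed simp

lemma stack_num_inj: "digits l \<Longrightarrow> digits m \<Longrightarrow> length l = length m \<Longrightarrow> stack_num l = stack_num m \<Longrightarrow> l = m"
proof (induction l arbitrary: m rule: rev_induct)
  case (snoc d l)
  then obtain e m' where m: "m = m' @ [e]" by (cases m rule: rev_cases) auto
  have "3 * stack_num l + d = 3 * stack_num m' + e" using snoc m by simp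
  moreover have "d \<in> {0, 1, 2}" "e \<in> {0, 1, 2}" using snoc m by auto
  ultimately have "d = e \<and> stack_num l = stack_num m'" by (auto, presburger+)
  then show ?case using snoc m by auto
qed simp

definition stack_at :: "nat \<Rightarrow> int list \<Rightarrow> (nat \<Rightarrow> int) \<Rightarrow> bool" where
  "stack_at r l s \<longleftrightarrow> s r = stack_num l \<and> s (Suc r) = 3 ^ length l \<and> digits l"

text \<open>The remainder modulo 3, for which there is no instruction.\<close>

definition last_exp :: "nat \<Rightarrow> aexp" where
  "last_exp r = Minus (Var r) (Times (Num 3) (Quot (Var r) (Num 3)))"

text \<open>The leading digit, obtained by dividing by its place value. On the empty stack this is
  0, as for \<open>last_exp\<close>, and so is never taken for a sign.\<close>

definition hd_exp :: "nat \<Rightarrow> aexp" where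
  "hd_exp r = Quot (Times (Num 3) (Var r)) (Var (Suc r))"

definition push_last :: "nat \<Rightarrow> aexp \<Rightarrow> com" where
  "push_last r e = Seq (Assign r (Plus (Times (Num 3) (Var r)) e)) (Assign (Suc r) (Times (Num 3) (Var (Suc r))))"

definition push_first :: "nat \<Rightarrow> aexp \<Rightarrow> com" where
  "push_first r e = Seq (Assign r (Plus (Var r) (Times e (Var (Suc r))))) (Assign (Suc r) (Times (Num 3) (Var (Suc r))))"

text \<open>The quotient \<open>(H + 2) div 3\<close> leaves the height code \<open>H = 1\<close> of the empty stack unchanged,
  so that both pop operations do nothing on it.\<close>

definition pop_last :: "nat \<Rightarrow> com" where
  "pop_last r = Seq (Assign r (Quot (Var r) (Num 3))) (Assign (Suc r) (Quot (Plus (Var (Suc r)) (Num 2)) (Num 3)))"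

definition pop_first :: "nat \<Rightarrow> com" where
  "pop_first r = Seq (Assign (Suc r) (Quot (Plus (Var (Suc r)) (Num 2)) (Num 3)))
     (Assign r (Minus (Var r) (Times (Var (Suc r)) (Quot (Var r) (Var (Suc r))))))"

lemmas stack_ops = push_last_def push_first_def pop_last_def pop_first_def

lemma tgts_stack_ops [simp]:
  "tgts (push_last r e) = {r, Suc r}" "tgts (push_first r e) = {r, Suc r}"
  "tgts (pop_last r) = {r, Suc r}" "tgts (pop_first r) = {r, Suc r}"
  by (auto simp: stack_ops)

lemma loop_free_stack_ops [simp]:
  "loop_free (push_last r e)" "loop_free (push_first r e)" "loop_free (pop_last r)" "loop_free (pop_first r)"
  by (auto simp: stack_ops)

lemma last_exp: "stack_at r l s \<Longrightarrow> aval (last_exp r) s = (if l = [] then 0 else last l)"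
proof (cases l rule: rev_cases)
  case (snoc m d)
  assume "stack_at r l s"
  then have "s r = 3 * stack_num m + d" "d \<in> {0, 1, 2}" using snoc by (auto simp: stack_at_def)
  then show ?thesis using snoc by (auto simp: last_exp_def)
qed (simp add: last_exp_def stack_at_def)

lemma hd_exp: "stack_at r l s \<Longrightarrow> aval (hd_exp r) s = (if l = [] then 0 else hd l)"
proof (cases l)
  case (Cons d m)
  assume "stack_at r l s"
  then have s: "s r = d * 3 ^ length m + stack_num m" "s (Suc r) = 3 * 3 ^ length m" "digits m"
    using Cons by (auto simp: stack_at_def stack_num_Cons)
  have b: "0 \<le> stack_num m" "stack_num m < 3 ^ length m" using stack_num_bounds s by auto
  have "(3 * s r) div s (Suc r) = s r div 3 ^ length m" unfolding s(2) by (rule div_mult_mult1) simp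
  also have "\<dots> = d" using s(1) b by simp
  finally show ?thesis using Cons by (simp add: hd_exp_def)
qed (simp add: hd_exp_def stack_at_def)

lemma push_last: "stack_at r l s \<Longrightarrow> d = aval e s \<Longrightarrow> d \<in> {0, 1, 2} \<Longrightarrow> stack_at r (l @ [d]) (sem g (push_last r e) s)"
  by (auto simp: stack_at_def push_last_def)

lemma push_first: "stack_at r l s \<Longrightarrow> d = aval e s \<Longrightarrow> d \<in> {0, 1, 2} \<Longrightarrow> stack_at r (d # l) (sem g (push_first r e) s)"
  by (auto simp: stack_at_def push_first_def stack_num_Cons)

lemma pop_last: "stack_at r l s \<Longrightarrow> stack_at r (butlast l) (sem g (pop_last r) s)"
proof (cases l rule: rev_cases)
  case (snoc m d)
  assume "stack_at r l s"
  then have "s r = 3 * stack_num m + d" "d \<in> {0, 1, 2}" "s (Suc r) = 3 * 3 ^ length m" "digits m"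
    using snoc by (auto simp: stack_at_def)
  then show ?thesis using snoc by (auto simp: stack_at_def pop_last_def)
qed (simp add: stack_at_def pop_last_def)

lemma pop_first: "stack_at r l s \<Longrightarrow> stack_at r (tl l) (sem g (pop_first r) s)"
proof (cases l)
  case (Cons d m)
  assume "stack_at r l s"
  then have s: "s r = d * 3 ^ length m + stack_num m" "s (Suc r) = 3 * 3 ^ length m" "digits m"
    using Cons by (auto simp: stack_at_def stack_num_Cons)
  have b: "0 \<le> stack_num m" "stack_num m < 3 ^ length m" using stack_num_bounds s by auto
  have h: "(s (Suc r) + 2) div 3 = 3 ^ length m" using s(2) by simp
  have "s r div 3 ^ length m = d" using s(1) b by simp
  then show ?thesis using Cons s h by (simp add: stack_at_def pop_first_def)
qed (simp add: stack_at_def pop_first_def)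

lemma stack_at_frame: "stack_at r l s \<Longrightarrow> r \<notin> tgts c \<Longrightarrow> Suc r \<notin> tgts c \<Longrightarrow> stack_at r l (sem g c s)"
  by (simp add: stack_at_def sem_frame)

lemma stack_at_digits: "stack_at r l s \<Longrightarrow> digits l"
  by (simp add: stack_at_def)

lemma stack_at_eq_iff: "stack_at r l s \<Longrightarrow> stack_at q m s \<Longrightarrow> l = m \<longleftrightarrow> s r = s q \<and> s (Suc r) = s (Suc q)"
  using stack_num_inj[of l m] by (auto simp: stack_at_def)

section \<open>Banks of stacks and the multiplication routines\<close>

context raag
begin

definition bank :: "nat \<Rightarrow> nat set" where
  "bank b = {b..<b + 2 * n}"

definition holds :: "nat \<Rightarrow> (nat \<Rightarrow> int list) \<Rightarrow> (nat \<Rightarrow> int) \<Rightarrow> bool" where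
  "holds b P s \<longleftrightarrow> (\<forall>v<n. stack_at (b + 2 * v) (P v) s)"

lemma in_bank: "v < n \<Longrightarrow> b + 2 * v \<in> bank b \<and> Suc (b + 2 * v) \<in> bank b"
  by (auto simp: bank_def)

lemma holds_frame: "holds b P s \<Longrightarrow> bank b \<inter> tgts c = {} \<Longrightarrow> holds b P (sem g c s)"
  unfolding holds_def using stack_at_frame in_bank by (metis disjoint_iff)

lemma holds_cong: "holds b P s \<Longrightarrow> (\<And>r. r \<in> bank b \<Longrightarrow> s' r = s r) \<Longrightarrow> holds b P s'"
  unfolding holds_def stack_at_def using in_bank by metis

text \<open>Each command writes to one stack only, so running the commands in sequence amounts to a
  simultaneous update. They may depend on registers outside the bank, and the condition on
  \<open>s'\<close> says that those keep their values.\<close>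

lemma holds_seqs:
  assumes "holds b P s" "distinct vs" "set vs \<subseteq> {..<n}"
    "\<And>v s' l. v \<in> set vs \<Longrightarrow> (\<And>r. r \<notin> bank b \<Longrightarrow> s' r = s r) \<Longrightarrow> stack_at (b + 2 * v) l s' \<Longrightarrow>
      stack_at (b + 2 * v) (f v l) (sem g (c v) s')"
    "\<And>v. v \<in> set vs \<Longrightarrow> tgts (c v) \<subseteq> {b + 2 * v, Suc (b + 2 * v)}"
  shows "holds b (\<lambda>v. if v \<in> set vs then f v (P v) else P v) (sem g (seqs (map c vs)) s)"
  using assms
proof (induction vs arbitrary: P s)
  case (Cons v vs)
  let ?s = "sem g (c v) s" and ?P = "P(v := f v (P v))"
  have v: "v < n" "v \<notin> set vs" using Cons.prems by auto
  have tv: "tgts (c v) \<subseteq> {b + 2 * v, Suc (b + 2 * v)}" using Cons.prems(5) by simp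
  have fr: "?s r = s r" if "r \<notin> bank b" for r
    using sem_frame[of r "c v"] tv in_bank[OF v(1)] that by blast
  have "holds b ?P ?s"
    unfolding holds_def
  proof (intro allI impI)
    fix w assume w: "w < n"
    show "stack_at (b + 2 * w) (?P w) ?s"
    proof (cases "w = v")
      case True
      then show ?thesis using Cons.prems(4)[of v s "P v"] Cons.prems(1) v by (auto simp: holds_def)
    next
      case False
      have "b + 2 * w \<noteq> Suc (b + 2 * v)" "Suc (b + 2 * w) \<noteq> b + 2 * v" by presburger+
      then have "b + 2 * w \<notin> tgts (c v)" "Suc (b + 2 * w) \<notin> tgts (c v)" using tv False by auto
      then show ?thesis using stack_at_frame Cons.prems(1) w False by (simp add: holds_def)
    qed
  qed
  then have "holds b (\<lambda>w. if w \<in> set vs then f w (?P w) else ?P w) (sem g (seqs (map c vs)) ?s)"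
  proof (rule Cons.IH)
    fix w s' l
    assume "w \<in> set vs" "\<And>r. r \<notin> bank b \<Longrightarrow> s' r = ?s r" "stack_at (b + 2 * w) l s'"
    then show "stack_at (b + 2 * w) (f w l) (sem g (c w) s')"
      using fr by (intro Cons.prems(4)) auto
  qed (use Cons.prems in auto)
  moreover have "(\<lambda>w. if w \<in> set vs then f w (?P w) else ?P w) = (\<lambda>w. if w \<in> set (v # vs) then f w (P w) else P w)"
    using v by (auto simp: fun_eq_iff)
  ultimately show ?case by simp
qed simp

definition deps :: "nat \<Rightarrow> nat list" where
  "deps y = filter (\<lambda>z. \<not> E y z) [0..<n]"

lemma deps: "distinct (deps y)" "set (deps y) \<subseteq> {..<n}" "z < n \<Longrightarrow> z \<in> set (deps y) \<longleftrightarrow> \<not> E y z"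
  by (auto simp: deps_def)

lemma holds_peq: "holds b P s \<Longrightarrow> (\<And>v. v < n \<Longrightarrow> Q v = P v) \<Longrightarrow> holds b Q s"
  by (simp add: holds_def)

definition rmul_com :: "nat \<Rightarrow> int \<Rightarrow> com" where
  "rmul_com b a = Cond (Minus (last_exp (b + 2 * vtx a)) (Num (3 - digit a)))
     (seqs (map (\<lambda>z. push_last (b + 2 * z) (Num (if vtx a = z then digit a else 0))) (deps (vtx a))))
     (seqs (map (\<lambda>z. pop_last (b + 2 * z)) (deps (vtx a))))"

definition lmul_com :: "nat \<Rightarrow> int \<Rightarrow> com" where
  "lmul_com b a = Cond (Minus (hd_exp (b + 2 * vtx a)) (Num (3 - digit a)))
     (seqs (map (\<lambda>z. push_first (b + 2 * z) (Num (if vtx a = z then digit a else 0))) (deps (vtx a))))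
     (seqs (map (\<lambda>z. pop_first (b + 2 * z)) (deps (vtx a))))"

lemma tgts_deps: "z \<in> set (deps y) \<Longrightarrow> {b + 2 * z, Suc (b + 2 * z)} \<subseteq> bank b"
  using deps(2)[of y] in_bank by auto

lemma tgts_mul_com: "tgts (rmul_com b a) \<subseteq> bank b" "tgts (lmul_com b a) \<subseteq> bank b"
  using tgts_deps by (fastforce simp: rmul_com_def lmul_com_def)+

lemma loop_free_mul_com [simp]: "loop_free (rmul_com b a)" "loop_free (lmul_com b a)"
  by (auto simp: rmul_com_def lmul_com_def)

lemma digit_cases: "digit a \<in> {1, 2}"
  by (simp add: digit_def)

lemma rmul_com:
  assumes "holds b P s" "vtx a < n"
  shows "holds b (rmul a P) (sem g (rmul_com b a) s)"
proof -
  have t: "aval (last_exp (b + 2 * vtx a)) s = 3 - digit a \<longleftrightarrow> P (vtx a) \<noteq> [] \<and> last (P (vtx a)) = 3 - digit a"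
    using last_exp[of "b + 2 * vtx a" "P (vtx a)" s] assms digit_cases[of a] by (auto simp: holds_def)
  have push: "holds b (\<lambda>z. if z \<in> set (deps (vtx a)) then P z @ [if vtx a = z then digit a else 0] else P z)
     (sem g (seqs (map (\<lambda>z. push_last (b + 2 * z) (Num (if vtx a = z then digit a else 0))) (deps (vtx a)))) s)"
    using assms(1) deps(1,2)
    by (rule holds_seqs[where f = "\<lambda>z l. l @ [if vtx a = z then digit a else 0]"])
      (auto intro!: push_last simp: digit_def)
  have pop: "holds b (\<lambda>z. if z \<in> set (deps (vtx a)) then butlast (P z) else P z)
     (sem g (seqs (map (\<lambda>z. pop_last (b + 2 * z)) (deps (vtx a)))) s)"
    using assms(1) deps(1,2) by (rule holds_seqs[where f = "\<lambda>z l. butlast l"]) (auto intro!: pop_last)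
  show ?thesis
  proof (cases "P (vtx a) \<noteq> [] \<and> last (P (vtx a)) = 3 - digit a")
    case True
    then show ?thesis using t holds_peq[OF pop, of "rmul a P"] by (simp add: rmul_com_def rmul_def deps)
  next
    case False
    then have "rmul a P = (\<lambda>v. if E (vtx a) v then P v else P v @ [if vtx a = v then digit a else 0])"
      by (simp only: rmul_def if_False)
    moreover have "aval (Minus (last_exp (b + 2 * vtx a)) (Num (3 - digit a))) s \<noteq> 0" using t False by simp
    ultimately show ?thesis using holds_peq[OF push, of "rmul a P"] by (simp add: rmul_com_def deps del: aval.simps)
  qed
qed

lemma lmul_com:
  assumes "holds b P s" "vtx a < n"
  shows "holds b (lmul a P) (sem g (lmul_com b a) s)"
proof -
  have t: "aval (hd_exp (b + 2 * vtx a)) s = 3 - digit a \<longleftrightarrow> P (vtx a) \<noteq> [] \<and> hd (P (vtx a)) = 3 - digit a"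
    using hd_exp[of "b + 2 * vtx a" "P (vtx a)" s] assms digit_cases[of a] by (auto simp: holds_def)
  have push: "holds b (\<lambda>z. if z \<in> set (deps (vtx a)) then (if vtx a = z then digit a else 0) # P z else P z)
     (sem g (seqs (map (\<lambda>z. push_first (b + 2 * z) (Num (if vtx a = z then digit a else 0))) (deps (vtx a)))) s)"
    using assms(1) deps(1,2)
    by (rule holds_seqs[where f = "\<lambda>z l. (if vtx a = z then digit a else 0) # l"])
      (auto intro!: push_first simp: digit_def)
  have pop: "holds b (\<lambda>z. if z \<in> set (deps (vtx a)) then tl (P z) else P z)
     (sem g (seqs (map (\<lambda>z. pop_first (b + 2 * z)) (deps (vtx a)))) s)"
    using assms(1) deps(1,2) by (rule holds_seqs[where f = "\<lambda>z l. tl l"]) (auto intro!: pop_first)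
  show ?thesis
  proof (cases "P (vtx a) \<noteq> [] \<and> hd (P (vtx a)) = 3 - digit a")
    case True
    then show ?thesis using t holds_peq[OF pop, of "lmul a P"] by (simp add: lmul_com_def lmul_def deps)
  next
    case False
    then have "lmul a P = (\<lambda>v. if E (vtx a) v then P v else (if vtx a = v then digit a else 0) # P v)"
      by (simp only: lmul_def if_False)
    moreover have "aval (Minus (hd_exp (b + 2 * vtx a)) (Num (3 - digit a))) s \<noteq> 0" using t False by simp
    ultimately show ?thesis using holds_peq[OF push, of "lmul a P"] by (simp add: lmul_com_def deps del: aval.simps)
  qed
qed

text \<open>Register 5 holds the current letter, register 4 the input position, and register 6 tells
  whether the separator has been read. Registers from 20 on are the four banks of stacks.\<close>

definition letters :: "int list" where
  "letters = map (\<lambda>v. int v + 1) [0..<n] @ map (\<lambda>v. - (int v + 1)) [0..<n]"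

lemma letters: "set letters = {a. valid_letter n a}" "distinct letters"
proof -
  have "a \<in> set letters" if "valid_letter n a" for a
  proof (cases "a > 0")
    case True
    then have "a = int (nat (a - 1)) + 1" "nat (a - 1) < n" using that by (auto simp: valid_letter_def)
    then show ?thesis unfolding letters_def set_append set_map
      by (intro UnI1 image_eqI[of _ _ "nat (a - 1)"]) auto
  next
    case False
    then have "a = - (int (nat (- a - 1)) + 1)" "nat (- a - 1) < n" using that by (auto simp: valid_letter_def)
    then show ?thesis unfolding letters_def set_append set_map
      by (intro UnI2 image_eqI[of _ _ "nat (- a - 1)"]) auto
  qed
  then show "set letters = {a. valid_letter n a}" by (auto simp: letters_def valid_letter_def)
  show "distinct letters" by (auto simp: letters_def distinct_map inj_on_def)
qed

text \<open>A letter known at run time selects code specialised to it. The tests are made one after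
  another; at most one succeeds as long as no branch changes register 5.\<close>

definition switch :: "(int \<Rightarrow> com) \<Rightarrow> com" where
  "switch c = seqs (map (\<lambda>a. Cond (Minus (Var 5) (Num a)) Skip (c a)) letters)"

lemma sem_switch:
  assumes "\<And>a. 5 \<notin> tgts (c a)"
  shows "sem g (switch c) s = (if valid_letter n (s 5) then sem g (c (s 5)) s else s)"
proof -
  have "sem g (seqs (map (\<lambda>a. Cond (Minus (Var 5) (Num a)) Skip (c a)) ls)) s
    = (if s 5 \<in> set ls then sem g (c (s 5)) s else s)" if "distinct ls" for ls s
    using that
  proof (induction ls arbitrary: s)
    case (Cons a ls)
    have "sem g (c a) s 5 = s 5" using sem_frame assms by blast
    then show ?case using Cons by auto
  qed simp
  from this[OF letters(2)] show ?thesis by (simp add: switch_def letters(1))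
qed

lemma tgts_switch: "tgts (switch c) \<subseteq> (\<Union>a. tgts (c a))"
  by (auto simp: switch_def)

lemma loop_free_switch [simp]: "(\<And>a. loop_free (c a)) \<Longrightarrow> loop_free (switch c)"
  by (auto simp: switch_def)

abbreviation "b0 \<equiv> 20"
abbreviation "b1 \<equiv> 20 + 2 * n"
abbreviation "b2 \<equiv> 20 + 4 * n"
abbreviation "b3 \<equiv> 20 + 6 * n"

lemma banks_low [simp]: "r < 20 \<Longrightarrow> r \<notin> bank b0" "r < 20 \<Longrightarrow> r \<notin> bank b1"
  "r < 20 \<Longrightarrow> r \<notin> bank b2" "r < 20 \<Longrightarrow> r \<notin> bank b3"
  by (auto simp: bank_def)

lemma banks_disjoint [simp]:
  "bank b0 \<inter> bank b1 = {}" "bank b0 \<inter> bank b2 = {}" "bank b0 \<inter> bank b3 = {}"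
  "bank b1 \<inter> bank b0 = {}" "bank b1 \<inter> bank b2 = {}" "bank b1 \<inter> bank b3 = {}"
  "bank b2 \<inter> bank b0 = {}" "bank b2 \<inter> bank b1 = {}" "bank b2 \<inter> bank b3 = {}"
  "bank b3 \<inter> bank b0 = {}" "bank b3 \<inter> bank b1 = {}" "bank b3 \<inter> bank b2 = {}"
  by (auto simp: bank_def)

lemma banks_disjointD:
  "r \<in> bank b0 \<Longrightarrow> r \<notin> bank b1" "r \<in> bank b0 \<Longrightarrow> r \<notin> bank b2" "r \<in> bank b0 \<Longrightarrow> r \<notin> bank b3"
  "r \<in> bank b1 \<Longrightarrow> r \<notin> bank b0" "r \<in> bank b1 \<Longrightarrow> r \<notin> bank b2" "r \<in> bank b1 \<Longrightarrow> r \<notin> bank b3"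
  "r \<in> bank b2 \<Longrightarrow> r \<notin> bank b0" "r \<in> bank b2 \<Longrightarrow> r \<notin> bank b1" "r \<in> bank b2 \<Longrightarrow> r \<notin> bank b3"
  "r \<in> bank b3 \<Longrightarrow> r \<notin> bank b0" "r \<in> bank b3 \<Longrightarrow> r \<notin> bank b1" "r \<in> bank b3 \<Longrightarrow> r \<notin> bank b2"
  by (auto simp: bank_def)

definition clear :: "nat \<Rightarrow> com" where
  "clear b = seqs (map (\<lambda>z. Seq (Assign (b + 2 * z) (Num 0)) (Assign (Suc (b + 2 * z)) (Num 1))) [0..<n])"

lemma tgts_clear: "tgts (clear b) \<subseteq> bank b"
  by (auto simp: clear_def bank_def)

lemma loop_free_clear [simp]: "loop_free (clear b)"
  by (auto simp: clear_def)

lemma clear_aux: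
  assumes "distinct vs"
  shows "\<forall>v\<in>set vs. stack_at (b + 2 * v) [] (sem g (seqs (map (\<lambda>z. Seq (Assign (b + 2 * z) (Num 0)) (Assign (Suc (b + 2 * z)) (Num 1))) vs)) s)"
  using assms
proof (induction vs arbitrary: s)
  case (Cons v vs)
  let ?c = "\<lambda>z. Seq (Assign (b + 2 * z) (Num 0)) (Assign (Suc (b + 2 * z)) (Num 1))"
  have "stack_at (b + 2 * v) [] (sem g (?c v) s)" by (simp add: stack_at_def)
  moreover have "b + 2 * v \<notin> tgts (seqs (map ?c vs))" "Suc (b + 2 * v) \<notin> tgts (seqs (map ?c vs))"
    using Cons.prems by (auto, presburger+)
  ultimately have "stack_at (b + 2 * v) [] (sem g (seqs (map ?c vs)) (sem g (?c v) s))"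
    by (rule stack_at_frame)
  then show ?case using Cons by simp
qed simp

lemma clear: "holds b (\<lambda>_. []) (sem g (clear b) s)"
  using clear_aux[of "[0..<n]" b] by (simp add: holds_def clear_def)

definition read_body :: com where
  "read_body = Seq (Assign 4 (Plus (Var 4) (Num 1))) (Seq (Read 5 4)
     (Cond (Var 5) (Cond (Var 6) (switch (rmul_com b1)) (switch (rmul_com b0))) (Assign 6 (Num 1))))"

definition read_com :: com where
  "read_com = Seq (Assign 4 (Num 0)) (Seq (Assign 6 (Num 0)) (Seq (clear b0) (Seq (clear b1) (Loop (Var 2) read_body))))"

lemma tgts_read_body: "tgts read_body \<subseteq> {4, 5, 6} \<union> bank b0 \<union> bank b1"
  using tgts_switch[of "rmul_com b0"] tgts_switch[of "rmul_com b1"] tgts_mul_com(1)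
  unfolding read_body_def by simp blast

lemma tgts_read_com: "tgts read_com \<subseteq> {4, 5, 6} \<union> bank b0 \<union> bank b1"
  using tgts_read_body tgts_clear by (auto simp: read_com_def)

lemma linear_read_com [simp]: "linear read_com"
  by (simp add: read_com_def read_body_def)

lemma switch_rmul:
  assumes "holds b P s" "valid_letter n (s 5)" "5 \<notin> bank b"
  shows "holds b (rmul (s 5) P) (sem g (switch (rmul_com b)) s)"
proof -
  have "5 \<notin> tgts (rmul_com b a)" for a using tgts_mul_com(1)[of b a] assms(3) by blast
  then show ?thesis using sem_switch[of "rmul_com b" g s] rmul_com[OF assms(1)] assms(2) vtx_less by simp
qed

lemma read_com:
  assumes uv: "valid u" "valid v" and len: "s 2 = int (length (encode_pair u v))"
    and g: "\<forall>i<length (encode_pair u v). g (int i + 1) = encode_pair u v ! i"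
  shows "holds b0 (nfp u) (sem g read_com s)" "holds b1 (nfp v) (sem g read_com s)"
proof -
  let ?inp = "encode_pair u v"
  have L: "length ?inp = Suc (length u + length v)" by (simp add: encode_pair_def)
  let ?s0 = "sem g (Seq (Assign 4 (Num 0)) (Seq (Assign 6 (Num 0)) (Seq (clear b0) (clear b1)))) s"
  \<comment> \<open>By truncated subtraction the prefix of \<open>v\<close> stays empty until the
    separator, at position \<open>length u\<close>, has been passed.\<close>
  define I where "I k t \<longleftrightarrow> t 4 = int k \<and> t 6 = (if k \<le> length u then 0 else 1) \<and>
    holds b0 (nfp (take k u)) t \<and> holds b1 (nfp (take (k - Suc (length u)) v)) t" for k and t :: "nat \<Rightarrow> int"
  have low: "sem g (clear b) t r = t r" if "r \<notin> bank b" for b t r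
    using sem_frame[of r "clear b"] tgts_clear[of b] that by blast
  have I0: "I 0 ?s0"
  proof -
    have d: "bank b0 \<inter> tgts (clear b1) = {}" using tgts_clear[of b1] banks_disjoint by blast
    show ?thesis unfolding I_def
      using low[of 4 b0] low[of 4 b1] low[of 6 b0] low[of 6 b1] holds_frame[OF clear d] clear
      by (simp add: nfp_def)
  qed
  have step: "I (Suc k) (sem g read_body t)" if I: "I k t" and k: "k < length ?inp" for k t
  proof -
    let ?t = "t(4 := int k + 1, 5 := ?inp ! k)"
    have h: "holds b0 (nfp (take k u)) ?t" "holds b1 (nfp (take (k - Suc (length u)) v)) ?t"
      using I unfolding I_def by (auto elim!: holds_cong)
    have t6: "?t 6 = (if k \<le> length u then 0 else 1)" using I by (simp add: I_def)
    have e: "sem g read_body t = sem g (Cond (Var 5) (Cond (Var 6) (switch (rmul_com b1)) (switch (rmul_com b0))) (Assign 6 (Num 1))) ?t"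
      using I g k by (simp add: read_body_def I_def)
    have fr0: "sem g (switch (rmul_com b0)) ?t r = ?t r" if "r \<notin> bank b0" for r
      using sem_frame tgts_switch[of "rmul_com b0"] tgts_mul_com(1)[of b0] that by blast
    have fr1: "sem g (switch (rmul_com b1)) ?t r = ?t r" if "r \<notin> bank b1" for r
      using sem_frame tgts_switch[of "rmul_com b1"] tgts_mul_com(1)[of b1] that by blast
    consider "k < length u" | "k = length u" | "length u < k" by linarith
    then show ?thesis
    proof cases
      case 1
      then have a: "?inp ! k = u ! k" by (simp add: encode_pair_def nth_append)
      have va: "valid_letter n (u ! k)" using uv 1 by (auto simp: valid_word_def)
      then have a0: "u ! k \<noteq> 0" by (rule valid_letter_nonzero)
      have tk: "take (Suc k) u = take k u @ [u ! k]" using 1 by (simp add: take_Suc_conv_app_nth)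
      have "holds b0 (rmul (u ! k) (nfp (take k u))) (sem g (switch (rmul_com b0)) ?t)"
        using switch_rmul[OF h(1)] va a by simp
      moreover have "holds b1 (nfp (take (k - Suc (length u)) v)) (sem g (switch (rmul_com b0)) ?t)"
        by (rule holds_cong[OF h(2)]) (rule fr0[OF banks_disjointD(4)])
      ultimately show ?thesis using e a a0 1 t6 fr0[of 4] fr0[of 6]
        by (simp add: I_def tk nfp_snoc)
    next
      case 2
      then have a: "?inp ! k = 0" by (simp add: encode_pair_def nth_append)
      have "holds b0 (nfp u) (?t(6 := 1))" "holds b1 (nfp []) (?t(6 := 1))"
        using h 2 by (auto elim!: holds_cong)
      then show ?thesis using e a 2 by (simp add: I_def)
    next
      case 3
      define j where "j = k - Suc (length u)"
      have j: "j < length v" "k = Suc (length u) + j" using 3 k L by (auto simp: j_def)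
      then have a: "?inp ! k = v ! j" by (simp add: encode_pair_def nth_append)
      have va: "valid_letter n (v ! j)" using uv j by (auto simp: valid_word_def)
      then have a0: "v ! j \<noteq> 0" by (rule valid_letter_nonzero)
      have tk: "take (Suc j) v = take j v @ [v ! j]" using j by (simp add: take_Suc_conv_app_nth)
      have "holds b1 (rmul (v ! j) (nfp (take j v))) (sem g (switch (rmul_com b1)) ?t)"
        using switch_rmul[OF h(2)] va a by (simp add: j_def)
      moreover have "holds b0 (nfp u) (sem g (switch (rmul_com b1)) ?t)"
      proof (rule holds_cong)
        show "holds b0 (nfp u) ?t" using h(1) 3 by simp
      qed (rule fr1[OF banks_disjointD(1)])
      moreover have "Suc k - Suc (length u) = Suc j" using j by simp
      ultimately show ?thesis using e a a0 3 t6 fr1[of 4] fr1[of 6]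
        by (simp add: I_def tk nfp_snoc)
    qed
  qed
  have "I k ((sem g read_body ^^ k) ?s0)" if "k \<le> length ?inp" for k
    using that by (induction k) (use I0 step in auto)
  from this[of "length ?inp"] have "I (length ?inp) ((sem g read_body ^^ length ?inp) ?s0)" by simp
  moreover have "sem g read_com s = (sem g read_body ^^ length ?inp) ?s0"
  proof -
    have "2 \<notin> tgts (Seq (Assign 4 (Num 0)) (Seq (Assign 6 (Num 0)) (Seq (clear b0) (clear b1))))"
      using tgts_clear[of b0] tgts_clear[of b1] by auto
    then have "?s0 2 = s 2" by (rule sem_frame)
    then show ?thesis using len by (simp add: read_com_def)
  qed
  ultimately show "holds b0 (nfp u) (sem g read_com s)" "holds b1 (nfp v) (sem g read_com s)"
    using L by (auto simp: I_def)
qed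

end

subsection \<open>The exhaustive search\<close>

context raag
begin

lemma holds_upd [intro]: "holds b P s \<Longrightarrow> r \<notin> bank b \<Longrightarrow> holds b P (s(r := k))"
  by (rule holds_cong[of b P s]) auto

lemma not_tgts: "tgts c \<subseteq> A \<Longrightarrow> r \<notin> A \<Longrightarrow> r \<notin> tgts c"
  by blast

lemma tgts_repeat: "tgts (seqs (replicate k c)) \<subseteq> tgts c"
  by auto

text \<open>Clearing the target first leaves empty stacks outside \<open>zs\<close>, in agreement
  with \<open>cpile\<close>.\<close>

definition copy :: "nat \<Rightarrow> nat \<Rightarrow> nat list \<Rightarrow> com" where
  "copy b b' zs = Seq (clear b') (seqs (map (\<lambda>z. Seq (Assign (b' + 2 * z) (Var (b + 2 * z)))
     (Assign (Suc (b' + 2 * z)) (Var (Suc (b + 2 * z))))) zs))"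

lemma tgts_copy: "set zs \<subseteq> {..<n} \<Longrightarrow> tgts (copy b b' zs) \<subseteq> bank b'"
  using tgts_clear[of b'] in_bank by (fastforce simp: copy_def)

lemma loop_free_copy [simp]: "loop_free (copy b b' zs)"
  by (auto simp: copy_def)

lemma copy:
  assumes "holds b P s" "bank b \<inter> bank b' = {}" "distinct zs" "set zs \<subseteq> {..<n}"
  shows "holds b' (\<lambda>z. if z \<in> set zs then P z else []) (sem g (copy b b' zs) s)"
proof -
  let ?s = "sem g (clear b') s"
  have h: "holds b P ?s" using assms(1,2) tgts_clear[of b'] by (intro holds_frame) auto
  have "holds b' (\<lambda>z. if z \<in> set zs then P z else [])
    (sem g (seqs (map (\<lambda>z. Seq (Assign (b' + 2 * z) (Var (b + 2 * z)))
     (Assign (Suc (b' + 2 * z)) (Var (Suc (b + 2 * z))))) zs)) ?s)"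
  proof (rule holds_seqs[where f = "\<lambda>z l. P z", OF clear assms(3,4)])
    fix v s' l
    assume v: "v \<in> set zs" and s': "\<And>r. r \<notin> bank b' \<Longrightarrow> s' r = ?s r"
    have vn: "v < n" using v assms(4) by auto
    have nb: "b + 2 * v \<notin> bank b'" "Suc (b + 2 * v) \<notin> bank b'" "b' + 2 * v \<in> bank b'"
      using in_bank[OF vn] assms(2) by blast+
    have "stack_at (b + 2 * v) (P v) s'"
      using h vn s'[OF nb(1)] s'[OF nb(2)] by (simp add: holds_def stack_at_def)
    moreover have "Suc (b + 2 * v) \<noteq> b' + 2 * v" using nb by metis
    ultimately show "stack_at (b' + 2 * v) (P v) (sem g (Seq (Assign (b' + 2 * v) (Var (b + 2 * v)))
      (Assign (Suc (b' + 2 * v)) (Var (Suc (b + 2 * v))))) s')"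
      by (simp add: stack_at_def)
  qed auto
  then show ?thesis by (simp add: copy_def)
qed

definition eq_com :: "nat \<Rightarrow> nat \<Rightarrow> com" where
  "eq_com b b' = Seq (Assign 8 (Num 1)) (seqs (map (\<lambda>z.
     Cond (Minus (Var (b + 2 * z)) (Var (b' + 2 * z))) (Assign 8 (Num 0))
      (Cond (Minus (Var (Suc (b + 2 * z))) (Var (Suc (b' + 2 * z)))) (Assign 8 (Num 0)) Skip)) [0..<n]))"

lemma tgts_eq_com: "tgts (eq_com b b') \<subseteq> {8}"
  by (auto simp: eq_com_def)

lemma loop_free_eq_com [simp]: "loop_free (eq_com b b')"
  by (auto simp: eq_com_def)

lemma eq_com:
  assumes "holds b P s" "holds b' Q s" "8 \<notin> bank b" "8 \<notin> bank b'"
  shows "sem g (eq_com b b') s 8 = (if \<forall>z<n. P z = Q z then 1 else 0)"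
proof -
  let ?c = "\<lambda>z. Cond (Minus (Var (b + 2 * z)) (Var (b' + 2 * z))) (Assign 8 (Num 0))
      (Cond (Minus (Var (Suc (b + 2 * z))) (Var (Suc (b' + 2 * z)))) (Assign 8 (Num 0)) Skip)"
  have "sem g (seqs (map ?c zs)) s 8 = (if \<forall>z\<in>set zs. P z = Q z then s 8 else 0)"
    if "set zs \<subseteq> {..<n}" "holds b P s" "holds b' Q s" for zs s
    using that
  proof (induction zs arbitrary: s)
    case (Cons z zs)
    have z: "z < n" using Cons.prems by simp
    have ne: "8 \<noteq> b + 2 * z" "8 \<noteq> Suc (b + 2 * z)" "8 \<noteq> b' + 2 * z" "8 \<noteq> Suc (b' + 2 * z)"
      using in_bank[OF z] assms(3,4) by metis+
    have "P z = Q z \<longleftrightarrow> s (b + 2 * z) = s (b' + 2 * z) \<and> s (Suc (b + 2 * z)) = s (Suc (b' + 2 * z))"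
      using Cons.prems z by (intro stack_at_eq_iff) (auto simp: holds_def)
    then have t: "sem g (?c z) s = (if P z = Q z then s else s(8 := 0))" (is "_ = ?t") by auto
    have "holds b P ?t" "holds b' Q ?t" using Cons.prems assms(3,4) by auto
    then have "sem g (seqs (map ?c zs)) ?t 8 = (if \<forall>z\<in>set zs. P z = Q z then ?t 8 else 0)"
      using Cons by (intro Cons.IH) auto
    then have "sem g (seqs (map ?c (z # zs))) s 8 = (if \<forall>z\<in>set zs. P z = Q z then ?t 8 else 0)"
      unfolding list.map seqs_simps sem.simps(4) t .
    then show ?case by auto
  qed simp
  moreover have "set [0..<n] \<subseteq> {..<n}" by auto
  ultimately have "sem g (seqs (map ?c [0..<n])) (s(8 := 1)) 8 =
    (if \<forall>z\<in>set [0..<n]. P z = Q z then (s(8 := 1)) 8 else 0)"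
    using holds_upd[OF assms(1,3)] holds_upd[OF assms(2,4)] by blast
  then show ?thesis by (simp add: eq_com_def)
qed

lemma vtx_valid_word: "valid w \<Longrightarrow> vtx ` set w \<subseteq> {..<n}"
proof (induction w)
  case (Cons a w)
  then show ?case using vtx_less[of n a] by simp
qed simp

text \<open>Only the stacks below \<open>n\<close> are stored; they decide equality because no other
  vertex occurs in a valid word.\<close>

lemma nfp_eq_iff:
  assumes "valid u" "valid v"
  shows "(\<forall>z<n. nfp u z = nfp v z) \<longleftrightarrow> geq u v"
proof
  assume *: "\<forall>z<n. nfp u z = nfp v z"
  obtain r s where r: "valid r" "geq u r" "nfp u = pile r" and s: "valid s" "geq v s" "nfp v = pile s"
    using nfp_red[OF assms(1)] nfp_red[OF assms(2)] by blast
  have "teq r s" using r s * vtx_valid_word by (intro pile_inj_on[of _ _ "{..<n}"]) auto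
  then have "geq r s" using teq_geq r(1) by blast
  from geq_trans[OF geq_trans[OF r(2) this] geq_sym[OF s(2)]] show "geq u v" .
next
  assume "geq u v"
  then show "\<forall>z<n. nfp u z = nfp v z" using geq_nfp assms by simp
qed

end

context twist
begin

definition conj_com :: "int \<Rightarrow> com" where
  "conj_com a = Seq (rmul_com b2 a) (lmul_com b2 (- F a))"

text \<open>Words of length at most \<open>B\<close> are coded by the numbers below \<open>(2 * n + 1) ^ B\<close>; the
  digit \<open>n\<close> stands for the absence of a letter.\<close>

primrec decode :: "int \<Rightarrow> nat \<Rightarrow> int list" where
  "decode c 0 = []"
| "decode c (Suc B) = (if c mod (2 * int n + 1) = int n then [] else [c mod (2 * int n + 1) - int n])
     @ decode (c div (2 * int n + 1)) B"

lemma digit_letter: "valid_letter n (c mod (2 * int n + 1) - int n) \<longleftrightarrow> c mod (2 * int n + 1) \<noteq> int n"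
proof -
  have "0 \<le> c mod (2 * int n + 1)" by simp
  moreover have "c mod (2 * int n + 1) < 2 * int n + 1" by (rule pos_mod_bound) simp
  ultimately show ?thesis unfolding valid_letter_def by linarith
qed

lemma valid_decode: "valid (decode c B)"
  by (induction B arbitrary: c) (auto simp: digit_letter)

lemma decode_surj:
  assumes "valid w" "length w \<le> B"
  shows "\<exists>c. 0 \<le> c \<and> c < (2 * int n + 1) ^ B \<and> decode c B = w"
  using assms
proof (induction B arbitrary: w)
  case (Suc B)
  have ext: "\<exists>c. 0 \<le> c \<and> c < (2 * int n + 1) ^ Suc B \<and>
      decode c (Suc B) = (if d = int n then [] else [d - int n]) @ w'"
    if t: "valid w'" "length w' \<le> B" "0 \<le> d" "d < 2 * int n + 1" for w' d
  proof -
    obtain c where c: "0 \<le> c" "c < (2 * int n + 1) ^ B" "decode c B = w'"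
      using Suc.IH[OF t(1,2)] by blast
    let ?K = "2 * int n + 1"
    have "(d + ?K * c) mod ?K = d"
      using mod_pos_pos_trivial[OF t(3,4)] by (simp only: mod_mult_self2)
    moreover have "(d + ?K * c) div ?K = c"
      using div_pos_pos_trivial[OF t(3,4)] div_mult_self2[of ?K d c] by simp
    moreover have "c + 1 \<le> ?K ^ B" using c by simp
    then have "?K * (c + 1) \<le> ?K * ?K ^ B" by (rule mult_left_mono) simp
    then have "d + ?K * c < ?K ^ Suc B" using t by (simp add: algebra_simps)
    moreover have "0 \<le> d + ?K * c" using t c by simp
    ultimately show ?thesis using c by (intro exI[of _ "d + ?K * c"]) auto
  qed
  show ?case
  proof (cases w)
    case Nil
    then show ?thesis using ext[of "[]" "int n"] by simp
  next
    case (Cons a w')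
    then have "a \<noteq> 0" "- int n \<le> a" "a \<le> int n" using Suc.prems by (auto simp: valid_letter_def)
    then show ?thesis using ext[of w' "a + int n"] Suc.prems Cons by auto
  qed
qed (intro exI[of _ 0], simp)

text \<open>The lowest digit of the code in register 13 becomes the current letter. The digit
  \<open>n\<close> yields 0, which is not a letter, so that \<open>switch\<close> does
  nothing.\<close>

definition conj_step :: com where
  "conj_step = Seq (Assign 5 (Minus (Minus (Var 13) (Times (Num (2 * int n + 1)) (Quot (Var 13) (Num (2 * int n + 1))))) (Num (int n))))
     (Seq (Assign 13 (Quot (Var 13) (Num (2 * int n + 1)))) (switch conj_com))"

lemma tgts_conj_com: "tgts (conj_com a) \<subseteq> bank b2"
  using tgts_mul_com(1)[of b2 a] tgts_mul_com(2)[of b2 "- F a"] by (simp add: conj_com_def)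

lemma tgts_switch_conj: "tgts (switch conj_com) \<subseteq> bank b2"
  using tgts_switch[of conj_com] tgts_conj_com by blast

lemma tgts_conj_step: "tgts conj_step \<subseteq> {5, 13} \<union> bank b2"
  using tgts_switch_conj by (auto simp: conj_step_def)

lemma conj_com:
  assumes "holds b2 (nfp x) s" "valid x" "valid_letter n a"
  shows "holds b2 (nfp (- F a # x @ [a])) (sem g (conj_com a) s)"
proof -
  have "vtx a < n" "vtx (- F a) < n" using assms(3) vtx_less[of n "F a"] vtx_less by auto
  from lmul_com[OF rmul_com[OF assms(1) this(1)] this(2)]
  show ?thesis using assms by (simp add: conj_com_def nfp_snoc nfp_Cons)
qed

lemma conj_steps:
  assumes "holds b2 (nfp x) s" "valid x" "s 13 = c"
  shows "holds b2 (nfp (inv_word (map F (decode c B)) @ x @ decode c B)) ((sem g conj_step ^^ B) s)"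
  using assms
proof (induction B arbitrary: x s c)
  case (Suc B)
  let ?K = "2 * int n + 1"
  let ?d = "c mod ?K - int n"
  define t where "t = s(5 := ?d, 13 := c div ?K)"
  have t: "t 5 = ?d" "t 13 = c div ?K" by (simp_all add: t_def)
  have md: "c - ?K * (c div ?K) = c mod ?K" by (simp add: minus_mult_div_eq_mod)
  have e: "sem g conj_step s = sem g (switch conj_com) t"
    using Suc.prems(3) md by (simp add: conj_step_def t_def)
  have h: "holds b2 (nfp x) t" unfolding t_def using Suc.prems(1) by (intro holds_upd) auto
  have n5: "5 \<notin> tgts (conj_com a)" for a using tgts_conj_com[of a] banks_low by fastforce
  let ?x = "if c mod ?K = int n then x else - F ?d # x @ [?d]"
  have "sem g (switch conj_com) t = (if c mod ?K = int n then t else sem g (conj_com ?d) t)"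
    unfolding sem_switch[OF n5] t digit_letter by simp
  then have "holds b2 (nfp ?x) (sem g (switch conj_com) t)"
    using conj_com[OF h Suc.prems(2)] h digit_letter[of c] by simp
  moreover have "valid ?x" using Suc.prems(2) digit_letter[of c] by simp
  moreover have "sem g (switch conj_com) t 13 = c div ?K"
    using sem_frame[OF not_tgts[OF tgts_switch_conj]] t by simp
  ultimately have "holds b2 (nfp (inv_word (map F (decode (c div ?K) B)) @ ?x @ decode (c div ?K) B))
    ((sem g conj_step ^^ B) (sem g conj_step s))"
    unfolding e by (intro Suc.IH) auto
  note H = this
  have eqw: "inv_word (map F (decode c (Suc B))) @ x @ decode c (Suc B) =
    inv_word (map F (decode (c div ?K) B)) @ ?x @ decode (c div ?K) B"
    by (simp del: inv_word_map_F)
  show ?case unfolding eqw funpow_Suc_right o_apply by (rule H)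
qed simp

definition search_body :: com where
  "search_body = Seq (copy b0 b2 [0..<n]) (Seq (Assign 13 (Var 12)) (Seq (Loop (Var 10) conj_step)
     (Seq (eq_com b2 b1) (Seq (Cond (Var 8) (Assign 3 (Num 1)) Skip) (Assign 12 (Plus (Var 12) (Num 1)))))))"

text \<open>For an input of length \<open>L\<close>, register 9 becomes
  \<open>(2 * n + 2) ^ (n * L)\<close>, register 10 \<open>word_bound L\<close> and register 11 the
  number of codes of words of that length. \<open>L\<close> includes the separator and so exceeds
  the sum of the two word lengths.\<close>

definition search_com :: com where
  "search_com = Seq read_com (Seq (Assign 9 (Num 1))
     (Seq (Loop (Times (Num (int n)) (Var 2)) (Assign 9 (Times (Num (2 * int n + 2)) (Var 9))))
     (Seq (Assign 10 (Times (Num (int n)) (Times (Var 9) (Var 9))))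
     (Seq (Assign 11 (Num 1)) (Seq (Loop (Var 10) (Assign 11 (Times (Num (2 * int n + 1)) (Var 11))))
     (Seq (Assign 12 (Num 0)) (Seq (Assign 3 (Num 0)) (Loop (Var 11) search_body))))))))"

lemma safe_search_com: "safe search_com"
proof -
  have "tgts (copy b0 b2 [0..<n]) \<subseteq> bank b2" by (rule tgts_copy) auto
  then have "tgts search_com \<subseteq> {3, 4, 5, 6, 8, 9, 10, 11, 12, 13} \<union> bank b0 \<union> bank b1 \<union> bank b2"
    using tgts_read_com tgts_conj_step tgts_eq_com[of b2 b1]
    unfolding search_com_def search_body_def tgts.simps by blast
  moreover have "3 \<le> r" if "r \<in> {3, 4, 5, 6, 8, 9, 10, 11, 12, 13} \<union> bank b0 \<union> bank b1 \<union> bank b2" for r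
    using that by (auto simp: bank_def)
  ultimately show ?thesis unfolding safe_iff_tgts by blast
qed

lemma power_loop: "(sem g (Assign r (Times (Num k) (Var r))) ^^ m) s = s(r := k ^ m * s r)"
  by (induction m) auto

lemma search_com:
  assumes uv: "valid u" "valid v" and len: "s 2 = int (length (encode_pair u v))"
    and g: "\<forall>i<length (encode_pair u v). g (int i + 1) = encode_pair u v ! i"
  shows "sem g search_com s 3 = (if tw u v then 1 else 0)"
proof -
  define L where "L = length (encode_pair u v)"
  define B where "B = word_bound L"
  define s1 where "s1 = sem g read_com s"
  have h1: "holds b0 (nfp u) s1" "holds b1 (nfp v) s1"
    using read_com[of u v s g, OF uv len g] by (simp_all add: s1_def)
  have "2 \<notin> tgts read_com" using tgts_read_com banks_low(1)[of 2] banks_low(2)[of 2] by auto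
  then have L1: "s1 2 = int L" using len sem_frame by (simp add: s1_def L_def)
  define s2 where "s2 = s1(9 := (2 * int n + 2) ^ (n * L), 10 := int B, 11 := (2 * int n + 1) ^ B, 12 := 0, 3 := 0)"
  have "int n * ((2 * int n + 2) ^ (n * L) * (2 * int n + 2) ^ (n * L)) = int B"
    by (simp add: B_def word_bound_def add.commute)
  moreover have "nat (int n * int L) = n * L" by (simp flip: of_nat_mult)
  ultimately have e: "sem g search_com s = (sem g search_body ^^ nat ((2 * int n + 1) ^ B)) s2"
    using L1 by (simp add: search_com_def s2_def power_loop s1_def[symmetric] fun_upd_twist)
  define good where "good c \<longleftrightarrow> geq (inv_word (map F (decode (int c) B)) @ u @ decode (int c) B) v" for c :: nat
  define I where "I k t \<longleftrightarrow> t 12 = int k \<and> t 10 = int B \<and> t 3 = (if \<exists>c<k. good c then 1 else 0) \<and>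
    holds b0 (nfp u) t \<and> holds b1 (nfp v) t" for k :: nat and t
  have I0: "I 0 s2" using h1 unfolding I_def s2_def by (auto elim!: holds_cong)
  have step: "I (Suc k) (sem g search_body t)" if I: "I k t" for k t
  proof -
    let ?t1 = "(sem g (copy b0 b2 [0..<n]) t)(13 := int k)"
    define t2 where "t2 = (sem g conj_step ^^ B) ?t1"
    define t3 where "t3 = sem g (eq_com b2 b1) t2"
    have tc: "tgts (copy b0 b2 [0..<n]) \<subseteq> bank b2" by (rule tgts_copy) auto
    have c: "sem g (copy b0 b2 [0..<n]) t r = t r" if "r \<notin> bank b2" for r
      using sem_frame tc that by blast
    have f2: "t2 r = t r" if "r \<notin> bank b2" "r \<noteq> 5" "r \<noteq> 13" for r
    proof -
      have "r \<notin> tgts (Loop (Num (int B)) conj_step)" using tgts_conj_step that by auto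
      from sem_frame[OF this, of g ?t1] show ?thesis using c that by (simp add: t2_def)
    qed
    have f3: "t3 r = t r" if "r \<notin> bank b2" "r \<noteq> 5" "r \<noteq> 13" "r \<noteq> 8" for r
      using sem_frame[of r "eq_com b2 b1" g t2] tgts_eq_com[of b2 b1] f2 that by (auto simp: t3_def)
    have e: "sem g search_body t = (if t3 8 \<noteq> 0 then t3(3 := 1) else t3)(12 := t3 12 + 1)"
    proof -
      have "t 12 = int k" "t 10 = int B" using I by (auto simp: I_def)
      then show ?thesis using c[of 12] c[of 10]
        by (simp add: search_body_def t3_def t2_def)
    qed
    have "holds b2 (\<lambda>z. if z \<in> set [0..<n] then nfp u z else []) (sem g (copy b0 b2 [0..<n]) t)"
      using I by (intro copy) (auto simp: I_def)
    then have "holds b2 (nfp u) (sem g (copy b0 b2 [0..<n]) t)" by (rule holds_peq) simp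
    then have "holds b2 (nfp u) ?t1" by (auto elim!: holds_cong)
    then have h2: "holds b2 (nfp (inv_word (map F (decode (int k) B)) @ u @ decode (int k) B)) t2"
      unfolding t2_def by (rule conj_steps) (use uv in auto)
    have h2': "holds b1 (nfp v) t2"
    proof (rule holds_cong[of b1 _ t])
      show "holds b1 (nfp v) t" using I by (simp add: I_def)
      fix r assume r: "r \<in> bank b1"
      then have "r \<noteq> 5" "r \<noteq> 13" using banks_low(2)[of 5] banks_low(2)[of 13] by auto
      then show "t2 r = t r" using f2 banks_disjointD(5)[OF r] by blast
    qed
    have "t3 8 = (if good k then 1 else 0)"
      unfolding t3_def good_def
      using eq_com[OF h2 h2'] nfp_eq_iff[of "inv_word (map F (decode (int k) B)) @ u @ decode (int k) B" v] uv valid_decode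
      by simp
    moreover have "holds b0 (nfp u) t3"
    proof (rule holds_cong[of b0 _ t])
      show "holds b0 (nfp u) t" using I by (simp add: I_def)
      fix r assume r: "r \<in> bank b0"
      then have "r \<noteq> 5" "r \<noteq> 13" "r \<noteq> 8" using banks_low(1)[of 5] banks_low(1)[of 13] banks_low(1)[of 8] by auto
      then show "t3 r = t r" using f3 banks_disjointD(2)[OF r] by blast
    qed
    moreover have "holds b1 (nfp v) t3"
    proof (rule holds_cong[OF h2'])
      fix r assume r: "r \<in> bank b1"
      then have "r \<noteq> 8" using banks_low(2)[of 8] by auto
      then show "t3 r = t2 r" using sem_frame[of r "eq_com b2 b1" g t2] tgts_eq_com[of b2 b1] by (auto simp: t3_def)
    qed
    ultimately show ?thesis
      unfolding e using I f3[of 12] f3[of 10] f3[of 3]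
      by (auto simp: I_def less_Suc_eq elim!: holds_cong)
  qed
  have "I k ((sem g search_body ^^ k) s2)" for k by (induction k) (use I0 step in auto)
  then have "sem g search_com s 3 = (if \<exists>c<nat ((2 * int n + 1) ^ B). good c then 1 else 0)"
    unfolding e by (simp add: I_def)
  moreover have "(\<exists>c<nat ((2 * int n + 1) ^ B). good c) \<longleftrightarrow> tw u v"
  proof
    assume "\<exists>c<nat ((2 * int n + 1) ^ B). good c"
    then show "tw u v" unfolding good_def tw_def using valid_decode geq_sym by blast
  next
    assume "tw u v"
    then obtain w where w: "valid w" "length w \<le> B" "geq v (inv_word (map F w) @ u @ w)"
      using tw_bounded[OF uv, of L] by (auto simp: B_def L_def encode_pair_def)
    obtain c where c: "0 \<le> c" "c < (2 * int n + 1) ^ B" "decode c B = w" using decode_surj[OF w(1,2)] by blast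
    then have "good (nat c)" using geq_sym[OF w(3)] by (simp add: good_def)
    moreover have "nat c < nat ((2 * int n + 1) ^ B)" using c by simp
    ultimately show "\<exists>c<nat ((2 * int n + 1) ^ B). good c" by blast
  qed
  ultimately show ?thesis by simp
qed

end

subsection \<open>The linear time program\<close>

context inversion_twist
begin

definition flip_exp :: "nat \<Rightarrow> aexp \<Rightarrow> aexp" where
  "flip_exp y e = (if F (int y + 1) = int y + 1 then e else Minus (Num 3) e)"

lemma flip_exp: "aval (flip_exp y e) s = flip y (aval e s)"
  by (simp add: flip_exp_def flip_def)

text \<open>The quotient by 4 tests for at least two entries: among the powers of 3 exactly 1 and 3
  give 0.\<close>

definition strip_com :: "nat \<Rightarrow> nat \<Rightarrow> com" where
  "strip_com b y = Cond (Quot (Var (Suc (b + 2 * y))) (Num 4)) (Cond (hd_exp (b + 2 * y))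
     (Cond (Minus (last_exp (b + 2 * y)) (Minus (Num 3) (flip_exp y (hd_exp (b + 2 * y))))) Skip
       (seqs (map (\<lambda>z. Seq (pop_first (b + 2 * z)) (pop_last (b + 2 * z))) (deps y)))) Skip) Skip"

definition reduce_com :: "nat \<Rightarrow> com" where
  "reduce_com b = Loop (Var 2) (seqs (map (strip_com b) [0..<n]))"

lemma tgts_strip_com: "tgts (strip_com b y) \<subseteq> bank b"
  using tgts_deps by (fastforce simp: strip_com_def)

lemma tgts_reduce_com: "tgts (reduce_com b) \<subseteq> bank b"
  using tgts_strip_com by (auto simp: reduce_com_def)

lemma linear_reduce_com [simp]: "linear (reduce_com b)"
  by (auto simp: reduce_com_def strip_com_def)

lemma strip_com:
  assumes "holds b P s" "y < n"
  shows "holds b (strip_if y P) (sem g (strip_com b y) s)"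
proof -
  have st: "stack_at (b + 2 * y) (P y) s" using assms by (simp add: holds_def)
  let ?c = "seqs (map (\<lambda>z. Seq (pop_first (b + 2 * z)) (pop_last (b + 2 * z))) (deps y))"
  have len: "s (Suc (b + 2 * y)) div 4 \<noteq> 0 \<longleftrightarrow> 2 \<le> length (P y)"
  proof -
    have "s (Suc (b + 2 * y)) = 3 ^ length (P y)" using st by (simp add: stack_at_def)
    moreover have "(3::int) ^ m div 4 \<noteq> 0" if "2 \<le> m" for m
    proof -
      have "(3::int) ^ 2 \<le> 3 ^ m" using that by (intro power_increasing) auto
      then have "(4::int) \<le> 3 ^ m" by simp
      then show ?thesis using zdiv_mono1[of 4 "3 ^ m" 4] by simp
    qed
    moreover have "(3::int) ^ m div 4 = 0" if "\<not> 2 \<le> m" for m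
    proof -
      have "m = 0 \<or> m = 1" using that by linarith
      then show ?thesis by auto
    qed
    ultimately show ?thesis by metis
  qed
  have r: "redu y P \<longleftrightarrow> s (Suc (b + 2 * y)) div 4 \<noteq> 0 \<and> aval (hd_exp (b + 2 * y)) s \<noteq> 0 \<and>
      aval (last_exp (b + 2 * y)) s = 3 - flip y (aval (hd_exp (b + 2 * y)) s)"
    unfolding len hd_exp[OF st] last_exp[OF st] by (auto simp: redu_def)
  have e: "sem g (strip_com b y) s = (if redu y P then sem g ?c s else s)"
    unfolding r by (auto simp: strip_com_def flip_exp)
  have "holds b (\<lambda>z. if z \<in> set (deps y) then butlast (tl (P z)) else P z) (sem g ?c s)"
    using assms(1) deps(1,2)
  proof (rule holds_seqs[where f = "\<lambda>z l. butlast (tl l)"])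
    fix v s' l assume "stack_at (b + 2 * v) l s'"
    from pop_last[OF pop_first[OF this]]
    show "stack_at (b + 2 * v) (butlast (tl l)) (sem g (Seq (pop_first (b + 2 * v)) (pop_last (b + 2 * v))) s')"
      by simp
  qed auto
  then have "holds b (strip y P) (sem g ?c s)" by (rule holds_peq) (simp add: strip_def deps)
  then show ?thesis using e assms(1) by (simp add: strip_if_def)
qed

lemma reduce_com:
  assumes "holds b P s" "s 2 = int L" "2 \<notin> bank b"
  shows "holds b ((fold strip_if [0..<n] ^^ L) P) (sem g (reduce_com b) s)"
proof -
  have pass: "holds b (fold strip_if ys P) (sem g (seqs (map (strip_com b) ys)) s)"
    if "holds b P s" "set ys \<subseteq> {..<n}" for P s ys
    using that by (induction ys arbitrary: P s) (use strip_com in auto)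
  have "holds b ((fold strip_if [0..<n] ^^ m) P) ((sem g (seqs (map (strip_com b) [0..<n])) ^^ m) s)" for m
  proof (induction m)
    case (Suc m)
    have "set [0..<n] \<subseteq> {..<n}" by auto
    from pass[OF Suc this] show ?case by simp
  qed (use assms(1) in simp)
  then show ?thesis using assms(2) by (simp add: reduce_com_def)
qed

lemma stack_num_supp:
  assumes "holds b (pile p) s" "y < n"
  shows "s (b + 2 * y) \<noteq> 0 \<longleftrightarrow> y \<in> supp p"
proof -
  have "stack_at (b + 2 * y) (pile p y) s" using assms by (simp add: holds_def)
  then have "s (b + 2 * y) = 0 \<longleftrightarrow> set (pile p y) \<subseteq> {0}"
    using stack_num_eq_0_iff by (simp add: stack_at_def)
  also have "\<dots> \<longleftrightarrow> y \<notin> supp p"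
  proof
    assume *: "set (pile p y) \<subseteq> {0}"
    have "digit a \<in> set (pile p y)" if "a \<in> set p" "vtx a = y" for a
      using that unfolding pile_def set_map by (intro image_eqI[of _ _ a]) auto
    then show "y \<notin> supp p" using * by fastforce
  qed (auto simp: pile_def)
  finally show ?thesis by blast
qed

definition supp_com :: com where
  "supp_com = seqs (map (\<lambda>y. Cond (Var (b0 + 2 * y)) (Cond (Var (b1 + 2 * y)) Skip (Assign 3 (Num 0)))
     (Cond (Var (b1 + 2 * y)) (Assign 3 (Num 0)) Skip)) [0..<n])"

lemma tgts_supp_com: "tgts supp_com \<subseteq> {3}"
  by (auto simp: supp_com_def)

lemma loop_free_supp_com [simp]: "loop_free supp_com"
  by (auto simp: supp_com_def)

lemma supp_com:
  assumes "holds b0 (pile p) s" "holds b1 (pile q) s" "valid p" "valid q"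
  shows "sem g supp_com s 3 = (if supp p = supp q then s 3 else 0)"
proof -
  let ?c = "\<lambda>y. Cond (Var (b0 + 2 * y)) (Cond (Var (b1 + 2 * y)) Skip (Assign 3 (Num 0)))
     (Cond (Var (b1 + 2 * y)) (Assign 3 (Num 0)) Skip)"
  have "sem g (seqs (map ?c ys)) s 3 = (if \<forall>y\<in>set ys. y \<in> supp p \<longleftrightarrow> y \<in> supp q then s 3 else 0)"
    if "set ys \<subseteq> {..<n}" "holds b0 (pile p) s" "holds b1 (pile q) s" for ys s
    using that
  proof (induction ys arbitrary: s)
    case (Cons y ys)
    have y: "y < n" using Cons.prems by simp
    have e: "sem g (?c y) s = (if y \<in> supp p \<longleftrightarrow> y \<in> supp q then s else s(3 := 0))" (is "_ = ?t")
      using stack_num_supp[OF Cons.prems(2) y] stack_num_supp[OF Cons.prems(3) y] by auto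
    have "holds b0 (pile p) (s(3 := 0))" "holds b1 (pile q) (s(3 := 0))"
      using Cons.prems by (auto intro!: holds_upd simp del: fun_upd_apply)
    then have "holds b0 (pile p) ?t" "holds b1 (pile q) ?t" using Cons.prems by simp_all
    then have "sem g (seqs (map ?c ys)) ?t 3 =
      (if \<forall>y\<in>set ys. y \<in> supp p \<longleftrightarrow> y \<in> supp q then ?t 3 else 0)"
      using Cons.prems by (intro Cons.IH) auto
    then have "sem g (seqs (map ?c (y # ys))) s 3 =
      (if \<forall>y\<in>set ys. y \<in> supp p \<longleftrightarrow> y \<in> supp q then ?t 3 else 0)"
      unfolding list.map seqs_simps sem.simps(4) e .
    then show ?case by auto
  qed simp
  moreover have "set [0..<n] \<subseteq> {..<n}" by auto
  ultimately have "sem g (seqs (map ?c [0..<n])) s 3 = (if \<forall>y\<in>set [0..<n]. y \<in> supp p \<longleftrightarrow> y \<in> supp q then s 3 else 0)"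
    using assms(1,2) by blast
  then have "sem g supp_com s 3 = (if \<forall>y<n. y \<in> supp p \<longleftrightarrow> y \<in> supp q then s 3 else 0)"
    by (auto simp: supp_com_def)
  moreover have "(\<forall>y<n. y \<in> supp p \<longleftrightarrow> y \<in> supp q) \<longleftrightarrow> supp p = supp q"
  proof -
    show ?thesis using vtx_valid_word[OF assms(3)] vtx_valid_word[OF assms(4)] by blast
  qed
  ultimately show ?thesis by simp
qed

fun guard :: "(nat \<times> bool) list \<Rightarrow> com \<Rightarrow> com" where
  "guard [] c = c"
| "guard ((r, nz) # cs) c = (if nz then Cond (Var r) (guard cs c) Skip else Cond (Var r) Skip (guard cs c))"

lemma sem_guard: "sem g (guard cs c) s = (if \<forall>(r, nz)\<in>set cs. s r \<noteq> 0 \<longleftrightarrow> nz then sem g c s else s)"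
  by (induction cs c rule: guard.induct) auto

lemma tgts_guard [simp]: "tgts (guard cs c) = tgts c"
  by (induction cs c rule: guard.induct) auto

lemma linear_guard [simp]: "linear (guard cs c) = linear c"
  by (induction cs c rule: guard.induct) auto

text \<open>A \<open>linear\<close> program may only loop as often as register 2 says; multiples of
  this number are obtained by writing the loop several times in a row.\<close>

lemma sem_repeat:
  assumes "2 \<notin> tgts c" "s 2 = int L"
  shows "sem g (seqs (replicate m (Loop (Var 2) c))) s = (sem g c ^^ (m * L)) s"
  using assms(2)
proof (induction m arbitrary: s)
  case (Suc m)
  have "2 \<notin> tgts (Loop (Num (int L)) c)" using assms(1) by simp
  from sem_frame[OF this, of g s] have "(sem g c ^^ L) s 2 = int L" using Suc.prems by simp
  then have "sem g (seqs (replicate (Suc m) (Loop (Var 2) c))) s = (sem g c ^^ (m * L)) ((sem g c ^^ L) s)"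
    using Suc by simp
  also have "\<dots> = (sem g c ^^ (m * L + L)) s" by (simp add: funpow_add)
  finally show ?case by (simp add: add.commute)
qed simp

end

section \<open>Comparing two words on one component\<close>

context component
begin

text \<open>Register 9 saves the new sign before popping destroys the old one.\<close>

definition fire_com :: "nat \<Rightarrow> nat \<Rightarrow> com" where
  "fire_com b y = Seq (Assign 9 (flip_exp y (hd_exp (b + 2 * y))))
     (seqs (map (\<lambda>z. Seq (pop_first (b + 2 * z)) (push_last (b + 2 * z) (if z = y then Var 9 else Num 0)))
       (filter (\<lambda>z. z \<in> C) (deps y))))"

text \<open>Nested alternatives in the order of \<open>ys\<close>, which is the order in which
  \<open>find\<close> searches.\<close>

definition next_com :: "nat \<Rightarrow> com \<Rightarrow> com" where
  "next_com b c = foldr (\<lambda>y c. Cond (hd_exp (b + 2 * y)) (fire_com b y) c) ys c"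

lemma tgts_fire_com: "tgts (fire_com b y) \<subseteq> insert 9 (bank b)"
  using tgts_deps[of _ y b] by (fastforce simp: fire_com_def)

lemma tgts_next_com: "tgts (next_com b c) \<subseteq> insert 9 (bank b) \<union> tgts c"
proof -
  have "tgts (foldr (\<lambda>y c. Cond (hd_exp (b + 2 * y)) (fire_com b y) c) zs c) \<subseteq> insert 9 (bank b) \<union> tgts c" for zs
    by (induction zs) (use tgts_fire_com in auto)
  then show ?thesis by (simp add: next_com_def)
qed

lemma loop_free_fire_com [simp]: "loop_free (fire_com b y)"
  by (auto simp: fire_com_def)

lemma loop_free_next_com [simp]: "loop_free c \<Longrightarrow> loop_free (next_com b c)"
proof -
  assume "loop_free c"
  then have "loop_free (foldr (\<lambda>y c. Cond (hd_exp (b + 2 * y)) (fire_com b y) c) zs c)" for zs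
    by (induction zs) auto
  then show ?thesis by (simp add: next_com_def)
qed

lemma hd_exp_top: "holds b P s \<Longrightarrow> y < n \<Longrightarrow> aval (hd_exp (b + 2 * y)) s \<noteq> 0 \<longleftrightarrow> top_letter P y"
  using hd_exp[of "b + 2 * y" "P y" s] by (auto simp: holds_def top_letter_def)

lemma fire_com:
  assumes "holds b P s" "top_letter P y" "y < n" "9 \<notin> bank b"
  shows "holds b (fire y P) (sem g (fire_com b y) s)"
proof -
  have st: "stack_at (b + 2 * y) (P y) s" using assms by (simp add: holds_def)
  let ?d = "flip y (hd (P y))"
  have e: "aval (flip_exp y (hd_exp (b + 2 * y))) s = ?d"
    using assms(2) by (simp add: flip_exp hd_exp[OF st] top_letter_def)
  have "hd (P y) \<in> {0, 1, 2}" using stack_at_digits[OF st] assms(2) hd_in_set by (auto simp: top_letter_def)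
  then have d: "?d \<in> {0, 1, 2}" using assms(2) by (auto simp: flip_def top_letter_def)
  have "holds b P (s(9 := ?d))" using assms(1,4) by (auto elim!: holds_cong)
  then have "holds b (\<lambda>z. if z \<in> set (filter (\<lambda>z. z \<in> C) (deps y)) then tl (P z) @ [if z = y then ?d else 0] else P z)
    (sem g (seqs (map (\<lambda>z. Seq (pop_first (b + 2 * z)) (push_last (b + 2 * z) (if z = y then Var 9 else Num 0)))
       (filter (\<lambda>z. z \<in> C) (deps y)))) (s(9 := ?d)))"
  proof (rule holds_seqs[where f = "\<lambda>z l. tl l @ [if z = y then ?d else 0]"])
    fix v s' l
    assume v: "v \<in> set (filter (\<lambda>z. z \<in> C) (deps y))" and s': "\<And>r. r \<notin> bank b \<Longrightarrow> s' r = (s(9 := ?d)) r"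
      and l: "stack_at (b + 2 * v) l s'"
    have "v < n" using v deps(2) by auto
    then have "9 \<notin> tgts (pop_first (b + 2 * v))" using in_bank[of v b] assms(4) by auto
    then have "sem g (pop_first (b + 2 * v)) s' 9 = ?d" using sem_frame s'[OF assms(4)] by simp
    then have "stack_at (b + 2 * v) (tl l @ [if v = y then ?d else 0])
      (sem g (push_last (b + 2 * v) (if v = y then Var 9 else Num 0)) (sem g (pop_first (b + 2 * v)) s'))"
      using d by (intro push_last[OF pop_first[OF l]]) auto
    then show "stack_at (b + 2 * v) (tl l @ [if v = y then ?d else 0])
      (sem g (Seq (pop_first (b + 2 * v)) (push_last (b + 2 * v) (if v = y then Var 9 else Num 0))) s')" by simp
  qed (auto simp: deps_def)
  then show ?thesis
    using e by (auto simp: fire_com_def fire_def deps intro: holds_peq)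
qed

lemma next_com:
  assumes "holds b P s" "9 \<notin> bank b"
  shows "find (top_letter P) ys = None \<Longrightarrow> sem g (next_com b c) s = sem g c s"
    and "find (top_letter P) ys = Some y \<Longrightarrow> holds b (fire y P) (sem g (next_com b c) s)"
proof -
  have ysn: "set ys \<subseteq> {..<n}" using ys C_less by auto
  have "(find (top_letter P) zs = None \<longrightarrow> sem g (foldr (\<lambda>y c. Cond (hd_exp (b + 2 * y)) (fire_com b y) c) zs c) s = sem g c s) \<and>
    (find (top_letter P) zs = Some y \<longrightarrow> holds b (fire y P) (sem g (foldr (\<lambda>y c. Cond (hd_exp (b + 2 * y)) (fire_com b y) c) zs c) s))"
    if "set zs \<subseteq> {..<n}" for zs
    using that by (induction zs) (use hd_exp_top[OF assms(1)] fire_com[OF assms(1) _ _ assms(2)] in auto)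
  from this[OF ysn] show "find (top_letter P) ys = None \<Longrightarrow> sem g (next_com b c) s = sem g c s"
    "find (top_letter P) ys = Some y \<Longrightarrow> holds b (fire y P) (sem g (next_com b c) s)"
    by (auto simp: next_com_def)
qed

lemma next_stab_com:
  assumes "holds b P s" "9 \<notin> bank b"
  shows "holds b (next_stab P) (sem g (next_com b Skip) s)"
  using next_com[OF assms, where g = g and c = Skip] assms(1) by (cases "find (top_letter P) ys") (auto simp: next_stab_def)

lemma next_fire_com:
  assumes "holds b P s" "9 \<notin> bank b" "stable P \<Longrightarrow> top_letter P x"
  shows "holds b (next_fire P) (sem g (next_com b (fire_com b x)) s)"
proof (cases "find (top_letter P) ys")
  case None
  then have "top_letter P x" using assms(3) by (simp add: stable_def)
  moreover have "x < n" using x C_less by auto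
  ultimately have "holds b (fire x P) (sem g (fire_com b x) s)" using fire_com[OF assms(1) _ _ assms(2)] by blast
  then show ?thesis using None next_com(1)[OF assms(1,2) None] by (simp add: next_fire_def)
next
  case (Some y)
  then show ?thesis using next_com(2)[OF assms(1,2) Some] by (simp add: next_fire_def)
qed

definition orbit_body :: com where
  "orbit_body = Seq (eq_com b2 b3) (Seq (Cond (Var 8) (Assign 7 (Num 1)) Skip) (next_com b2 (fire_com b2 x)))"

text \<open>The guard expresses \<open>closed_in\<close>: all of \<open>C\<close> occurs, and no
  vertex outside \<open>C\<close> that fails to commute with a member of \<open>C\<close> does. Then
  a copy of the second word is stabilised, and along the orbit of the first each state is compared
  with it; register 7 remembers a hit. The numbers \<open>n + 1\<close> and \<open>n + 2\<close> of
  repetitions meet the bounds of \<open>rots_iff_orbit\<close> when the input length exceeds both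
  word lengths.\<close>

definition block_com :: com where
  "block_com = guard (map (\<lambda>y. (b0 + 2 * y, True)) (filter (\<lambda>y. y \<in> C) [0..<n]) @
       map (\<lambda>z. (b0 + 2 * z, False)) (filter (\<lambda>z. z \<notin> C \<and> (\<exists>y\<in>C. \<not> E y z)) [0..<n]))
     (Seq (copy b0 b2 (filter (\<lambda>y. y \<in> C) [0..<n])) (Seq (copy b1 b3 (filter (\<lambda>y. y \<in> C) [0..<n]))
     (Seq (seqs (replicate (n + 1) (Loop (Var 2) (next_com b3 Skip)))) (Seq (Assign 7 (Num 0))
     (Seq (seqs (replicate (n + 2) (Loop (Var 2) orbit_body))) (Cond (Var 7) Skip (Assign 3 (Num 0))))))))"

lemma tgts_orbit_body: "tgts orbit_body \<subseteq> {7, 8, 9} \<union> bank b2"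
  using tgts_eq_com[of b2 b3] tgts_next_com[of b2 "fire_com b2 x"] tgts_fire_com[of b2 x]
  by (auto simp: orbit_body_def)

lemma tgts_block_com: "tgts block_com \<subseteq> {3, 7, 8, 9} \<union> bank b2 \<union> bank b3"
proof -
  have "set (filter (\<lambda>y. y \<in> C) [0..<n]) \<subseteq> {..<n}" by auto
  from tgts_copy[OF this] have "tgts (copy b b' (filter (\<lambda>y. y \<in> C) [0..<n])) \<subseteq> bank b'" for b b' .
  from this[of b0 b2] this[of b1 b3] tgts_orbit_body tgts_next_com[of b3 Skip]
    tgts_repeat[of "n + 1" "Loop (Var 2) (next_com b3 Skip)"] tgts_repeat[of "n + 2" "Loop (Var 2) orbit_body"]
  show ?thesis unfolding block_com_def tgts_guard tgts.simps by blast
qed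

lemma linear_block_com: "linear block_com"
  by (simp add: block_com_def orbit_body_def)

text \<open>This holds from every state, so a negative answer found earlier, for instance by unequal
  supports, survives blocks that are run on unsuitable data.\<close>

lemma block_com_zero: "sem g block_com s 3 = s 3 \<or> sem g block_com s 3 = 0"
proof -
  let ?zs = "filter (\<lambda>y. y \<in> C) [0..<n]"
  let ?c = "Seq (copy b0 b2 ?zs) (Seq (copy b1 b3 ?zs)
     (Seq (seqs (replicate (n + 1) (Loop (Var 2) (next_com b3 Skip)))) (Seq (Assign 7 (Num 0))
     (seqs (replicate (n + 2) (Loop (Var 2) orbit_body))))))"
  have "set ?zs \<subseteq> {..<n}" by auto
  from tgts_copy[OF this] have "tgts (copy b b' ?zs) \<subseteq> bank b'" for b b' .
  from this[of b0 b2] this[of b1 b3] tgts_orbit_body tgts_next_com[of b3 Skip]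
    tgts_repeat[of "n + 1" "Loop (Var 2) (next_com b3 Skip)"] tgts_repeat[of "n + 2" "Loop (Var 2) orbit_body"]
  have "tgts ?c \<subseteq> {7, 8, 9} \<union> bank b2 \<union> bank b3" unfolding tgts.simps by blast
  then have "3 \<notin> tgts ?c" by (rule not_tgts) simp
  from sem_frame[OF this, of g s] have "sem g ?c s 3 = s 3" .
  moreover obtain t where t: "t = sem g ?c s" by blast
  ultimately have t3: "t 3 = s 3" by simp
  have "sem g block_com s = s \<or> sem g block_com s = t \<or> sem g block_com s = t(3 := 0)"
    unfolding block_com_def sem_guard t by (simp only: sem.simps aval.simps) presburger
  then show ?thesis using t3 by auto
qed

lemma block_com:
  assumes h: "holds b0 (pile p) s" "holds b1 (pile q) s" and v: "valid p" "valid q"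
    and S: "supp p = supp q" and L: "s 2 = int L" "length p < L" "length q < L"
  shows "sem g block_com s 3 = (if closed_in C (supp p) \<and> \<not> rots (res C p) (res C q) then 0 else s 3)"
proof -
  let ?zs = "filter (\<lambda>y. y \<in> C) [0..<n]"
  let ?cs = "map (\<lambda>y. (b0 + 2 * y, True)) ?zs @
       map (\<lambda>z. (b0 + 2 * z, False)) (filter (\<lambda>z. z \<notin> C \<and> (\<exists>y\<in>C. \<not> E y z)) [0..<n])"
  have zs1: "set ?zs = C" using C_less unfolding set_filter set_upt atLeast0LessThan by blast
  have zs2: "set ?zs \<subseteq> {..<n}" unfolding zs1 by (rule C_less)
  have zs3: "distinct ?zs" by simp
  note zs = zs1 zs3 zs2
  have Sn: "supp p \<subseteq> {..<n}" by (rule vtx_valid_word[OF v(1)])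
  have gd: "(\<forall>(r, nz)\<in>set ?cs. s r \<noteq> 0 \<longleftrightarrow> nz) \<longleftrightarrow> closed_in C (supp p)"
  proof -
    have nz: "s (b0 + 2 * y) \<noteq> 0 \<longleftrightarrow> y \<in> supp p" if "y < n" for y
      by (rule stack_num_supp[OF h(1) that])
    have nzC: "s (b0 + 2 * y) \<noteq> 0 \<longleftrightarrow> y \<in> supp p" if "y \<in> C" for y
      by (rule nz) (use that C_less in auto)
    have "(\<forall>(r, nz)\<in>set ?cs. s r \<noteq> 0 \<longleftrightarrow> nz) \<longleftrightarrow>
      (\<forall>y\<in>set ?zs. s (b0 + 2 * y) \<noteq> 0) \<and>
      (\<forall>z\<in>set (filter (\<lambda>z. z \<notin> C \<and> (\<exists>y\<in>C. \<not> E y z)) [0..<n]). s (b0 + 2 * z) = 0)"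
      unfolding set_append set_map ball_Un ball_simps(9) prod.case by blast
    also have "\<dots> \<longleftrightarrow> (\<forall>y\<in>C. s (b0 + 2 * y) \<noteq> 0) \<and>
      (\<forall>z<n. z \<notin> C \<and> (\<exists>y\<in>C. \<not> E y z) \<longrightarrow> s (b0 + 2 * z) = 0)"
      using C_less unfolding zs(1) set_filter set_upt by auto
    also have "\<dots> \<longleftrightarrow> (\<forall>y\<in>C. y \<in> supp p) \<and> (\<forall>z<n. z \<notin> C \<and> (\<exists>y\<in>C. \<not> E y z) \<longrightarrow> z \<notin> supp p)"
      using nz nzC by blast
    also have "\<dots> \<longleftrightarrow> closed_in C (supp p)" using Sn unfolding closed_in_def by blast
    finally show ?thesis .
  qed
  show ?thesis
  proof (cases "closed_in C (supp p)")
    case False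
    then have "sem g block_com s = s" unfolding block_com_def sem_guard gd by simp
    then show ?thesis using False by simp
  next
    case True
    let ?p = "res C p" and ?q = "res C q"
    \<comment> \<open>Letters outside \<open>C\<close> commute with \<open>z\<close>, as
      \<open>C\<close> is closed in the support, and so leave no entry on its stack.\<close>
    have pile_res: "pile (res C w) z = pile w z" if "z \<in> C" "supp w = supp p" for w z
    proof -
      have "\<not> E (vtx a) z \<longleftrightarrow> vtx a \<in> C \<and> \<not> E (vtx a) z" if "a \<in> set w" for a
      proof (cases "vtx a \<in> C")
        case False
        then have "vtx a \<in> supp p - C" using \<open>supp w = supp p\<close> that by blast
        then have "E z (vtx a)" using True \<open>z \<in> C\<close> unfolding closed_in_def by blast
        then show ?thesis using E_sym False by blast
      qed simp
      then show ?thesis unfolding pile_def filter_filter by (intro arg_cong[of _ _ "map _"] filter_cong) auto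
    qed
    have cw: "cword ?p" "cword ?q"
      using True v S supp_res[of C p] supp_res[of C q] by (auto simp: cword_def closed_in_def valid_word_def)
    have cp: "(\<lambda>z. if z \<in> set ?zs then pile p z else []) = cpile ?p"
      "(\<lambda>z. if z \<in> set ?zs then pile q z else []) = cpile ?q"
      using pile_res S unfolding zs(1) by (auto simp: cpile_def fun_eq_iff)
    have t2: "tgts (copy b0 b2 ?zs) \<subseteq> bank b2" and t3: "tgts (copy b1 b3 ?zs) \<subseteq> bank b3"
      using tgts_copy[OF zs(3)] by blast+
    define s1 where "s1 = sem g (copy b0 b2 ?zs) s"
    define s2 where "s2 = sem g (copy b1 b3 ?zs) s1"
    have f1: "s1 r = s r" if "r \<notin> bank b2" for r using sem_frame t2 that unfolding s1_def by blast
    have f2: "s2 r = s1 r" if "r \<notin> bank b3" for r using sem_frame t3 that unfolding s2_def by blast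
    have h1: "holds b2 (cpile ?p) s1" using copy[OF h(1) _ zs(2,3), of b2 g] cp by (simp add: s1_def)
    have "holds b1 (pile q) s1" by (rule holds_cong[OF h(2)]) (rule f1[OF banks_disjointD(5)])
    then have h3: "holds b3 (cpile ?q) s2" using copy[OF _ _ zs(2,3), of b1 "pile q" s1 b3 g] cp by (simp add: s2_def)
    have h2: "holds b2 (cpile ?p) s2" by (rule holds_cong[OF h1]) (rule f2[OF banks_disjointD(9)])
    have L2: "s2 2 = int L" using f1[of 2] f2[of 2] L by simp
    have ln: "length ?p < L" "length ?q < L" using L length_filter_le le_less_trans by blast+
    have t: "2 \<notin> tgts (next_com b3 Skip)" "3 \<notin> tgts (next_com b3 Skip)" "2 \<notin> tgts orbit_body" "3 \<notin> tgts orbit_body"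
      using tgts_next_com[of b3 Skip] tgts_orbit_body banks_low(4)[of 2] banks_low(4)[of 3] banks_low(3)[of 2] banks_low(3)[of 3]
      by fastforce+
    define m where "m = (n + 1) * L"
    have mb: "n * length ?q < m"
    proof -
      have "n * length ?q \<le> n * L" using ln(2) by (intro mult_le_mono2) simp
      also have "\<dots> < n * L + L" using ln(2) by simp
      finally show ?thesis by (simp add: m_def add.commute)
    qed
    define Q where "Q = (next_stab ^^ m) (cpile ?q)"
    define s3 where "s3 = (sem g (next_com b3 Skip) ^^ m) s2"
    have fr3: "s3 r = s2 r" if "r \<notin> bank b3" "r \<noteq> 9" for r
    proof -
      have "r \<notin> tgts (Loop (Num (int m)) (next_com b3 Skip))" using tgts_next_com[of b3 Skip] that by auto
      from sem_frame[OF this, of g s2] show ?thesis by (simp add: s3_def)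
    qed
    have "holds b3 ((next_stab ^^ k) (cpile ?q)) ((sem g (next_com b3 Skip) ^^ k) s2)" for k
      by (induction k) (use h3 next_stab_com[of b3] in auto)
    then have hQ: "holds b3 Q s3" by (simp add: s3_def Q_def)
    have hP: "holds b2 (cpile ?p) s3"
    proof (rule holds_cong[OF h2])
      fix r assume r: "r \<in> bank b2"
      then have "r \<noteq> 9" using banks_low(3)[of 9] by auto
      then show "s3 r = s2 r" using fr3 banks_disjointD(9)[OF r] by blast
    qed
    define I where "I k t \<longleftrightarrow> holds b2 ((next_fire ^^ k) (cpile ?p)) t \<and> holds b3 Q t \<and> t 3 = s 3 \<and>
      t 7 = (if \<exists>j<k. (next_fire ^^ j) (cpile ?p) = Q then 1 else 0)" for k and t :: "nat \<Rightarrow> int"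
    have "3 \<notin> bank b2" "3 \<notin> bank b3" by simp_all
    then have "s3 3 = s 3" using fr3[of 3] f2[of 3] f1[of 3] by simp
    then have I0: "I 0 (s3(7 := 0))" using hP hQ unfolding I_def by (auto elim!: holds_cong)
    \<comment> \<open>Outside \<open>C\<close> both pilings are empty, so comparing the stored
      stacks decides whether the two functions are equal.\<close>
    have Qw: "Q z = []" if "z \<notin> C" for z
    proof -
      have "\<exists>v. Q = cpile v"
        using stabilize[OF cw(2) mb] unfolding Q_def by blast
      then show ?thesis using that by (auto simp: cpile_def)
    qed
    have step: "I (Suc k) (sem g orbit_body t)" if I: "I k t" for k t
    proof -
      let ?P = "(next_fire ^^ k) (cpile ?p)"
      obtain w where w: "cword w" "?P = cpile w" using next_fire_rots[OF cw(1)] by blast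
      define t1 where "t1 = sem g (eq_com b2 b3) t"
      define t2 where "t2 = (if t1 8 \<noteq> 0 then t1(7 := 1) else t1)"
      have tI: "holds b2 ?P t" "holds b3 Q t" using I by (auto simp: I_def)
      have ft1: "t1 r = t r" if "r \<noteq> 8" for r using sem_frame[of r "eq_com b2 b3" g t] tgts_eq_com[of b2 b3] that by (auto simp: t1_def)
      have "(\<forall>z<n. ?P z = Q z) \<longleftrightarrow> ?P = Q"
      proof
        assume *: "\<forall>z<n. ?P z = Q z"
        have "?P z = Q z" for z
        proof (cases "z \<in> C")
          case True
          then show ?thesis using * C_less by auto
        next
          case False
          then show ?thesis using w Qw by (simp add: cpile_def)
        qed
        then show "?P = Q" by blast
      qed simp
      then have t8: "t1 8 = (if ?P = Q then 1 else 0)" using eq_com[OF tI, of g] by (simp add: t1_def)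
      have ht1: "holds b2 ?P t1" "holds b3 Q t1"
      proof -
        have n8: "8 \<notin> bank b2" "8 \<notin> bank b3" by simp_all
        show "holds b2 ?P t1" by (rule holds_cong[OF tI(1)]) (rule ft1, use n8 in blast)
        show "holds b3 Q t1" by (rule holds_cong[OF tI(2)]) (rule ft1, use n8 in blast)
      qed
      have ht2: "holds b2 ?P t2" "holds b3 Q t2"
        using ht1 by (auto simp: t2_def elim!: holds_cong)
      have e: "sem g orbit_body t = sem g (next_com b2 (fire_com b2 x)) t2"
        by (simp add: orbit_body_def t2_def t1_def)
      have n9: "9 \<notin> bank b2" by simp
      have hn: "holds b2 (next_fire ?P) (sem g (next_com b2 (fire_com b2 x)) t2)"
        by (rule next_fire_com[OF ht2(1) n9]) (use stable_apex w in auto)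
      have fn: "sem g (next_com b2 (fire_com b2 x)) t2 r = t2 r" if "r \<notin> bank b2" "r \<noteq> 9" for r
        using sem_frame[of r "next_com b2 (fire_com b2 x)" g t2] tgts_next_com[of b2 "fire_com b2 x"]
          tgts_fire_com[of b2 x] that by auto
      have "holds b3 Q (sem g (next_com b2 (fire_com b2 x)) t2)"
      proof (rule holds_cong[OF ht2(2)])
        fix r assume r: "r \<in> bank b3"
        then have "r \<noteq> 9" using banks_low(4)[of 9] by auto
        then show "sem g (next_com b2 (fire_com b2 x)) t2 r = t2 r" using fn banks_disjointD(12)[OF r] by blast
      qed
      moreover have "t2 3 = t 3" "t2 7 = (if ?P = Q then 1 else t 7)" using ft1 t8 by (auto simp: t2_def)
      ultimately show ?thesis
        unfolding e using hn fn[of 3] fn[of 7] I by (auto simp: I_def less_Suc_eq)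
    qed
    have "I k ((sem g orbit_body ^^ k) (s3(7 := 0)))" for k
      by (induction k) (simp_all add: I0 step del: fun_upd_apply)
    from this[of "(n + 2) * L"]
    have fin: "I ((n + 2) * L) ((sem g orbit_body ^^ ((n + 2) * L)) (s3(7 := 0)))" .
    have L3: "(s3(7 := 0)) 2 = int L" using fr3[of 2] L2 by simp
    have "sem g (seqs (replicate (n + 1) (Loop (Var 2) (next_com b3 Skip)))) s2 = s3"
      using sem_repeat[OF t(1), where s = s2 and L = L and m = "n + 1" and g = g] L2 by (simp only: s3_def m_def)
    moreover have "sem g (seqs (replicate (n + 2) (Loop (Var 2) orbit_body))) (s3(7 := 0)) = (sem g orbit_body ^^ ((n + 2) * L)) (s3(7 := 0))"
      using sem_repeat[OF t(3), where s = "s3(7 := 0)" and L = L and m = "n + 2" and g = g] L3 by (simp only:)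
    ultimately have "sem g block_com s = sem g (Cond (Var 7) Skip (Assign 3 (Num 0))) ((sem g orbit_body ^^ ((n + 2) * L)) (s3(7 := 0)))"
      unfolding block_com_def sem_guard gd using True
      by (simp only: if_True sem.simps s1_def[symmetric] s2_def[symmetric] aval.simps)
    then have "sem g block_com s 3 = (if \<exists>j<(n + 2) * L. (next_fire ^^ j) (cpile ?p) = Q then s 3 else 0)"
      using fin by (auto simp: I_def)
    moreover have "rots ?p ?q \<longleftrightarrow> (\<exists>j<(n + 2) * L. (next_fire ^^ j) (cpile ?p) = Q)"
      unfolding Q_def
    proof (rule rots_iff_orbit[OF cw])
      show "n * length ?q < m"
        by (rule mb)
      show "(n + 2) * length ?p \<le> (n + 2) * L" using ln by (intro mult_le_mono2) simp
    qed
    ultimately show ?thesis using True by auto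
  qed
qed

end

section \<open>Assembling the blocks\<close>

context inversion_twist
begin

text \<open>The task of a block, stated without its apex and enumeration. Each block comes from its
  own instance of \<open>component\<close>, and this form lets the blocks for all \<open>C\<close>
  be combined in one program.\<close>

definition block_spec :: "nat set \<Rightarrow> com \<Rightarrow> bool" where
  "block_spec C c \<longleftrightarrow> linear c \<and> tgts c \<subseteq> {3, 7, 8, 9} \<union> bank b2 \<union> bank b3 \<and>
     (\<forall>g s. sem g c s 3 = s 3 \<or> sem g c s 3 = 0) \<and>
     (\<forall>g s p q L. holds b0 (pile p) s \<longrightarrow> holds b1 (pile q) s \<longrightarrow> valid p \<longrightarrow> valid q \<longrightarrow>
        supp p = supp q \<longrightarrow> s 2 = int L \<longrightarrow> length p < L \<longrightarrow> length q < L \<longrightarrow>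
        sem g c s 3 = (if closed_in C (supp p) \<and> \<not> rots (res C p) (res C q) then 0 else s 3))"

lemma block_exists:
  assumes "stack_conn C" "C \<subseteq> {..<n}"
  shows "\<exists>c. block_spec C c"
proof -
  obtain x where x: "x \<in> C" using assms(1) unfolding stack_conn_def by blast
  have "finite (C - {x})" using assms(2) finite_subset by blast
  then obtain ys where ys: "set ys = C - {x}" using finite_list by blast
  interpret component n E F C x ys
    by (intro component.intro component_axioms.intro inversion_twist_axioms assms x ys)
  have "block_spec C block_com"
    unfolding block_spec_def
    by (intro conjI allI impI linear_block_com tgts_block_com block_com_zero) (rule block_com)
  then show ?thesis by blast
qed

text \<open>A block is prepared for every connected set of vertices; their number depends on the
  graph alone. A block whose set is not a component of the actual support switches itself
  off.\<close>

theorem linear_program: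
  obtains c where "safe c" "linear c"
    "\<And>g s u v. valid u \<Longrightarrow> valid v \<Longrightarrow> s 2 = int (length (encode_pair u v)) \<Longrightarrow>
       \<forall>i<length (encode_pair u v). g (int i + 1) = encode_pair u v ! i \<Longrightarrow>
       sem g c s 3 = (if tw u v then 1 else 0)"
proof -
  have "finite {C. C \<subseteq> {..<n} \<and> stack_conn C}" by simp
  then obtain Cs where Cs: "set Cs = {C. C \<subseteq> {..<n} \<and> stack_conn C}" using finite_list by blast
  have "\<forall>C\<in>set Cs. \<exists>c. block_spec C c" using block_exists Cs by blast
  then obtain blk where blk: "\<And>C. C \<in> set Cs \<Longrightarrow> block_spec C (blk C)" by metis
  define prog where "prog = Seq read_com (Seq (reduce_com b0) (Seq (reduce_com b1)
    (Seq (Assign 3 (Num 1)) (Seq supp_com (seqs (map blk Cs))))))"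
  have tgb: "tgts (seqs (map blk Cs)) \<subseteq> {3, 7, 8, 9} \<union> bank b2 \<union> bank b3"
  proof -
    have "tgts (blk C) \<subseteq> {3, 7, 8, 9} \<union> bank b2 \<union> bank b3" if "C \<in> set Cs" for C
      using blk[OF that] by (simp only: block_spec_def)
    then show ?thesis unfolding tgts_seqs set_map by blast
  qed
  have lin: "linear prog"
  proof -
    have "linear (blk C)" if "C \<in> set Cs" for C
      using blk[OF that] by (simp only: block_spec_def)
    then show ?thesis by (simp add: prog_def)
  qed
  have "tgts prog \<subseteq> {3, 4, 5, 6, 7, 8, 9} \<union> bank b0 \<union> bank b1 \<union> bank b2 \<union> bank b3"
    using tgts_read_com tgts_reduce_com[of b0] tgts_reduce_com[of b1] tgts_supp_com tgb
    unfolding prog_def tgts.simps by blast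
  moreover have "3 \<le> r" if "r \<in> {3, 4, 5, 6, 7, 8, 9} \<union> bank b0 \<union> bank b1 \<union> bank b2 \<union> bank b3" for r
    using that by (auto simp: bank_def)
  ultimately have saf: "safe prog" unfolding safe_iff_tgts by blast
  have zero: "sem g (seqs (map blk Ds)) s 3 = 0" if "set Ds \<subseteq> set Cs" "s 3 = 0" for g Ds s
    using that
  proof (induction Ds arbitrary: s)
    case (Cons C Ds)
    have "block_spec C (blk C)" using blk Cons.prems by simp
    then have "sem g (blk C) s 3 = s 3 \<or> sem g (blk C) s 3 = 0" unfolding block_spec_def by blast
    then have "sem g (blk C) s 3 = 0" using Cons.prems by simp
    then show ?case using Cons by simp
  qed simp
  have blocks: "sem g (seqs (map blk Ds)) s 3 =
      (if \<exists>C\<in>set Ds. closed_in C (supp p) \<and> \<not> rots (res C p) (res C q) then 0 else s 3)"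
    if "set Ds \<subseteq> set Cs" "holds b0 (pile p) s" "holds b1 (pile q) s" "valid p" "valid q"
      "supp p = supp q" "s 2 = int L" "length p < L" "length q < L" for g Ds s p q L
    using that
  proof (induction Ds arbitrary: s)
    case (Cons C Ds)
    have spec: "block_spec C (blk C)" using blk Cons.prems by simp
    let ?s = "sem g (blk C) s"
    have t: "tgts (blk C) \<subseteq> {3, 7, 8, 9} \<union> bank b2 \<union> bank b3"
      using spec by (simp only: block_spec_def)
    have low: "r \<notin> {3, 7, 8, 9}" if "r \<in> bank b0 \<or> r \<in> bank b1" for r
      using that by (auto simp: bank_def)
    have d0: "bank b0 \<inter> tgts (blk C) = {}"
      using t low banks_disjointD(2,3) by blast
    have d1: "bank b1 \<inter> tgts (blk C) = {}"
      using t low banks_disjointD(5,6) by blast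
    have s2: "?s 2 = int L" using sem_frame[OF not_tgts[OF t], of 2] Cons.prems by simp
    have s3: "?s 3 = (if closed_in C (supp p) \<and> \<not> rots (res C p) (res C q) then 0 else s 3)"
      using spec Cons.prems unfolding block_spec_def by blast
    have "sem g (seqs (map blk Ds)) ?s 3 =
      (if \<exists>C\<in>set Ds. closed_in C (supp p) \<and> \<not> rots (res C p) (res C q) then 0 else ?s 3)"
      using Cons.prems holds_frame[OF Cons.prems(2) d0] holds_frame[OF Cons.prems(3) d1] s2
      by (intro Cons.IH) simp_all
    then show ?case using s3 by auto
  qed simp
  have main: "sem g prog s 3 = (if tw u v then 1 else 0)"
    if uv: "valid u" "valid v" and len: "s 2 = int (length (encode_pair u v))"
      and g: "\<forall>i<length (encode_pair u v). g (int i + 1) = encode_pair u v ! i" for g s u v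
  proof -
    define L where "L = length (encode_pair u v)"
    define s1 where "s1 = sem g read_com s"
    define s2 where "s2 = sem g (reduce_com b0) s1"
    define s3 where "s3 = sem g (reduce_com b1) s2"
    define s4 where "s4 = s3(3 := 1)"
    define s5 where "s5 = sem g supp_com s4"
    have h1: "holds b0 (nfp u) s1" "holds b1 (nfp v) s1"
      using read_com[of u v s g, OF uv len g] by (simp_all add: s1_def)
    have L1: "s1 2 = int L"
      using sem_frame[OF not_tgts[OF tgts_read_com], of 2 g s] len by (simp add: s1_def L_def)
    have L2: "s2 2 = int L"
      using sem_frame[OF not_tgts[OF tgts_reduce_com], of 2 b0 g s1] L1 by (simp add: s2_def)
    have L3: "s3 2 = int L"
      using sem_frame[OF not_tgts[OF tgts_reduce_com], of 2 b1 g s2] L2 by (simp add: s3_def)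
    obtain r where r: "valid r" "red r" "geq u r" "nfp u = pile r" "length r \<le> length u" using nfp_red[OF uv(1)] by blast
    obtain t where t: "valid t" "red t" "geq v t" "nfp v = pile t" "length t \<le> length v" using nfp_red[OF uv(2)] by blast
    have lens: "length r \<le> L" "length t \<le> L" "length r < L" "length t < L"
      using r(5) t(5) by (auto simp: L_def encode_pair_def)
    obtain p where p: "valid p" "red p" "irred p" "tw r p" "length p \<le> length r"
      "(fold strip_if [0..<n] ^^ L) (pile r) = pile p"
      using cyclic_reduction[OF r(1,2) lens(1)] by blast
    obtain q where q: "valid q" "red q" "irred q" "tw t q" "length q \<le> length t"
      "(fold strip_if [0..<n] ^^ L) (pile t) = pile q"
      using cyclic_reduction[OF t(1,2) lens(2)] by blast
    have p2: "holds b0 (pile p) s2"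
      using reduce_com[OF h1(1) L1, of g] r(4) p(6) by (simp add: s2_def)
    have d01: "bank b1 \<inter> tgts (reduce_com b0) = {}" "bank b0 \<inter> tgts (reduce_com b1) = {}"
      using tgts_reduce_com[of b0] tgts_reduce_com[of b1] banks_disjointD(1,4) by blast+
    have "holds b1 (nfp v) s2" unfolding s2_def by (rule holds_frame[OF h1(2) d01(1)])
    then have q3: "holds b1 (pile q) s3"
      using reduce_com[where b = b1 and P = "nfp v" and s = s2 and L = L and g = g] L2 t(4) q(6) by (simp add: s3_def)
    have p3: "holds b0 (pile p) s3" unfolding s3_def by (rule holds_frame[OF p2 d01(2)])
    have h4: "holds b0 (pile p) s4" "holds b1 (pile q) s4"
      unfolding s4_def by (rule holds_upd[OF p3], simp) (rule holds_upd[OF q3], simp)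
    have h5: "holds b0 (pile p) s5" "holds b1 (pile q) s5"
      unfolding s5_def
    proof -
      have "3 \<notin> bank b0" "3 \<notin> bank b1" by simp_all
      then have "bank b0 \<inter> tgts supp_com = {}" "bank b1 \<inter> tgts supp_com = {}"
        using tgts_supp_com by blast+
      then show "holds b0 (pile p) (sem g supp_com s4)" "holds b1 (pile q) (sem g supp_com s4)"
        using holds_frame[OF h4(1)] holds_frame[OF h4(2)] by blast+
    qed
    have L5: "s5 2 = int L"
      using sem_frame[OF not_tgts[OF tgts_supp_com], of 2 g s4] L3 by (simp add: s5_def s4_def)
    have s53: "s5 3 = (if supp p = supp q then 1 else 0)"
      using supp_com[OF h4 p(1) q(1)] by (simp add: s5_def s4_def)
    have e: "sem g prog s 3 = sem g (seqs (map blk Cs)) s5 3"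
      by (simp add: prog_def s5_def s4_def s3_def s2_def s1_def)
    have tw_rots: "tw u v \<longleftrightarrow> rots p q"
      by (rule tw_iff_rots[OF uv p(1,2,3) q(1,2,3)])
        (rule tw_trans[OF tw_geq[OF r(3)] p(4)], rule tw_trans[OF tw_geq[OF t(3)] q(4)])
    show ?thesis
    proof (cases "supp p = supp q")
      case False
      then have "\<not> rots p q" using rots_supp by blast
      moreover have "sem g (seqs (map blk Cs)) s5 3 = 0" using zero[of Cs s5 g] s53 False by simp
      ultimately show ?thesis using tw_rots e by simp
    next
      case True
      have "length p < L" "length q < L" using lens p(5) q(5) by simp_all
      then have b: "sem g (seqs (map blk Cs)) s5 3 =
        (if \<exists>C\<in>set Cs. closed_in C (supp p) \<and> \<not> rots (res C p) (res C q) then 0 else 1)"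
        using blocks[OF subset_refl h5 p(1) q(1) True L5, of g] s53 True by simp
      have "rots p q \<longleftrightarrow> \<not> (\<exists>C\<in>set Cs. closed_in C (supp p) \<and> \<not> rots (res C p) (res C q))"
      proof
        assume "rots p q"
        then show "\<not> (\<exists>C\<in>set Cs. closed_in C (supp p) \<and> \<not> rots (res C p) (res C q))" using rots_res by blast
      next
        assume *: "\<not> (\<exists>C\<in>set Cs. closed_in C (supp p) \<and> \<not> rots (res C p) (res C q))"
        show "rots p q"
        proof (rule rots_components[OF refl True[symmetric]])
          fix C assume C: "stack_conn C" "closed_in C (supp p)"
          then have "C \<subseteq> {..<n}" using vtx_valid_word[OF p(1)] unfolding closed_in_def by blast
          then show "rots (res C p) (res C q)" using C * Cs by blast
        qed
      qed
      then show ?thesis using tw_rots e b by simp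
    qed
  qed
  show ?thesis using that[OF saf lin] main by blast
qed

end

section \<open>Passing from the automorphism to its letter map\<close>

theorem theorem4p1:
  fixes n :: nat and E :: "nat \<Rightarrow> nat \<Rightarrow> bool" and f :: "nat \<Rightarrow> int list"
  assumes "simple_graph n E"
    and "raag_aut n E f"
    and "length_preserving n E f"
  shows "(\<exists>P. solves_TCP n E f P) \<and>
         (is_comp_of_inversions n E f \<longrightarrow> (\<exists>P c. solves_TCP_linear n E f P c))"
proof -
  interpret raag n E by unfold_locales (rule assms(1))
  obtain F where F: "twist n E F" "\<And>w. valid w \<Longrightarrow> geq (hom f w) (map F w)"
    "\<And>a. \<not> valid_letter n a \<Longrightarrow> F a = a"
    using length_preserving_letter_map[OF assms(2,3)] by blast
  interpret twist n E F by (rule F(1))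
  note tc = twisted_conj_iff_tw[OF F(2)]
  have ne: "encode_pair u v \<noteq> []" for u v by (simp add: encode_pair_def)
  have "\<exists>P. solves_TCP n E f P"
  proof -
    obtain P k where P: "\<forall>inp b. inp \<noteq> [] \<longrightarrow>
      (\<forall>g s. s 2 = int (length inp) \<longrightarrow> (\<forall>i<length inp. g (int i + 1) = inp ! i) \<longrightarrow>
         sem g search_com s 3 = (if b then 1 else 0)) \<longrightarrow>
      (\<exists>t g s. s 2 = int (length inp) \<and> t \<le> cost g search_com s + k \<and> outputs_in P inp t b)"
      using ram_program[OF safe_search_com order_refl] by (elim exE) (rule that)
    have "\<exists>t. outputs_in P (encode_pair u v) t (twisted_conj n E f u v)" if uv: "valid u" "valid v" for u v
    proof -
      have "\<forall>g s. s 2 = int (length (encode_pair u v)) \<longrightarrow>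
          (\<forall>i<length (encode_pair u v). g (int i + 1) = encode_pair u v ! i) \<longrightarrow>
          sem g search_com s 3 = (if twisted_conj n E f u v then 1 else 0)"
        using search_com[OF uv] tc[of u v] by simp
      from P[THEN spec, THEN spec, THEN mp, THEN mp, OF ne this] show ?thesis by blast
    qed
    then show ?thesis unfolding solves_TCP_def by blast
  qed
  moreover have "\<exists>P c. solves_TCP_linear n E f P c" if inv: "is_comp_of_inversions n E f"
  proof -
    \<comment> \<open>A composition of inversions sends each vertex to a word that literally is one
      letter at that vertex. \<open>f\<close> agrees with it only as a map to the group, and
      \<open>geq_single_eq\<close> turns this into equality of letters for \<open>F\<close>.\<close>
    have sign: "\<exists>b. h v = [b] \<and> (b = int v + 1 \<or> b = - (int v + 1))" if "comp_inversions n h" for h v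
      using that
    proof (induction arbitrary: v)
      case (base x)
      then show ?case by (simp add: inversion_def)
    next
      case (comp h1 h2)
      have vt: "vtx (int v + 1) = v" "vtx (- (int v + 1)) = v" by (auto simp: vtx_def)
      obtain b c where b: "h2 v = [b]" "b = int v + 1 \<or> b = - (int v + 1)"
        and c: "h1 v = [c]" "c = int v + 1 \<or> c = - (int v + 1)" using comp.IH by blast
      show ?case using b(2)
      proof
        assume "b = int v + 1"
        then show ?thesis using b(1) c vt by auto
      next
        assume "b = - (int v + 1)"
        then show ?thesis using b(1) c vt by auto
      qed
    qed
    obtain h where h: "comp_inversions n h" "\<And>v. v < n \<Longrightarrow> geq (f v) (h v)"
      using inv unfolding is_comp_of_inversions_def by blast
    have pos: "F (int v + 1) = int v + 1 \<or> F (int v + 1) = - (int v + 1)" if v: "v < n" for v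
    proof -
      obtain b where b: "h v = [b]" "b = int v + 1 \<or> b = - (int v + 1)" using sign[OF h(1)] by blast
      have vl: "valid_letter n (int v + 1)" using v by (auto simp: valid_letter_def)
      then have "valid_letter n b" using b(2) valid_letter_minus[of n "int v + 1"] by metis
      have "hom f [int v + 1] = f v" by (simp add: vtx_def nat_add_distrib)
      then have "geq (f v) [F (int v + 1)]" using F(2)[of "[int v + 1]"] vl by simp
      from geq_trans[OF geq_sym[OF this] h(2)[OF v]] have "geq [F (int v + 1)] [b]" by (simp add: b(1))
      then have "F (int v + 1) = b" by (rule geq_single_eq) (simp_all add: vl \<open>valid_letter n b\<close>)
      then show ?thesis using b(2) by simp
    qed
    have pm: "F a = a \<or> F a = - a" for a
    proof (cases "valid_letter n a")
      case True
      then have a: "a = int (vtx a) + 1 \<or> a = - (int (vtx a) + 1)"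
        by (auto simp: valid_letter_def vtx_def)
      show ?thesis using a
      proof
        assume "a = int (vtx a) + 1"
        then show ?thesis using pos[OF vtx_less[OF True]] by metis
      next
        assume "a = - (int (vtx a) + 1)"
        then have "- a = int (vtx a) + 1" by simp
        then have "F (- a) = - a \<or> F (- a) = - (- a)" using pos[OF vtx_less[OF True]] by metis
        then show ?thesis by auto
      qed
    qed (use F(3) in simp)
    interpret inversion_twist n E F by unfold_locales (rule pm)
    obtain c where c: "safe c" "linear c"
      "\<And>g s u v. valid u \<Longrightarrow> valid v \<Longrightarrow> s 2 = int (length (encode_pair u v)) \<Longrightarrow>
       \<forall>i<length (encode_pair u v). g (int i + 1) = encode_pair u v ! i \<Longrightarrow>
       sem g c s 3 = (if tw u v then 1 else 0)"
      using linear_program by blast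
    obtain k where k: "\<And>g s L. s 2 = int L \<Longrightarrow> cost g c s \<le> k * (L + 1)"
      using cost_linear[OF c(2,1)] by blast
    obtain P l where P: "\<forall>inp b. inp \<noteq> [] \<longrightarrow>
      (\<forall>g s. s 2 = int (length inp) \<longrightarrow> (\<forall>i<length inp. g (int i + 1) = inp ! i) \<longrightarrow>
         sem g c s 3 = (if b then 1 else 0)) \<longrightarrow>
      (\<exists>t g s. s 2 = int (length inp) \<and> t \<le> cost g c s + l \<and> outputs_in P inp t b)"
      using ram_program[OF c(1) order_refl] by (elim exE) (rule that)
    \<comment> \<open>The encoded pair has one symbol more than the two words, so the cost is at
      most \<open>k * (length u + length v + 2)\<close>; doubling \<open>k\<close> absorbs the 2,
      and \<open>l\<close> covers the constant overhead of the compiled program.\<close>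
    have "\<exists>t. t \<le> (2 * k + l) * (length u + length v + 1) \<and>
        outputs_in P (encode_pair u v) t (twisted_conj n E f u v)" if uv: "valid u" "valid v" for u v
    proof -
      have "\<forall>g s. s 2 = int (length (encode_pair u v)) \<longrightarrow>
          (\<forall>i<length (encode_pair u v). g (int i + 1) = encode_pair u v ! i) \<longrightarrow>
          sem g c s 3 = (if twisted_conj n E f u v then 1 else 0)"
        using c(3)[OF uv] tc[of u v] by simp
      from P[THEN spec, THEN spec, THEN mp, THEN mp, OF ne this]
      obtain t g s where t: "s 2 = int (length (encode_pair u v))" "t \<le> cost g c s + l"
        "outputs_in P (encode_pair u v) t (twisted_conj n E f u v)" by blast
      have "t \<le> k * (length u + length v + 2) + l"
        using t(2) k[where s = s and g = g and L = "length (encode_pair u v)"] t(1) by (simp add: encode_pair_def)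
      also have "\<dots> \<le> (2 * k + l) * (length u + length v + 1)" by (simp add: algebra_simps)
      finally show ?thesis using t(3) by blast
    qed
    then show ?thesis unfolding solves_TCP_linear_def by blast
  qed
  ultimately show ?thesis by blast
qed

end
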